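(* Let $k = 2\ell$ be an even integer, and for $z, \tau$ in the upper half plane write $q = e^{2\pi i z}$. Then $$\sum_{m \geq -\ell} f_{k,m}^{(4)}(\tau) q^m = \frac{f_{k,-\ell}^{(4)}(\tau)\, g_{2-k,\ell+1}^{(4)}(z)}{f_{0,1}^{(4)}(z) - f_{0,1}^{(4)}(\tau)} = -\sum_{m \geq \ell+1} g_{2-k,m}^{(4)}(z)\, e^{2\pi i m \tau},$$ where the first equality is the expansion in powers of $q = e^{2\pi i z}$, valid for each fixed $\tau$ and all $z$ with $\mathrm{Im}(z)$ sufficiently large (depending on $\tau$), and the second equality is the expansion in powers of $e^{2\pi i \tau}$, valid for each fixed $z$ and all $\tau$ with $\mathrm{Im}(\tau)$ sufficiently large (depending on $z$).
   Context: $\Gamma_0(4) = \left\{ \begin{pmatrix} a & b \\ c & d\end{pmatrix} \in \mathrm{SL}_2(\mathbb{Z}) : c \equiv 0 \pmod 4 \right\}$. $M_k^\sharp(4)$ is the space of weakly holomorphic modular forms of even integer weight $k$ for $\Gamma_0(4)$ (holomorphic on the upper half plane, meromorphic at the cusps) that are holomorphic away from the cusp at $\infty$, i.e. also holomorphic at the cusps $0$ and $\frac12$. For an even weight $k = 2\ell$ and an integer $m \ge -\ell$, $f_{k,m}^{(4)}$ is the unique element of $M_k^\sharp(4)$ with Fourier expansion $$f_{k,m}^{(4)}(z) = q^{-m} + \sum_{n=\ell+1}^\infty a_k^{(4)}(m,n) q^n.$$ For an even weight $k = 2\ell$ and an integer $m \ge -\ell+2$, $g_{k,m}^{(4)}$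 is the unique element of $M_k^\sharp(4)$ that vanishes at the cusps $0$ and $\frac12$ and has Fourier expansion $$g_{k,m}^{(4)}(z) = q^{-m} + \sum_{n=\ell-1}^\infty b_k^{(4)}(m,n) q^n.$$ (In particular, for $k = 2\ell$, the form $g_{2-k,m}^{(4)}$ is defined for $m \ge \ell+1$.) *)

theory Defs
  imports "HOL-Complex_Analysis.Complex_Analysis"
begin

definition upper_half_plane :: "complex set" where
  "upper_half_plane = {z. Im z > 0}"

definition SL2Z :: "(int ^ 2 ^ 2) set" where
  "SL2Z = {A. det A = 1}"

definition Gamma0_4 :: "(int ^ 2 ^ 2) set" where
  "Gamma0_4 = {A \<in> SL2Z. 4 dvd A $ 2 $ 1}"

definition moebius_act :: "int ^ 2 ^ 2 \<Rightarrow> complex \<Rightarrow> complex" where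
  "moebius_act A z =
     (of_int (A $ 1 $ 1) * z + of_int (A $ 1 $ 2)) / (of_int (A $ 2 $ 1) * z + of_int (A $ 2 $ 2))"

definition slash :: "int \<Rightarrow> int ^ 2 ^ 2 \<Rightarrow> (complex \<Rightarrow> complex) \<Rightarrow> complex \<Rightarrow> complex" where
  "slash k A F z =
     (of_int (A $ 2 $ 1) * z + of_int (A $ 2 $ 2)) powi (- k) * F (moebius_act A z)"

definition qpar :: "complex \<Rightarrow> complex" where
  "qpar z = exp (2 * of_real pi * \<i> * z)"

(* For F of level Gamma_0(4), the function slash k A F has period 4 for every A in SL_2(Z),
   because Gamma(4) is contained in Gamma_0(4) and normal in SL_2(Z).  So q^(1/4) can be used
   as parameter at every cusp, whatever its width; N is measured in powers of q^(1/4). *)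
definition cusp_order_ge :: "int \<Rightarrow> int ^ 2 ^ 2 \<Rightarrow> (complex \<Rightarrow> complex) \<Rightarrow> int \<Rightarrow> bool" where
  "cusp_order_ge k A F N \<longleftrightarrow>
     (\<exists>a :: int \<Rightarrow> complex. \<forall>z \<in> upper_half_plane.
        ((\<lambda>n. a n * qpar (z / 4) powi n) has_sum slash k A F z) {N..})"

(* The matrices A in SL_2(Z) that send infinity to the rational number s: for det A = 1 the
   equation below forces A $ 2 $ 1 to be nonzero. *)
definition to_cusp :: "rat \<Rightarrow> (int ^ 2 ^ 2) set" where
  "to_cusp s = {A \<in> SL2Z. of_int (A $ 1 $ 1) = s * of_int (A $ 2 $ 1)}"

definition holomorphic_at_cusp :: "int \<Rightarrow> rat \<Rightarrow> (complex \<Rightarrow> complex) \<Rightarrow> bool" where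
  "holomorphic_at_cusp k s F \<longleftrightarrow> (\<forall>A \<in> to_cusp s. cusp_order_ge k A F 0)"

definition vanishes_at_cusp :: "int \<Rightarrow> rat \<Rightarrow> (complex \<Rightarrow> complex) \<Rightarrow> bool" where
  "vanishes_at_cusp k s F \<longleftrightarrow> (\<forall>A \<in> to_cusp s. cusp_order_ge k A F 1)"

(* Modular forms are functions on the upper half plane; they are extended by 0 to all of the
   complex plane so that equality of forms is equality of HOL functions. *)
definition weakly_holomorphic_forms_4 :: "int \<Rightarrow> (complex \<Rightarrow> complex) set" where
  "weakly_holomorphic_forms_4 k = {F.
     F holomorphic_on upper_half_plane \<and>
     (\<forall>z. z \<notin> upper_half_plane \<longrightarrow> F z = 0) \<and>
     (\<forall>A \<in> Gamma0_4. \<forall>z \<in> upper_half_plane. slash k A F z = F z) \<and>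
     (\<forall>A \<in> SL2Z. \<exists>N. cusp_order_ge k A F N)}"

definition M_sharp_4 :: "int \<Rightarrow> (complex \<Rightarrow> complex) set" where
  "M_sharp_4 k = {F \<in> weakly_holomorphic_forms_4 k.
     holomorphic_at_cusp k 0 F \<and> holomorphic_at_cusp k (1 / 2) F}"

(* Meaningful for even k = 2 * l and m \<ge> - l. *)
definition f4 :: "int \<Rightarrow> int \<Rightarrow> complex \<Rightarrow> complex" where
  "f4 k m = (THE F. F \<in> M_sharp_4 k \<and>
     (\<exists>a :: int \<Rightarrow> complex. \<forall>z \<in> upper_half_plane.
        ((\<lambda>n. a n * qpar z powi n) has_sum (F z - qpar z powi (- m))) {k div 2 + 1..}))"

(* Meaningful for even k = 2 * l and m \<ge> - l + 2. *)
definition g4 :: "int \<Rightarrow> int \<Rightarrow> complex \<Rightarrow> complex" where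
  "g4 k m = (THE F. F \<in> M_sharp_4 k \<and> vanishes_at_cusp k 0 F \<and> vanishes_at_cusp k (1 / 2) F \<and>
     (\<exists>b :: int \<Rightarrow> complex. \<forall>z \<in> upper_half_plane.
        ((\<lambda>n. b n * qpar z powi n) has_sum (F z - qpar z powi (- m))) {k div 2 - 1..}))"

end

(*
  The form P(z) = eta(4z)^8/eta(2z)^4 of weight 2 vanishes only at infinity, to first order, and
  phi(z) = eta(z)^8/eta(4z)^8 has its only pole, a simple one, there.  Hence a form of weight 2l
  that is holomorphic away from infinity is P^l times a polynomial in phi, and every form of
  weight 0 without poles is constant by the maximum principle, which gives the uniqueness of
  f_{k,m} and g_{k,m}.

  Write phi = u(q)/q and P = q p(q).  Then f_{k,-l} = P^l and g_{2-k,l+1} = - P^(-l) q dphi/dq, so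
  that the kernel is P(tau)^l q^(-l) B(q)/(u(q) - phi(tau) q) with B = p^(-l) (u - q u').  Its
  coefficients in q are P(tau)^l times polynomials in phi(tau).  That these have the principal
  parts of the f_{k,m} follows by induction from the recursion for the coefficients of B/(u - t q);
  the one coefficient that the recursion does not control is a residue of r(phi) dphi for a
  polynomial r, which vanishes.  Exchanging the roles of p^l and B gives the g_{2-k,m}.

  The transformation behaviour of eta^4 is obtained from that of its logarithmic derivative, the
  conditionally convergent Eisenstein series of weight 2.
*)
theory Submission imports Defs begin

section \<open>Partial fractions of the cotangent\<close>

text \<open>The forms f and g are not constructed separately and then compared. One polynomial
  recursion, run with a pair (A, B) subject to A B = u - q u', yields forms with the required
  principal parts, so existence comes out of the same computation, and uniqueness then identifies
  them with the definite descriptions \<open>f4\<close> and \<open>g4\<close>. Swapping A and B is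
  the whole duality between the two families. The fourth power of eta is used because its factor
  under z -> -1/z is -z^2, so that no square root has to be chosen. The obstacle there is that the
  weight 2 double series does not converge absolutely: summation by rows and by columns gives
  different values. Subtracting a telescoping term from each summand makes the series absolutely
  convergent. The correction adds up to zero along rows but not along columns, and what it leaves is
  the non-modular term 2 pi i / z. The additive constant by which f_{0,1} differs from phi cancels
  in the denominator of the kernel.\<close>

lemma Digamma_reflection_complex:
  fixes z :: complex
  assumes z: "z \<notin> \<int>"
  shows "Digamma (1 - z) - Digamma z = of_real pi * cot (of_real pi * z)"
proof -
  have nz: "z \<notin> \<int>\<^sub>\<le>\<^sub>0" "1 - z \<notin> \<int>\<^sub>\<le>\<^sub>0"
    using z nonpos_Ints_subset_Ints Ints_diff[of 1 "1 - z"] by auto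
  have s: "sin (of_real pi * z) \<noteq> 0"
    using z by (auto simp: sin_eq_0)
  \<comment> \<open>Both sides of Gamma(z) Gamma(1 - z) = pi / sin(pi z) are differentiated;
    dividing by the nonzero product then gives the claim.\<close>
  have "((\<lambda>w. Gamma w * Gamma (1 - w)) has_field_derivative
          Gamma z * Gamma (1 - z) * (Digamma z - Digamma (1 - z))) (at z)"
    by (rule derivative_eq_intros refl nz | simp add: algebra_simps)+
  moreover have "((\<lambda>w. of_real pi / sin (of_real pi * w)) has_field_derivative
          - (of_real pi / sin (of_real pi * z)) * (of_real pi * cot (of_real pi * z))) (at z)"
    using s by (auto intro!: derivative_eq_intros simp: cot_def field_simps power2_eq_square)
  ultimately have "Gamma z * Gamma (1 - z) * (Digamma z - Digamma (1 - z)) =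
      - (of_real pi / sin (of_real pi * z)) * (of_real pi * cot (of_real pi * z))"
    unfolding Gamma_reflection_complex by (rule DERIV_unique)
  hence "(of_real pi / sin (of_real pi * z)) * (Digamma (1 - z) - Digamma z) =
      (of_real pi / sin (of_real pi * z)) * (of_real pi * cot (of_real pi * z))"
    unfolding Gamma_reflection_complex by (simp add: algebra_simps)
  thus ?thesis
    using s by simp
qed

lemma Polygamma_1_reflection_complex:
  fixes z :: complex
  assumes z: "z \<notin> \<int>"
  shows "Polygamma 1 z + Polygamma 1 (1 - z) = of_real pi ^ 2 / sin (of_real pi * z) ^ 2"
proof -
  have nz: "z \<notin> \<int>\<^sub>\<le>\<^sub>0" "1 - z \<notin> \<int>\<^sub>\<le>\<^sub>0"
    using z nonpos_Ints_subset_Ints Ints_diff[of 1 "1 - z"] by auto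
  have s: "sin (of_real pi * z) \<noteq> 0"
    using z by (auto simp: sin_eq_0)
  have "((\<lambda>w. Digamma (1 - w) - Digamma w) has_field_derivative
          - (Polygamma 1 (1 - z) + Polygamma 1 z)) (at z)"
    by (rule derivative_eq_intros refl nz | simp add: algebra_simps)+
  moreover have "((\<lambda>w. Digamma (1 - w) - Digamma w) has_field_derivative
          - (of_real pi ^ 2 / sin (of_real pi * z) ^ 2)) (at z) \<longleftrightarrow>
      ((\<lambda>w. of_real pi * cot (of_real pi * w)) has_field_derivative
          - (of_real pi ^ 2 / sin (of_real pi * z) ^ 2)) (at z)"
  proof (rule DERIV_cong_ev[OF refl _ refl])
    have "eventually (\<lambda>w. w \<in> - \<int>) (nhds z)"
      using z closed_Ints by (intro eventually_nhds_in_open) (auto simp: open_closed)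
    thus "eventually (\<lambda>w. Digamma (1 - w) - Digamma w = of_real pi * cot (of_real pi * w)) (nhds z)"
      by eventually_elim (use Digamma_reflection_complex in auto)
  qed
  moreover have "((\<lambda>w. of_real pi * cot (of_real pi * w)) has_field_derivative
          - (of_real pi ^ 2 / sin (of_real pi * z) ^ 2)) (at z)"
  proof -
    have "((\<lambda>w. cot (of_real pi * w)) has_field_derivative
        - inverse (sin (of_real pi * z) ^ 2) * of_real pi) (at z)"
      by (rule DERIV_chain2[where g = "\<lambda>w. of_real pi * w", OF DERIV_cot[OF s]]) (auto intro!: derivative_eq_intros)
    from DERIV_cmult[OF this, of "of_real pi"] show ?thesis
      by (simp add: power2_eq_square field_simps)
  qed
  ultimately have "- (Polygamma 1 (1 - z) + Polygamma 1 z) = - (of_real pi ^ 2 / sin (of_real pi * z) ^ 2)"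
    using DERIV_unique by blast
  thus ?thesis by (simp only: neg_equal_iff_equal add.commute[of "Polygamma 1 z"])
qed

text \<open>The negative half is indexed by -1 - k because w + (-1 - k) = -(1 - w + k): sums over it
  become sums over the nonnegative half for 1 - w, the second argument in the reflection
  formulas.\<close>

lemma has_sum_int_decompose:
  fixes f :: "int \<Rightarrow> complex"
  assumes "((\<lambda>k::nat. f (int k)) has_sum S) UNIV" "((\<lambda>k::nat. f (- 1 - int k)) has_sum T) UNIV"
  shows "(f has_sum (S + T)) UNIV"
proof -
  have 1: "(f has_sum S) {0..}"
    by (rule has_sum_reindex_bij_witness[where i = int and j = nat, THEN iffD2, OF _ _ _ _ _ _ assms(1)]) auto
  have 2: "(f has_sum T) {..-1}"
    by (rule has_sum_reindex_bij_witness[where i = "\<lambda>k. - 1 - int k" and j = "\<lambda>n. nat (- 1 - n)",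
          THEN iffD2, OF _ _ _ _ _ _ assms(2)]) auto
  have "(f has_sum (S + T)) ({0..} \<union> {..-1})"
    by (rule has_sum_Un_disjoint[OF 1 2]) auto
  also have "{0..} \<union> {..-1::int} = UNIV" by auto
  finally show ?thesis .
qed

lemma summable_norm_inverse_square:
  fixes w :: complex
  shows "summable (\<lambda>k::nat. norm (inverse ((w + of_nat k)^2)))"
proof (rule summable_comparison_test_ev)
  show "summable (\<lambda>k::nat. 4 * inverse (real k ^ 2))"
    by (intro summable_mult inverse_power_summable) auto
  show "\<forall>\<^sub>F k in sequentially. norm (norm (inverse ((w + of_nat k)^2))) \<le> 4 * inverse (real k ^ 2)"
    using eventually_gt_at_top[of "nat \<lceil>2 * norm w\<rceil>"]
  proof eventually_elim
    case (elim k)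
    have k: "real k > 2 * norm w" using elim by linarith
    hence k0: "real k > 0" using norm_ge_zero[of w] by linarith
    have "norm (of_nat k :: complex) - norm w \<le> norm (of_nat k + w)" by (rule norm_diff_ineq)
    hence "real k / 2 \<le> norm (w + of_nat k)" using k by (simp add: add.commute)
    hence "(real k / 2) ^ 2 \<le> norm (w + of_nat k) ^ 2" using k0 by (intro power_mono) auto
    hence "inverse (norm (w + of_nat k) ^ 2) \<le> inverse ((real k / 2) ^ 2)"
      using k0 by (intro le_imp_inverse_le) auto
    also have "\<dots> = 4 * inverse (real k ^ 2)" by (simp add: power2_eq_square field_simps)
    finally show ?case by (simp add: norm_inverse norm_power)
  qed
qed

text \<open>The two halves are the trigamma series at w and at 1 - w.\<close>

lemma has_sum_inverse_square_int:
  fixes w :: complex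
  assumes w: "w \<notin> \<int>"
  shows "((\<lambda>n::int. 1 / (w + of_int n) ^ 2) has_sum (of_real pi ^ 2 / sin (of_real pi * w) ^ 2)) UNIV"
proof -
  have w0: "w \<noteq> 0" "1 - w \<noteq> 0" using w by auto
  have 1: "((\<lambda>k::nat. 1 / (w + of_int (int k)) ^ 2) has_sum Polygamma 1 w) UNIV"
    using Polygamma_LIMSEQ[OF w0(1), of 1] summable_norm_inverse_square[of w]
    by (intro norm_summable_imp_has_sum) (simp_all add: divide_inverse power2_eq_square)
  have eq: "w + of_int (- 1 - int k) = - (1 - w + of_nat k)" for k by simp
  have 2: "((\<lambda>k::nat. 1 / (w + of_int (- 1 - int k)) ^ 2) has_sum Polygamma 1 (1 - w)) UNIV"
    unfolding eq power2_minus
    using Polygamma_LIMSEQ[OF w0(2), of 1] summable_norm_inverse_square[of "1 - w"]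
    by (intro norm_summable_imp_has_sum) (simp_all add: divide_inverse power2_eq_square)
  show ?thesis
    using has_sum_int_decompose[OF 1 2] Polygamma_1_reflection_complex[OF w] by simp
qed

text \<open>The Digamma limits at 1 - w and w have the same logarithmic terms, which cancel.
  Truncated at N they cover the indices -N..-1 and 0..N-1; the remaining index N contributes 1 / (w
  + N), which tends to 0.\<close>

lemma cot_partial_fractions:
  fixes w :: complex
  assumes w: "w \<notin> \<int>"
  shows "(\<lambda>N::nat. \<Sum>m = - int N..int N. 1 / (w + of_int m)) \<longlonglongrightarrow> of_real pi * cot (of_real pi * w)"
proof -
  have w0: "w \<noteq> 0" "1 - w \<noteq> 0" using w by auto
  have "(\<lambda>m. (of_real (ln (real m)) - (\<Sum>n<m. inverse (1 - w + of_nat n))) -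
        (of_real (ln (real m)) - (\<Sum>n<m. inverse (w + of_nat n))) + 1 / (w + of_nat m))
      \<longlonglongrightarrow> Digamma (1 - w) - Digamma w + 0"
  proof (intro tendsto_add tendsto_diff Digamma_LIMSEQ w0)
    show "(\<lambda>m. 1 / (w + of_nat m)) \<longlonglongrightarrow> 0"
      by (intro tendsto_divide_0[OF tendsto_const] tendsto_add_filterlim_at_infinity[OF tendsto_const]
          tendsto_of_nat)
  qed
  moreover have "(\<Sum>m = - int N..int N. 1 / (w + of_int m)) =
      (of_real (ln (real N)) - (\<Sum>n<N. inverse (1 - w + of_nat n))) -
        (of_real (ln (real N)) - (\<Sum>n<N. inverse (w + of_nat n))) + 1 / (w + of_nat N)" for N
  proof (induction N)
    case (Suc N)
    have "{- int (Suc N)..int (Suc N)} = insert (int (Suc N)) (insert (- int (Suc N)) {- int N..int N})"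
      by auto
    hence "(\<Sum>m = - int (Suc N)..int (Suc N). 1 / (w + of_int m)) =
       1 / (w + of_nat (Suc N)) + (1 / (w - of_nat (Suc N)) + (\<Sum>m = - int N..int N. 1 / (w + of_int m)))"
      by simp
    also have "1 / (w - of_nat (Suc N)) = - inverse (1 - w + of_nat N)"
      by (simp add: divide_inverse flip: inverse_minus_eq)
    finally show ?case unfolding Suc.IH by (simp add: divide_inverse)
  qed auto
  ultimately show ?thesis using Digamma_reflection_complex[OF w] by simp
qed

text \<open>With x = exp(-2 pi i w), of modulus below 1, the cotangent is i (1 + x^n) / (1 - x^n).
  It is applied to w = 1 / z, and the limit i is the source of the term 2 pi i / z in the weight 2
  transformation.\<close>

lemma tendsto_cot_lower:
  fixes w :: complex
  assumes "Im w < 0"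
  shows "(\<lambda>n::nat. cot (of_real pi * (of_nat n * w))) \<longlonglongrightarrow> \<i>"
proof -
  define x where "x = exp (- 2 * of_real pi * \<i> * w)"
  have "norm x < 1" using assms by (simp add: x_def mult_neg_neg mult_pos_neg)
  hence lim: "(\<lambda>n. x ^ n) \<longlonglongrightarrow> 0" by (rule LIMSEQ_power_zero)
  \<comment> \<open>At n = 0 both denominators vanish and both sides are 0 by the convention for
    division.\<close>
  have eq: "cot (of_real pi * (of_nat n * w)) = \<i> * (1 + x ^ n) / (1 - x ^ n)" for n
  proof -
    define y where "y = exp (\<i> * (of_real pi * (of_nat n * w)))"
    have y0: "y \<noteq> 0" by (simp add: y_def)
    have xn: "x ^ n = inverse y ^ 2"
      by (simp add: x_def y_def flip: exp_of_nat_mult exp_minus)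
         (simp add: algebra_simps)
    have "cot (of_real pi * (of_nat n * w)) = \<i> * (y + inverse y) / (y - inverse y)"
    proof -
      have "sin (of_real pi * (of_nat n * w)) = (y - inverse y) / (2 * \<i>)"
        "cos (of_real pi * (of_nat n * w)) = (y + inverse y) / 2"
        by (simp_all add: sin_exp_eq cos_exp_eq y_def exp_minus)
      note trig = this
      show ?thesis
        unfolding cot_def trig by (cases "y - inverse y = 0") (simp_all add: divide_simps)
    qed
    also have "\<dots> = \<i> * (1 + x ^ n) / (1 - x ^ n)"
      unfolding xn using y0 by (cases "y ^ 2 = 1") (auto simp: field_simps power2_eq_square)
    finally show ?thesis .
  qed
  have "(\<lambda>n. \<i> * (1 + x ^ n) / (1 - x ^ n)) \<longlonglongrightarrow> \<i> * (1 + 0) / (1 - 0)"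
    by (intro tendsto_intros lim) auto
  thus ?thesis by (simp add: eq)
qed

section \<open>The Eisenstein series of weight 2\<close>

lemma Im_minus_inverse_pos:
  assumes "Im z > 0"
  shows "Im (- 1 / z) > 0"
proof -
  have "(Re z)\<^sup>2 + (Im z)\<^sup>2 > 0" using assms by (intro add_nonneg_pos) auto
  thus ?thesis using assms by (simp add: Im_divide)
qed

text \<open>The first bound reads off the imaginary part; inserting it into y = (x z + y) - x z
  gives the second.\<close>

lemma lattice_norm_bounds:
  fixes z :: complex and x y :: real
  assumes z: "Im z > 0"
  shows "Im z * \<bar>x\<bar> \<le> norm (of_real x * z + of_real y)"
    and "Im z * \<bar>y\<bar> \<le> (Im z + norm z) * norm (of_real x * z + of_real y)"
proof -
  show 1: "Im z * \<bar>x\<bar> \<le> norm (of_real x * z + of_real y)"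
    using abs_Im_le_cmod[of "of_real x * z + of_real y"] z by (simp add: abs_mult mult.commute)
  have "\<bar>y\<bar> = norm ((of_real x * z + of_real y) - of_real x * z)" by simp
  also have "\<dots> \<le> norm (of_real x * z + of_real y) + \<bar>x\<bar> * norm z"
    using norm_triangle_ineq4[of "of_real x * z + of_real y" "of_real x * z"] by (simp add: norm_mult)
  finally have "Im z * \<bar>y\<bar> \<le> Im z * norm (of_real x * z + of_real y) + (Im z * \<bar>x\<bar>) * norm z"
    using mult_left_mono[of "\<bar>y\<bar>" "norm (of_real x * z + of_real y) + \<bar>x\<bar> * norm z" "Im z"] z
    by (simp add: distrib_left mult.assoc)
  also have "\<dots> \<le> Im z * norm (of_real x * z + of_real y) + norm (of_real x * z + of_real y) * norm z"
    by (intro add_left_mono mult_right_mono 1) auto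
  finally show "Im z * \<bar>y\<bar> \<le> (Im z + norm z) * norm (of_real x * z + of_real y)"
    by (simp add: algebra_simps)
qed

text \<open>The cubic decay of \<open>eis_term\<close> is shared equally between its two indices;
  3/2 exceeds 1, so each factor is summable.\<close>

lemma summable_on_int_powr:
  "(\<lambda>n::int. (1 + \<bar>real_of_int n\<bar>) powr (-3/2)) summable_on UNIV"
proof -
  have "summable (\<lambda>n. real n powr (-3/2))" by (subst summable_real_powr_iff) auto
  hence "summable (\<lambda>n. real (Suc n) powr (-3/2))" by (subst summable_Suc_iff)
  hence s: "(\<lambda>n::nat. (1 + real n) powr (-3/2)) summable_on UNIV"
    by (intro norm_summable_imp_summable_on) (simp add: add.commute)
  have "(\<lambda>n::int. (1 + \<bar>real_of_int n\<bar>) powr (-3/2)) summable_on (range int \<union> range (\<lambda>n. - int n))"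
  proof (rule summable_on_union)
    show "(\<lambda>n::int. (1 + \<bar>real_of_int n\<bar>) powr (-3/2)) summable_on range int"
      using s by (subst summable_on_reindex) (auto simp: o_def inj_on_def)
    show "(\<lambda>n::int. (1 + \<bar>real_of_int n\<bar>) powr (-3/2)) summable_on range (\<lambda>n. - int n)"
      using s by (subst summable_on_reindex) (auto simp: o_def inj_on_def)
  qed
  also have "range int \<union> range (\<lambda>n. - int n) = UNIV"
  proof -
    have "x \<in> range int \<union> range (\<lambda>n. - int n)" for x
      by (cases x rule: int_cases2) auto
    thus ?thesis by blast
  qed
  finally show ?thesis .
qed

text \<open>The term of the conditionally convergent Eisenstein series of weight 2, corrected by a
  telescoping term so that the double series converges absolutely.\<close>
definition eis_term :: "complex \<Rightarrow> int \<Rightarrow> int \<Rightarrow> complex" where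
  "eis_term z n m = 1 / (of_int m * z + of_int n) ^ 2 -
     (1 / (of_int m * z + of_int (n - 1)) - 1 / (of_int m * z + of_int n))"

text \<open>With w = m z + n the corrected term collapses to -1 / (w^2 (w - 1)), of third order
  instead of second. Both |w| and |w - 1| are at least a constant times the larger of 1 + |m| and 1
  + |n|.\<close>

lemma eis_term_norm_le:
  fixes z :: complex
  assumes z: "Im z > 0"
  obtains C where "\<And>m n. m \<noteq> 0 \<Longrightarrow> norm (eis_term z n m) \<le>
      C * ((1 + \<bar>real_of_int n\<bar>) powr (-3/2) * (1 + \<bar>real_of_int m\<bar>) powr (-3/2))"
proof -
  \<comment> \<open>The division by 4 absorbs the passage from |m|, |n| and |n - 1| to 1 + |m| and 1
    + |n|.\<close>
  define K where "K = min (Im z) (Im z / (Im z + norm z)) / 4"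
  have pos: "Im z + norm z > 0" using z norm_ge_zero[of z] by linarith
  have K: "K > 0" using z pos by (simp add: K_def)
  have K1: "4 * K * \<bar>x\<bar> \<le> norm (of_real x * z + of_real y)" for x y :: real
  proof -
    have "4 * K * \<bar>x\<bar> \<le> Im z * \<bar>x\<bar>" by (intro mult_right_mono) (auto simp: K_def)
    also have "\<dots> \<le> norm (of_real x * z + of_real y)" by (rule lattice_norm_bounds[OF z])
    finally show ?thesis .
  qed
  have K2: "4 * K * \<bar>y\<bar> \<le> norm (of_real x * z + of_real y)" for x y :: real
  proof -
    have "4 * K * \<bar>y\<bar> \<le> Im z / (Im z + norm z) * \<bar>y\<bar>" by (intro mult_right_mono) (auto simp: K_def)
    also have "\<dots> \<le> norm (of_real x * z + of_real y)"
      using lattice_norm_bounds(2)[OF z, of y x] pos by (simp add: field_simps)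
    finally show ?thesis .
  qed
  have "norm (eis_term z n m) \<le> (1 / K ^ 3) *
      ((1 + \<bar>real_of_int n\<bar>) powr (-3/2) * (1 + \<bar>real_of_int m\<bar>) powr (-3/2))"
    if m: "m \<noteq> 0" for m n
  proof -
    define w where "w = of_int m * z + of_int n"
    define a b where "a = 1 + \<bar>real_of_int m\<bar>" and "b = 1 + \<bar>real_of_int n\<bar>"
    have ab: "a > 0" "b > 0" by (auto simp: a_def b_def)
    have wm: "4 * K * \<bar>real_of_int m\<bar> \<le> norm w" "4 * K * \<bar>real_of_int m\<bar> \<le> norm (w - 1)"
      using K1[of m n] K1[of m "n - 1"] by (simp_all add: w_def add_diff_eq)
    have wn: "4 * K * \<bar>real_of_int n\<bar> \<le> norm w" "4 * K * \<bar>real_of_int n - 1\<bar> \<le> norm (w - 1)"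
      using K2[of n m] K2[of "n - 1" m] by (simp_all add: w_def add_diff_eq)
    have m1: "\<bar>real_of_int m\<bar> \<ge> 1" using m by linarith
    have "a \<le> 4 * \<bar>real_of_int m\<bar>" using m1 by (simp add: a_def)
    hence "K * a \<le> K * (4 * \<bar>real_of_int m\<bar>)" using K by (intro mult_left_mono) auto
    hence "K * a \<le> 4 * K * \<bar>real_of_int m\<bar>" by (simp only: mult_ac)
    hence wa: "K * a \<le> norm w" "K * a \<le> norm (w - 1)" using wm by linarith+
    \<comment> \<open>When n is close to 0 or 1, the values |n| and |n - 1| do not control 1 + |n|;
      then |m|, which is at least 1, does.\<close>
    have far: "1 + \<bar>x\<bar> \<le> 4 * \<bar>x\<bar> \<or> 1 + \<bar>x\<bar> \<le> 4 * y"
      "1 + \<bar>x\<bar> \<le> 4 * \<bar>x - 1\<bar> \<or> 1 + \<bar>x\<bar> \<le> 4 * y" if "y \<ge> 1" for x y :: real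
    proof -
      have *: "1 + p \<le> 4 * p' \<or> 1 + p \<le> 4 * y" if "p - 1 \<le> p'" for p p' :: real
        using that \<open>y \<ge> 1\<close> by linarith
      show "1 + \<bar>x\<bar> \<le> 4 * \<bar>x\<bar> \<or> 1 + \<bar>x\<bar> \<le> 4 * y"
        "1 + \<bar>x\<bar> \<le> 4 * \<bar>x - 1\<bar> \<or> 1 + \<bar>x\<bar> \<le> 4 * y"
        by (rule *, linarith)+
    qed
    have "b \<le> 4 * \<bar>real_of_int n\<bar> \<or> b \<le> 4 * \<bar>real_of_int m\<bar>"
      "b \<le> 4 * \<bar>real_of_int n - 1\<bar> \<or> b \<le> 4 * \<bar>real_of_int m\<bar>"
      unfolding b_def by (rule far[OF m1])+
    moreover have mm: "b \<le> x \<Longrightarrow> b * K \<le> x * K" for x using K by simp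
    ultimately have "b * K \<le> (4 * \<bar>real_of_int n\<bar>) * K \<or> b * K \<le> (4 * \<bar>real_of_int m\<bar>) * K"
      "b * K \<le> (4 * \<bar>real_of_int n - 1\<bar>) * K \<or> b * K \<le> (4 * \<bar>real_of_int m\<bar>) * K"
      using mm by blast+
    moreover have "(4 * x) * K = 4 * K * x" for x :: real by simp
    ultimately have "b * K \<le> 4 * K * \<bar>real_of_int n\<bar> \<or> b * K \<le> 4 * K * \<bar>real_of_int m\<bar>"
      "b * K \<le> 4 * K * \<bar>real_of_int n - 1\<bar> \<or> b * K \<le> 4 * K * \<bar>real_of_int m\<bar>"
      by metis+
    hence wb: "K * b \<le> norm w" "K * b \<le> norm (w - 1)"
      using wm wn by (auto simp: mult.commute[of K b])
    define M where "M = max a b"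
    have M: "M > 0" "K * M \<le> norm w" "K * M \<le> norm (w - 1)"
      using ab wa wb by (auto simp: M_def max_def)
    have "K * M > 0" using M K by simp
    hence "norm w > 0" "norm (w - 1) > 0" using M(2,3) by linarith+
    hence w0: "w \<noteq> 0" "w - 1 \<noteq> 0" by simp_all
    have "eis_term z n m = 1 / w ^ 2 - (1 / (w - 1) - 1 / w)"
      by (simp add: eis_term_def w_def add_diff_eq)
    also have "1 / (w - 1) - 1 / w = 1 / (w * (w - 1))"
      using w0 by (simp add: diff_frac_eq)
    also have "1 / w ^ 2 - 1 / (w * (w - 1)) = - 1 / (w ^ 2 * (w - 1))"
      using w0 by (simp add: divide_simps power2_eq_square)
    finally have "eis_term z n m = - 1 / (w ^ 2 * (w - 1))" .
    hence "norm (eis_term z n m) = 1 / (norm w ^ 2 * norm (w - 1))"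
      by (simp add: norm_divide norm_mult norm_power)
    also have "\<dots> \<le> 1 / ((K * M) ^ 2 * (K * M))"
      using \<open>K * M > 0\<close> \<open>norm w > 0\<close> \<open>norm (w - 1) > 0\<close> M K
      by (intro divide_left_mono mult_mono power_mono mult_pos_pos) auto
    also have "(K * M) ^ 2 * (K * M) = K ^ 3 * M ^ 3"
      by (simp add: power2_eq_square power3_eq_cube)
    also have "1 / (K ^ 3 * M ^ 3) = (1 / K ^ 3) * M powr (-3)"
      using M(1) by (simp add: powr_minus powr_numeral divide_inverse)
    also have "M powr (-3) = M powr (-3/2) * M powr (-3/2)"
      using M by (simp flip: powr_add)
    also have "(1 / K ^ 3) * (M powr (-3/2) * M powr (-3/2)) \<le> (1 / K ^ 3) * (b powr (-3/2) * a powr (-3/2))"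
      using ab K by (intro mult_left_mono mult_mono powr_mono2') (auto simp: M_def)
    finally show ?thesis by (simp add: a_def b_def)
  qed
  thus ?thesis by (rule that)
qed

lemma eis_term_summable:
  fixes z :: complex
  assumes z: "Im z > 0"
  shows "(\<lambda>(n, m). eis_term z n m) summable_on (UNIV \<times> - {0})"
proof -
  obtain C where C: "\<And>m n. m \<noteq> 0 \<Longrightarrow> norm (eis_term z n m) \<le>
      C * ((1 + \<bar>real_of_int n\<bar>) powr (-3/2) * (1 + \<bar>real_of_int m\<bar>) powr (-3/2))"
    using eis_term_norm_le[OF z] by metis
  define g where "g = (\<lambda>n. (1 + \<bar>real_of_int n\<bar>) powr (-3/2))"
  have "(\<lambda>(n, m). g n * g m) summable_on (UNIV \<times> UNIV)"
  proof (rule summable_on_SigmaI)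
    show "((\<lambda>m. case (n, m) of (n, m) \<Rightarrow> g n * g m) has_sum (g n * infsum g UNIV)) UNIV" for n
      using summable_on_int_powr unfolding g_def prod.case
      by (intro has_sum_cmult_right has_sum_infsum)
    show "(\<lambda>n. g n * infsum g UNIV) summable_on UNIV"
      using summable_on_int_powr unfolding g_def by (intro summable_on_cmult_left)
  qed (auto simp: g_def)
  hence "(\<lambda>(n, m). g n * g m) summable_on (UNIV \<times> - {0})"
    by (rule summable_on_subset) auto
  hence "(\<lambda>x. C * (\<lambda>(n, m). g n * g m) x) summable_on (UNIV \<times> - {0})"
    by (rule summable_on_cmult_right)
  hence "(\<lambda>x. norm (case x of (n, m) \<Rightarrow> eis_term z n m)) summable_on (UNIV \<times> - {0})"
    by (rule Infinite_Sum.abs_summable_on_comparison_test') (use C in \<open>auto simp: g_def\<close>)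
  thus ?thesis by (rule Infinite_Sum.abs_summable_summable)
qed

lemma of_int_mult_non_Ints:
  assumes "Im z \<noteq> 0" "m \<noteq> 0"
  shows "of_int m * z \<notin> \<int>"
proof
  assume "of_int m * z \<in> \<int>"
  then obtain k where "of_int m * z = of_int k" by (rule Ints_cases)
  hence "Im (of_int m * z) = Im (of_int k)" by (rule arg_cong)
  thus False using assms by simp
qed

text \<open>On a row, where w = m z, the correction in \<open>eis_term\<close> adds nothing: the two
  halves telescope to 1 / (w - 1) and its negative. Each difference is a product of two consecutive
  reciprocals, dominated by the sum of their squares, so the convergence is absolute.\<close>

lemma telescoping_inverse_int:
  fixes w :: complex
  assumes w: "w \<notin> \<int>"
  shows "((\<lambda>n::int. 1 / (w + of_int (n - 1)) - 1 / (w + of_int n)) has_sum 0) UNIV"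
proof -
  have w0: "w + of_int k \<noteq> 0" for k
  proof
    assume "w + of_int k = 0"
    hence "w = of_int (- k)" by (simp add: add_eq_0_iff2)
    thus False using w by simp
  qed
  have eq: "1 / (w + of_int (n - 1)) - 1 / (w + of_int n) = inverse (w + of_int (n - 1)) * inverse (w + of_int n)" for n
    using w0[of n] w0[of "n - 1"] by (simp add: divide_simps)
  have bound: "norm (a * b) \<le> norm (a ^ 2) + norm (b ^ 2)" for a b :: complex
  proof -
    have "2 * (norm a * norm b) \<le> norm a ^ 2 + norm b ^ 2"
      using sum_squares_bound[of "norm a" "norm b"] by simp
    moreover have "norm a * norm b \<ge> 0" by simp
    ultimately show ?thesis unfolding norm_mult norm_power by linarith
  qed
  have s: "summable (\<lambda>k. norm (inverse ((u + of_nat k)^2)) + norm (inverse ((v + of_nat k)^2)))" for u v :: complex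
    by (intro summable_add summable_norm_inverse_square)
  have lim: "(\<lambda>k. 1 / (u + of_nat k)) \<longlonglongrightarrow> 0" for u :: complex
    by (intro tendsto_divide_0[OF tendsto_const] tendsto_add_filterlim_at_infinity[OF tendsto_const]
          tendsto_of_nat)
  have 1: "((\<lambda>k. 1 / (w + of_int (int k - 1)) - 1 / (w + of_int (int k))) has_sum 1 / (w - 1)) UNIV"
  proof (rule norm_summable_imp_has_sum)
    show "summable (\<lambda>k. norm (1 / (w + of_int (int k - 1)) - 1 / (w + of_int (int k))))"
      unfolding eq using bound[of "inverse (w - 1 + of_nat _)" "inverse (w + of_nat _)"]
      by (intro summable_comparison_test'[OF s[of "w - 1" w]])
         (auto simp: power_inverse algebra_simps)
    show "(\<lambda>k. 1 / (w + of_int (int k - 1)) - 1 / (w + of_int (int k))) sums (1 / (w - 1))"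
      using telescope_sums'[OF lim[of "w - 1"]] by (simp add: algebra_simps)
  qed
  have 2: "((\<lambda>k. 1 / (w + of_int (- 1 - int k - 1)) - 1 / (w + of_int (- 1 - int k))) has_sum - (1 / (w - 1))) UNIV"
  proof (rule norm_summable_imp_has_sum)
    have e1: "w + of_int (- 1 - int k - 1) = - (2 - w + of_nat k)"
      and e2: "w + of_int (- 1 - int k) = - (1 - w + of_nat k)" for k by simp_all
    show "summable (\<lambda>k. norm (1 / (w + of_int (- 1 - int k - 1)) - 1 / (w + of_int (- 1 - int k))))"
      unfolding eq unfolding e1 e2 using bound[of "inverse (- (2 - w + of_nat _))" "inverse (- (1 - w + of_nat _))"]
      by (intro summable_comparison_test'[OF s[of "2 - w" "1 - w"]])
         (simp only: real_norm_def abs_norm_cancel power_inverse power2_minus)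
    have "(\<lambda>k. 1 / (1 - w + of_nat k) - 1 / (1 - w + of_nat (Suc k))) sums (1 / (1 - w + of_nat 0) - 0)"
      using telescope_sums'[OF lim[of "1 - w"]] by simp
    also have "(\<lambda>k. 1 / (1 - w + of_nat k) - 1 / (1 - w + of_nat (Suc k))) =
       (\<lambda>k. 1 / (w + of_int (- 1 - int k - 1)) - 1 / (w + of_int (- 1 - int k)))"
      unfolding e1 e2 divide_minus_right by (intro ext) (simp add: algebra_simps)
    also have "1 / (1 - w + of_nat 0) - 0 = - (1 / (w - 1))"
      unfolding divide_minus_right[symmetric] by simp
    finally show "(\<lambda>k. 1 / (w + of_int (- 1 - int k - 1)) - 1 / (w + of_int (- 1 - int k))) sums - (1 / (w - 1))" .
  qed
  show ?thesis
    using has_sum_int_decompose[OF 1 2] by simp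
qed

text \<open>Links unordered with conditionally convergent sums: the difference of two unordered sums
  may be evaluated along chosen finite sets, where the summands can be split into pieces that
  converge only along that exhaustion.\<close>

lemma has_sum_int_exhaustion:
  fixes f :: "int \<Rightarrow> complex"
  assumes "(f has_sum S) A" "\<And>N. finite (B N)" "\<And>N. B N \<subseteq> A"
    and "\<And>x N. x \<in> A \<Longrightarrow> nat \<bar>x\<bar> < N \<Longrightarrow> x \<in> B N"
  shows "(\<lambda>N. \<Sum>n\<in>B N. f n) \<longlonglongrightarrow> S"
proof -
  have "filterlim B (finite_subsets_at_top A) sequentially"
    unfolding filterlim_finite_subsets_at_top
  proof safe
    fix X :: "int set" assume X: "finite X" "X \<subseteq> A"
    obtain M where M: "\<And>x. x \<in> X \<Longrightarrow> nat \<bar>x\<bar> \<le> M"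
      using finite_imageI[OF X(1), of "\<lambda>x. nat \<bar>x\<bar>"] by (metis finite_nat_set_iff_bounded_le imageI)
    show "\<forall>\<^sub>F N in sequentially. finite (B N) \<and> X \<subseteq> B N \<and> B N \<subseteq> A"
      using eventually_gt_at_top[of M]
    proof eventually_elim
      case (elim N)
      have "x \<in> B N" if "x \<in> X" for x
        by (rule assms(4)) (use that X M[OF that] elim in auto)
      thus ?case using assms(2,3) by auto
    qed
  qed
  from filterlim_compose[OF assms(1)[unfolded has_sum_def] this] show ?thesis .
qed

lemma has_sum_even_int:
  fixes f :: "int \<Rightarrow> complex"
  assumes nat: "((\<lambda>n. f (int n + 1)) has_sum S) UNIV" and even: "\<And>n. f (- n) = f n"
  shows "(f has_sum (S + S)) (- {0})"
proof -
  have 1: "(f has_sum S) {1..}"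
    by (rule has_sum_reindex_bij_witness[where i = "\<lambda>n. int n + 1" and j = "\<lambda>n. nat (n - 1)",
          THEN iffD2, OF _ _ _ _ _ _ nat]) auto
  have 2: "(f has_sum S) {..-1}"
    by (rule has_sum_reindex_bij_witness[where i = "\<lambda>n. - int n - 1" and j = "\<lambda>n. nat (- n - 1)",
          THEN iffD2, OF _ _ _ _ _ _ nat]) (auto simp: even)
  have "(f has_sum (S + S)) ({1..} \<union> {..-1})"
    by (rule has_sum_Un_disjoint[OF 1 2]) auto
  also have "{1..} \<union> {..-1::int} = - {0}" by auto
  finally show ?thesis .
qed

lemma has_sum_inverse_squares_int:
  "((\<lambda>n::int. 1 / of_int n ^ 2 :: complex) has_sum of_real pi ^ 2 / 3) (- {0})"
proof -
  have "(\<lambda>n. complex_of_real (1 / (real n + 1)\<^sup>2)) sums complex_of_real (pi\<^sup>2 / 6)"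
    using inverse_squares_sums by (intro sums_of_real) (simp add: add.commute)
  moreover have "summable (\<lambda>n. norm (complex_of_real (1 / (real n + 1)\<^sup>2)))"
    using inverse_squares_sums by (simp only: norm_of_real) (simp add: sums_iff add.commute)
  ultimately have nat: "((\<lambda>n. complex_of_real (1 / (real n + 1)\<^sup>2)) has_sum complex_of_real (pi\<^sup>2 / 6)) UNIV"
    by (intro norm_summable_imp_has_sum)
  thus ?thesis
    using has_sum_even_int[of "\<lambda>n. 1 / of_int n ^ 2" "of_real (pi\<^sup>2 / 6)"] by simp
qed

lemma has_sum_difference:
  fixes f g :: "'a \<Rightarrow> complex"
  assumes "(f has_sum a) A" "(g has_sum b) A"
  shows "((\<lambda>x. f x - g x) has_sum (a - b)) A"
  using has_sum_add[OF assms(1) has_sum_uminusI[OF assms(2)]] by simp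

text \<open>In the usual notation this is G_2(z) - pi^2 / 3: summand m is the sum of 1 / (m z + n)^2
  over all n, and pi^2 / 3 is the row m = 0.\<close>

definition csc2_sum :: "complex \<Rightarrow> complex" where
  "csc2_sum z = infsum (\<lambda>m. of_real pi ^ 2 / sin (of_real pi * (of_int m * z)) ^ 2) (- {0::int})"

lemma eis_term_has_sum_rows:
  assumes z: "Im z > 0" and m: "m \<noteq> 0"
  shows "((\<lambda>n. eis_term z n m) has_sum of_real pi ^ 2 / sin (of_real pi * (of_int m * z)) ^ 2) UNIV"
  using has_sum_difference[OF has_sum_inverse_square_int telescoping_inverse_int, of "of_int m * z" "of_int m * z"]
    of_int_mult_non_Ints[of z m] assms by (simp add: eis_term_def)

text \<open>The closed form is the iterated sum of \<open>eis_term\<close> by rows. Absolute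
  convergence makes the double sum the same number, which can then be summed by columns.\<close>

lemma csc2_sum_has_sum:
  assumes z: "Im z > 0"
  shows "((\<lambda>m. of_real pi ^ 2 / sin (of_real pi * (of_int m * z)) ^ 2) has_sum csc2_sum z) (- {0})"
    and "((\<lambda>(n, m). eis_term z n m) has_sum csc2_sum z) (UNIV \<times> - {0})"
proof -
  obtain S where S: "((\<lambda>(n, m). eis_term z n m) has_sum S) (UNIV \<times> - {0})"
    using eis_term_summable[OF z] by (auto simp: summable_on_def)
  hence "((\<lambda>(m, n). eis_term z n m) has_sum S) ((- {0}) \<times> UNIV)"
    by (subst (asm) has_sum_swap) simp
  hence *: "((\<lambda>m. of_real pi ^ 2 / sin (of_real pi * (of_int m * z)) ^ 2) has_sum S) (- {0})"
    by (rule has_sum_SigmaD) (use eis_term_has_sum_rows[OF z] in auto)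
  moreover from * have "S = csc2_sum z" by (simp add: csc2_sum_def infsumI)
  ultimately show "((\<lambda>m. of_real pi ^ 2 / sin (of_real pi * (of_int m * z)) ^ 2) has_sum csc2_sum z) (- {0})"
    and "((\<lambda>(n, m). eis_term z n m) has_sum csc2_sum z) (UNIV \<times> - {0})" using S by auto
qed

text \<open>Symmetric truncation makes the sum over m of 1 / (m z + n) converge: factoring out z
  turns it into the cotangent series at n / z, less the term m = 0. For n = 0 the terms cancel in
  pairs.\<close>

lemma tendsto_symmetric_sum_inverse:
  assumes z: "Im z > 0"
  defines "c \<equiv> \<lambda>n::int. if n = 0 then 0 else of_real pi / z * cot (of_real pi * (of_int n / z)) - 1 / of_int n"
  shows "(\<lambda>N. \<Sum>m\<in>{- int N..int N} - {0}. 1 / (of_int m * z + of_int n)) \<longlonglongrightarrow> c n"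
proof (cases "n = 0")
  case True
  have "(\<Sum>m\<in>{- int N..int N} - {0}. 1 / (of_int m * z)) = 0" for N
  proof -
    have "(\<Sum>m\<in>{- int N..int N} - {0}. 1 / (of_int m * z)) =
          (\<Sum>m\<in>{- int N..int N} - {0}. - (1 / (of_int m * z)))"
      by (rule sum.reindex_bij_witness[of _ uminus uminus]) auto
    also have "\<dots> = - (\<Sum>m\<in>{- int N..int N} - {0}. 1 / (of_int m * z))" by (rule sum_negf)
    finally show ?thesis by simp
  qed
  thus ?thesis using True by (simp add: c_def)
next
  case False
  have z0: "z \<noteq> 0" using z by auto
  have "Im (1 / z) \<noteq> 0" using Im_minus_inverse_pos[OF z] by auto
  hence nz: "of_int n / z \<notin> \<int>" using of_int_mult_non_Ints[of "1 / z" n] False by simp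
  have fact: "of_int m * z + of_int n = z * (of_int n / z + of_int m)" for m
    using z0 by (simp add: field_simps)
  have "(\<Sum>m\<in>{- int N..int N} - {0}. 1 / (of_int m * z + of_int n)) =
        1 / z * (\<Sum>m = - int N..int N. 1 / (of_int n / z + of_int m)) - 1 / of_int n" for N
  proof -
    have "(\<Sum>m\<in>{- int N..int N} - {0}. 1 / (of_int m * z + of_int n)) =
          (\<Sum>m\<in>{- int N..int N}. 1 / (of_int m * z + of_int n)) - 1 / of_int n"
      by (subst sum_diff1) auto
    also have "(\<Sum>m\<in>{- int N..int N}. 1 / (of_int m * z + of_int n)) =
       1 / z * (\<Sum>m = - int N..int N. 1 / (of_int n / z + of_int m))"
      unfolding sum_distrib_left fact by simp
    finally show ?thesis .
  qed
  moreover have "(\<lambda>N. 1 / z * (\<Sum>m = - int N..int N. 1 / (of_int n / z + of_int m)) - 1 / of_int n)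
      \<longlonglongrightarrow> 1 / z * (of_real pi * cot (of_real pi * (of_int n / z))) - 1 / of_int n"
    by (intro tendsto_intros cot_partial_fractions nz)
  ultimately show ?thesis using False by (simp add: c_def)
qed

text \<open>Along symmetric partial sums over m a column separates into the squares, with sum
  \<open>s n\<close>, and the two halves of the correction, with limits \<open>c (n - 1)\<close> and
  \<open>c n\<close>. The argument of the sine is written with -1 / z so that summing
  \<open>s\<close> over n yields \<open>csc2_sum (- 1 / z)\<close>.\<close>

lemma eis_term_column:
  assumes z: "Im z > 0"
  defines "c \<equiv> \<lambda>n::int. if n = 0 then 0 else of_real pi / z * cot (of_real pi * (of_int n / z)) - 1 / of_int n"
  defines "s \<equiv> \<lambda>n::int. if n = 0 then of_real pi ^ 2 / (3 * z ^ 2)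
      else 1 / z ^ 2 * (of_real pi ^ 2 / sin (of_real pi * (of_int n * (- 1 / z))) ^ 2) - 1 / of_int n ^ 2"
  shows "((\<lambda>m. eis_term z n m) has_sum (s n - (c (n - 1) - c n))) (- {0})"
proof -
  have z0: "z \<noteq> 0" using z by auto
  have sq: "((\<lambda>m. 1 / (of_int m * z + of_int n) ^ 2) has_sum s n) (- {0})"
  proof (cases "n = 0")
    case True
    have "((\<lambda>m. 1 / z ^ 2 * (1 / of_int m ^ 2)) has_sum (1 / z ^ 2 * (of_real pi ^ 2 / 3))) (- {0})"
      by (intro has_sum_cmult_right has_sum_inverse_squares_int)
    thus ?thesis using True z0 by (simp add: s_def power_mult_distrib mult_ac)
  next
    case False
    have "Im (1 / z) \<noteq> 0" using Im_minus_inverse_pos[OF z] by auto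
    hence nz: "of_int n / z \<notin> \<int>" using of_int_mult_non_Ints[of "1 / z" n] False by simp
    have "((\<lambda>m. 1 / z ^ 2 * (1 / (of_int n / z + of_int m) ^ 2)) has_sum
          (1 / z ^ 2 * (of_real pi ^ 2 / sin (of_real pi * (of_int n / z)) ^ 2))) UNIV"
      by (intro has_sum_cmult_right has_sum_inverse_square_int nz)
    also have "(\<lambda>m. 1 / z ^ 2 * (1 / (of_int n / z + of_int m) ^ 2)) =
        (\<lambda>m. 1 / (of_int m * z + of_int n) ^ 2)"
    proof
      fix m
      have "of_int m * z + of_int n = z * (of_int n / z + of_int m)"
        using z0 by (simp add: field_simps)
      thus "1 / z ^ 2 * (1 / (of_int n / z + of_int m) ^ 2) = 1 / (of_int m * z + of_int n) ^ 2"
        by (simp add: power_mult_distrib)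
    qed
    finally have "((\<lambda>m. 1 / (of_int m * z + of_int n) ^ 2) has_sum
        (1 / z ^ 2 * (of_real pi ^ 2 / sin (of_real pi * (of_int n / z)) ^ 2)) - 1 / of_int n ^ 2) (UNIV - {0})"
      by (intro has_sum_Diff) (use has_sum_finite[of "{0}" "\<lambda>m. 1 / (of_int m * z + of_int n) ^ 2"] in auto)
    thus ?thesis using False by (simp add: s_def Compl_eq_Diff_UNIV)
  qed
  have "(\<lambda>m. eis_term z n m) summable_on (- {0})"
    using summable_on_SigmaD1[OF eis_term_summable[OF z], of n] by simp
  then obtain T where T: "((\<lambda>m. eis_term z n m) has_sum T) (- {0})" by (auto simp: summable_on_def)
  have "(\<lambda>N. \<Sum>m\<in>{- int N..int N} - {0}. 1 / (of_int m * z + of_int n) ^ 2 - eis_term z n m) \<longlonglongrightarrow> s n - T"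
    by (rule has_sum_int_exhaustion[OF has_sum_difference[OF sq T]]) auto
  hence "(\<lambda>N. \<Sum>m\<in>{- int N..int N} - {0}.
      1 / (of_int m * z + of_int (n - 1)) - 1 / (of_int m * z + of_int n)) \<longlonglongrightarrow> s n - T"
    by (simp add: eis_term_def)
  moreover have "(\<lambda>N. \<Sum>m\<in>{- int N..int N} - {0}.
      1 / (of_int m * z + of_int (n - 1)) - 1 / (of_int m * z + of_int n)) \<longlonglongrightarrow> c (n - 1) - c n"
    unfolding sum_subtractf c_def by (intro tendsto_diff tendsto_symmetric_sum_inverse z)
  ultimately have "s n - T = c (n - 1) - c n" by (rule LIMSEQ_unique)
  hence "T = s n - (c (n - 1) - c n)" by (simp add: algebra_simps)
  thus ?thesis using T by simp
qed

lemma sum_telescope_int: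
  fixes c :: "int \<Rightarrow> complex"
  shows "(\<Sum>n = - int N + 1..int N. c (n - 1) - c n) = c (- int N) - c (int N)"
proof (induction N)
  case (Suc N)
  have "{- int (Suc N) + 1..int (Suc N)} = insert (int (Suc N)) (insert (- int N) {- int N + 1..int N})"
    by auto
  hence "(\<Sum>n = - int (Suc N) + 1..int (Suc N). c (n - 1) - c n) =
      (c (int N) - c (int (Suc N))) + ((c (- int (Suc N)) - c (- int N)) + (\<Sum>n = - int N + 1..int N. c (n - 1) - c n))"
    by (simp add: algebra_simps minus_diff_commute)
  thus ?case unfolding Suc.IH by simp
qed simp

text \<open>In the sum over columns the squares give the value at -1 / z, while the corrections
  telescope in n to c(-N) - c(N) = -2 c(N). This tends to -2 pi i / z, since the cotangent tends to
  i.\<close>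

theorem csc2_sum_transform:
  assumes z: "Im z > 0"
  shows "csc2_sum z = csc2_sum (- 1 / z) / z ^ 2 + of_real pi ^ 2 / (3 * z ^ 2) - of_real pi ^ 2 / 3
           + 2 * of_real pi * \<i> / z"
proof -
  define c :: "int \<Rightarrow> complex" where
    "c = (\<lambda>n::int. if n = 0 then 0 else of_real pi / z * cot (of_real pi * (of_int n / z)) - 1 / of_int n)"
  define s where
    "s = (\<lambda>n::int. if n = 0 then of_real pi ^ 2 / (3 * z ^ 2)
      else 1 / z ^ 2 * (of_real pi ^ 2 / sin (of_real pi * (of_int n * (- 1 / z))) ^ 2) - 1 / of_int n ^ 2)"
  define S where "S = 1 / z ^ 2 * csc2_sum (- 1 / z) - of_real pi ^ 2 / 3 + of_real pi ^ 2 / (3 * z ^ 2)"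
  have z0: "z \<noteq> 0" using z by auto
  have "Im (- 1 / z) > 0" using z by (rule Im_minus_inverse_pos)
  have "((\<lambda>n. 1 / z ^ 2 * (of_real pi ^ 2 / sin (of_real pi * (of_int n * (- 1 / z))) ^ 2) - 1 / of_int n ^ 2)
     has_sum (1 / z ^ 2 * csc2_sum (- 1 / z) - of_real pi ^ 2 / 3)) (- {0})"
    by (intro has_sum_difference has_sum_cmult_right csc2_sum_has_sum has_sum_inverse_squares_int) fact
  hence "(s has_sum (1 / z ^ 2 * csc2_sum (- 1 / z) - of_real pi ^ 2 / 3)) (- {0})"
    by (rule has_sum_cong[THEN iffD1, rotated]) (auto simp: s_def)
  hence "(s has_sum (s 0 + (1 / z ^ 2 * csc2_sum (- 1 / z) - of_real pi ^ 2 / 3))) (insert 0 (- {0}))"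
    by (intro has_sum_insert) auto
  moreover have "insert 0 (- {0}) = (UNIV :: int set)" by auto
  moreover have "s 0 + (1 / z ^ 2 * csc2_sum (- 1 / z) - of_real pi ^ 2 / 3) = S"
    by (simp add: S_def s_def)
  ultimately have s: "(s has_sum S) UNIV" by simp
  have cols: "((\<lambda>n. s n - (c (n - 1) - c n)) has_sum csc2_sum z) UNIV"
    by (rule has_sum_SigmaD[OF csc2_sum_has_sum(2)[OF z]])
       (use eis_term_column[OF z] in \<open>simp add: s_def c_def\<close>)
  \<comment> \<open>The range from -N + 1 to N makes the telescoped boundary the pair c(-N) - c(N),
    and c is odd.\<close>
  have "(\<lambda>N. \<Sum>n = - int N + 1..int N. s n - (s n - (c (n - 1) - c n))) \<longlonglongrightarrow> S - csc2_sum z"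
    by (rule has_sum_int_exhaustion[OF has_sum_difference[OF s cols]]) auto
  hence "(\<lambda>N. \<Sum>n = - int N + 1..int N. c (n - 1) - c n) \<longlonglongrightarrow> S - csc2_sum z" by simp
  hence lim: "(\<lambda>N. c (- int N) - c (int N)) \<longlonglongrightarrow> S - csc2_sum z"
    by (simp only: sum_telescope_int)
  have "Im (1 / z) < 0" using Im_minus_inverse_pos[OF z] by simp
  hence "(\<lambda>N. - 2 * (of_real pi / z * cot (of_real pi * (of_nat N * (1 / z)))) + 2 * (1 / of_nat N))
      \<longlonglongrightarrow> - 2 * (of_real pi / z * \<i>) + 2 * 0"
    by (intro tendsto_intros tendsto_cot_lower lim_1_over_n)
  hence "(\<lambda>N. c (- int N) - c (int N)) \<longlonglongrightarrow> - 2 * (of_real pi / z * \<i>) + 2 * 0"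
    by (rule Lim_transform_eventually)
       (use eventually_gt_at_top[of 0] in eventually_elim, simp add: c_def)
  with lim have "S - csc2_sum z = - 2 * (of_real pi / z * \<i>) + 2 * 0" by (rule LIMSEQ_unique)
  hence "csc2_sum z = S + 2 * of_real pi * \<i> / z" by (simp add: algebra_simps)
  thus ?thesis by (simp add: S_def algebra_simps)
qed

section \<open>The Euler product\<close>

definition euler_prod :: "complex \<Rightarrow> complex" where
  "euler_prod q = (\<Prod>n. 1 - q ^ Suc n)"

lemma euler_prod_convergent:
  fixes q :: complex
  assumes "norm q < 1"
  shows "convergent_prod (\<lambda>n. 1 - q ^ Suc n)"
proof -
  have "abs_convergent_prod (\<lambda>n. 1 - q ^ Suc n)"
  proof (rule summable_imp_abs_convergent_prod)
    have "summable (\<lambda>n. norm q ^ Suc n)"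
      using assms by (subst summable_Suc_iff) (intro summable_geometric, auto)
    thus "summable (\<lambda>n. norm (1 - q ^ Suc n - 1))"
      by (simp add: norm_mult norm_power)
  qed
  thus ?thesis by (rule abs_convergent_prod_imp_convergent_prod)
qed

lemma euler_prod_LIMSEQ:
  assumes "norm q < 1"
  shows "(\<lambda>N. \<Prod>n<N. 1 - q ^ Suc n) \<longlonglongrightarrow> euler_prod q"
  using convergent_prod_LIMSEQ[OF euler_prod_convergent[OF assms]]
  by (simp only: euler_prod_def LIMSEQ_lessThan_iff_atMost)

lemma euler_prod_uniform_limit:
  assumes r: "r < 1"
  shows "uniform_limit (cball 0 r) (\<lambda>N q. \<Prod>n<N. 1 - q ^ Suc n) euler_prod sequentially"
proof (cases "r \<ge> 0")
  case True
  have "uniformly_convergent_on (cball 0 r) (\<lambda>N q::complex. \<Prod>n<N. 1 + - (q ^ Suc n))"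
  proof (rule uniformly_convergent_on_prod)
    show "uniformly_convergent_on (cball 0 r) (\<lambda>N q::complex. \<Sum>n<N. norm (- (q ^ Suc n)))"
    proof (rule Weierstrass_m_test')
      show "norm (norm (- (q ^ Suc n))) \<le> r ^ Suc n" if "q \<in> cball 0 r" for n and q :: complex
        using that True by (auto simp: norm_mult norm_power intro!: mult_mono power_mono)
      show "summable (\<lambda>n. r ^ Suc n)"
        using r True by (subst summable_Suc_iff) (intro summable_geometric, auto)
    qed
  qed (auto intro!: continuous_intros)
  hence conv: "uniformly_convergent_on (cball 0 r) (\<lambda>N q::complex. \<Prod>n<N. 1 - q ^ Suc n)"
    by (simp only: diff_conv_add_uminus)
  hence "uniform_limit (cball 0 r) (\<lambda>N q::complex. \<Prod>n<N. 1 - q ^ Suc n)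
      (\<lambda>q. lim (\<lambda>N. \<Prod>n<N. 1 - q ^ Suc n)) sequentially"
    by (simp only: uniformly_convergent_uniform_limit_iff)
  thus ?thesis
    by (rule uniform_limit_cong'[THEN iffD1, rotated 2]) (use r limI[OF euler_prod_LIMSEQ] in auto)
next
  case False
  hence "cball 0 r = ({} :: complex set)" by auto
  thus ?thesis by (simp only: uniform_limit_on_subset[OF _ empty_subsetI])
     (simp add: uniform_limit_iff)
qed

lemma norm_power_less_1:
  fixes q :: complex
  assumes "norm q < 1" "n > 0"
  shows "norm (q ^ n) < 1"
  using power_strict_mono[OF assms(1) norm_ge_zero assms(2)] by (simp add: norm_power)

lemma one_minus_power_nonzero:
  fixes q :: complex
  assumes "norm q < 1" "n > 0"
  shows "1 - q ^ n \<noteq> 0"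
  using norm_power_less_1[OF assms] by auto

lemma euler_prod_nonzero:
  assumes "norm q < 1"
  shows "euler_prod q \<noteq> 0"
  unfolding euler_prod_def
  using euler_prod_convergent[OF assms] one_minus_power_nonzero[OF assms, of "Suc _"]
  by (intro prodinf_nonzero) auto

lemma euler_prod_0 [simp]: "euler_prod 0 = 1"
  by (simp add: euler_prod_def)

lemma holomorphic_euler_prod: "euler_prod holomorphic_on ball 0 1"
proof (rule holomorphic_uniform_sequence[where f = "\<lambda>N q. \<Prod>n<N. 1 - q ^ Suc n"])
  fix x :: complex assume x: "x \<in> ball 0 1"
  define d where "d = (1 - norm x) / 2"
  have "d > 0" using x by (simp add: d_def)
  have sub: "cball x d \<subseteq> cball 0 (norm x + d)"
    by (metis add.commute add_0 cball_subset_cball_iff dist_0_norm dist_commute order_refl)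
  have "norm x + d < 1" using x by (simp add: d_def field_simps)
  hence "cball 0 (norm x + d) \<subseteq> ball (0::complex) 1" by auto
  moreover have "uniform_limit (cball x d) (\<lambda>N q. \<Prod>n<N. 1 - q ^ Suc n) euler_prod sequentially"
    using euler_prod_uniform_limit[OF \<open>norm x + d < 1\<close>] sub by (rule uniform_limit_on_subset)
  ultimately show "\<exists>d>0. cball x d \<subseteq> ball 0 1 \<and>
      uniform_limit (cball x d) (\<lambda>N q. \<Prod>n<N. 1 - q ^ Suc n) euler_prod sequentially"
    using \<open>d > 0\<close> sub by blast
qed (auto intro!: holomorphic_intros)

lemma holomorphic_on_euler_prod [holomorphic_intros]:
  assumes "f holomorphic_on A" "\<And>z. z \<in> A \<Longrightarrow> norm (f z) < 1"
  shows "(\<lambda>z. euler_prod (f z)) holomorphic_on A"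
  using holomorphic_on_compose_gen[OF assms(1) holomorphic_euler_prod] assms(2)
  by (simp add: o_def image_subset_iff)

section \<open>Lambert series and the logarithmic derivative of the Euler product\<close>

lemma euler_prod_logderiv:
  assumes q: "norm q < 1"
  shows "(\<lambda>n. of_nat (Suc n) * q ^ Suc n / (1 - q ^ Suc n)) sums
           (- q * deriv euler_prod q / euler_prod q)"
proof -
  obtain r where r: "norm q < r" "r < 1" using dense[OF q] by auto
  have "(\<lambda>n. deriv (\<lambda>q. 1 - q ^ Suc n) q / (1 - q ^ Suc n)) sums (deriv euler_prod q / euler_prod q)"
  proof (rule logderiv_prodinf_complex_uniform_limit[where A = "ball 0 r"])
    show "uniform_limit (ball 0 r) (\<lambda>N q. \<Prod>n<N. 1 - q ^ Suc n) euler_prod sequentially"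
      using euler_prod_uniform_limit[OF r(2)] by (rule uniform_limit_on_subset) auto
  qed (use r q euler_prod_nonzero in \<open>auto intro!: holomorphic_intros\<close>)
  moreover have "deriv (\<lambda>q. 1 - q ^ Suc n) q = - (of_nat (Suc n) * q ^ n)" for n
    by (rule DERIV_imp_deriv) (auto intro!: derivative_eq_intros simp del: power_Suc)
  ultimately have "(\<lambda>n. - (of_nat (Suc n) * q ^ n) / (1 - q ^ Suc n)) sums (deriv euler_prod q / euler_prod q)"
    by simp
  from sums_mult[OF this, of "- q"] show ?thesis
    by (simp add: mult_ac)
qed

lemma has_sum_lambert_square:
  fixes x :: complex
  assumes x: "norm x < 1"
  shows "((\<lambda>m. of_nat (Suc m) * x ^ Suc m) has_sum (x / (1 - x) ^ 2)) UNIV"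
proof (rule norm_summable_imp_has_sum)
  have "summable (\<lambda>n. of_nat (Suc n) * norm x ^ n)"
    using geometric_deriv_sums[of "norm x"] x by (simp add: sums_iff)
  from summable_mult[OF this, of "norm x"]
  show "summable (\<lambda>n. norm (of_nat (Suc n) * x ^ Suc n))"
    by (simp add: norm_mult norm_power mult_ac del: of_nat_Suc)
  have "(\<lambda>n. of_nat (Suc n) * x ^ n) sums (1 / (1 - x) ^ 2)"
    by (rule geometric_deriv_sums) fact
  from sums_mult[OF this, of x] show "(\<lambda>n. of_nat (Suc n) * x ^ Suc n) sums (x / (1 - x) ^ 2)"
    by (simp add: mult_ac)
qed

lemma has_sum_geometric_Suc:
  fixes x :: complex
  assumes x: "norm x < 1"
  shows "((\<lambda>m. x ^ Suc m) has_sum (x / (1 - x))) UNIV"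
proof (rule norm_summable_imp_has_sum)
  have "summable (\<lambda>n. norm x ^ Suc n)"
    using x by (subst summable_Suc_iff) (intro summable_geometric, auto)
  thus "summable (\<lambda>n. norm (x ^ Suc n))" by (simp add: norm_mult norm_power)
  have "(\<lambda>n. x ^ n) sums (1 / (1 - x))" by (rule geometric_sums) fact
  from sums_mult[OF this, of x] show "(\<lambda>n. x ^ Suc n) sums (x / (1 - x))" by simp
qed

text \<open>Both series are iterated sums of the double series n q^(n m): summing over m first gives
  n q^n / (1 - q^n), summing over n first gives q^m / (1 - q^m)^2.\<close>

lemma lambert_swap:
  fixes q :: complex
  assumes q: "norm q < 1" and S: "(\<lambda>n. of_nat (Suc n) * q ^ Suc n / (1 - q ^ Suc n)) sums S"
  shows "((\<lambda>m. q ^ Suc m / (1 - q ^ Suc m) ^ 2) has_sum S) UNIV"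
proof -
  define f where "f = (\<lambda>(n, m). of_nat (Suc n) * q ^ (Suc n * Suc m))"
  have pw: "norm (q ^ Suc n) < 1" for n
    by (rule norm_power_less_1[OF q]) simp
  have row: "((\<lambda>m. f (n, m)) has_sum (of_nat (Suc n) * q ^ Suc n / (1 - q ^ Suc n))) UNIV" for n
    using has_sum_cmult_right[OF has_sum_geometric_Suc[OF pw[of n]], of "of_nat (Suc n)"]
    by (simp only: f_def prod.case power_mult times_divide_eq_right)
  have col: "((\<lambda>n. f (n, m)) has_sum (q ^ Suc m / (1 - q ^ Suc m) ^ 2)) UNIV" for m
    using has_sum_lambert_square[OF pw[of m]]
    by (simp only: f_def prod.case power_mult[symmetric] mult.commute[of "Suc m"])
  have "(\<lambda>x. norm (f x)) summable_on (UNIV \<times> UNIV)"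
  proof (rule summable_on_SigmaI)
    define r where "r = norm q"
    have r: "0 \<le> r" "r < 1" using q by (auto simp: r_def)
    show "((\<lambda>m. norm (f (n, m))) has_sum (real (Suc n) * r ^ Suc n / (1 - r ^ Suc n))) UNIV" for n
    proof (rule norm_summable_imp_has_sum)
      have rn: "norm (r ^ Suc n) < 1"
        using pw[of n] unfolding r_def norm_power by simp
      have "(\<lambda>m. (r ^ Suc n) ^ m) sums (1 / (1 - r ^ Suc n))" by (rule geometric_sums) fact
      from sums_mult[OF this, of "real (Suc n) * r ^ Suc n"]
      have *: "(\<lambda>m. norm (f (n, m))) sums (real (Suc n) * r ^ Suc n / (1 - r ^ Suc n))"
        unfolding f_def prod.case norm_mult norm_power norm_of_nat r_def power_mult power_Suc[of _ "_ :: nat"]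
        by (simp add: mult_ac power_mult_distrib power_mult)
      show "(\<lambda>m. norm (f (n, m))) sums (real (Suc n) * r ^ Suc n / (1 - r ^ Suc n))" by (rule *)
      show "summable (\<lambda>m. norm (norm (f (n, m))))" using * by (simp add: sums_iff)
    qed
    have "summable (\<lambda>n. real (Suc n) * r ^ n)"
      using geometric_deriv_sums[of r] r by (simp add: sums_iff)
    hence "summable (\<lambda>n. real (Suc n) * r ^ n * (r / (1 - r)))" by (rule summable_mult2)
    hence "summable (\<lambda>n. norm (real (Suc n) * r ^ Suc n / (1 - r ^ Suc n)))"
    proof (rule summable_comparison_test')
      fix n :: nat
      have rn: "r ^ Suc n \<le> r" using r by (simp add: mult_left_le power_le_one)
      hence "real (Suc n) * r ^ Suc n / (1 - r ^ Suc n) \<le> real (Suc n) * r ^ Suc n / (1 - r)"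
        using r by (intro divide_left_mono mult_nonneg_nonneg mult_pos_pos) auto
      moreover have "real (Suc n) * r ^ Suc n / (1 - r ^ Suc n) \<ge> 0"
        using r rn by (intro divide_nonneg_nonneg mult_nonneg_nonneg) auto
      ultimately show "norm (norm (real (Suc n) * r ^ Suc n / (1 - r ^ Suc n))) \<le> real (Suc n) * r ^ n * (r / (1 - r))"
        unfolding real_norm_def abs_idempotent by (subst abs_of_nonneg) (simp_all add: mult_ac)
    qed
    thus "(\<lambda>n. real (Suc n) * r ^ Suc n / (1 - r ^ Suc n)) summable_on UNIV"
      by (rule norm_summable_imp_summable_on)
  qed auto
  hence "f summable_on (UNIV \<times> UNIV)" by (rule Infinite_Sum.abs_summable_summable)
  then obtain T where T: "(f has_sum T) (UNIV \<times> UNIV)" by (auto simp: summable_on_def)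
  have "((\<lambda>n. of_nat (Suc n) * q ^ Suc n / (1 - q ^ Suc n)) has_sum T) UNIV"
    using T row by (rule has_sum_SigmaD)
  hence "T = S" using has_sum_imp_sums sums_unique2 S by blast
  have "((\<lambda>(m, n). f (n, m)) has_sum T) (UNIV \<times> UNIV)"
    using T by (subst (asm) has_sum_swap)
  hence "((\<lambda>m. q ^ Suc m / (1 - q ^ Suc m) ^ 2) has_sum T) UNIV"
    by (rule has_sum_SigmaD) (use col in auto)
  thus ?thesis using \<open>T = S\<close> by simp
qed

lemma norm_qpar_less_1: "Im z > 0 \<Longrightarrow> norm (qpar z) < 1"
  by (simp add: qpar_def mult_pos_pos)

lemma qpar_nonzero [simp]: "qpar z \<noteq> 0"
  by (simp add: qpar_def)

lemma qpar_add: "qpar (z + w) = qpar z * qpar w"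
  by (simp add: qpar_def exp_add distrib_left)

lemma qpar_of_nat_mult: "qpar (of_nat n * z) = qpar z ^ n"
  unfolding qpar_def by (simp flip: exp_of_nat_mult) (simp add: mult_ac)

lemma qpar_1 [simp]: "qpar 1 = 1" "qpar (1/2) = -1"
  by (simp_all add: qpar_def exp_pi_i exp_two_pi_i)

lemma csc2_qpar:
  assumes z: "Im z > 0" and m: "m > 0"
  shows "of_real pi ^ 2 / sin (of_real pi * (of_nat m * z)) ^ 2 =
     - 4 * of_real pi ^ 2 * (qpar z ^ m / (1 - qpar z ^ m) ^ 2)"
proof -
  define y where "y = exp (\<i> * (of_real pi * (of_nat m * z)))"
  have y0: "y \<noteq> 0" by (simp add: y_def)
  have ym: "qpar z ^ m = y ^ 2"
    unfolding qpar_of_nat_mult[symmetric] unfolding y_def qpar_def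
    by (simp flip: exp_of_nat_mult) (simp add: mult_ac)
  have nz: "1 - y ^ 2 \<noteq> 0"
    using one_minus_power_nonzero[OF norm_qpar_less_1[OF z] m] by (simp add: ym)
  have s: "sin (of_real pi * (of_nat m * z)) = (y - inverse y) / (2 * \<i>)"
    by (simp add: sin_exp_eq y_def exp_minus)
  have "(y - inverse y) ^ 2 = (1 - y ^ 2) ^ 2 / y ^ 2"
    using y0 by (simp add: field_simps power2_eq_square)
  thus ?thesis
    unfolding s ym using y0 nz by (simp add: power_divide power_mult_distrib)
qed

text \<open>Row m of the Eisenstein series is -4 pi^2 q^m / (1 - q^m)^2 for m > 0; rows m and -m
  agree, which doubles 4 pi^2 to the constant 8 pi^2.\<close>

lemma csc2_sum_euler_prod:
  assumes z: "Im z > 0"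
  shows "qpar z * deriv euler_prod (qpar z) / euler_prod (qpar z) = csc2_sum z / (8 * of_real pi ^ 2)"
proof -
  define q where "q = qpar z"
  define S where "S = - q * deriv euler_prod q / euler_prod q"
  define g where "g = (\<lambda>m. of_real pi ^ 2 / sin (of_real pi * (of_int m * z)) ^ 2)"
  have q: "norm q < 1" using norm_qpar_less_1[OF z] by (simp add: q_def)
  have "((\<lambda>m. - 4 * of_real pi ^ 2 * (q ^ Suc m / (1 - q ^ Suc m) ^ 2)) has_sum (- 4 * of_real pi ^ 2 * S)) UNIV"
    unfolding S_def by (intro has_sum_cmult_right lambert_swap q euler_prod_logderiv)
  also have "(\<lambda>m. - 4 * of_real pi ^ 2 * (q ^ Suc m / (1 - q ^ Suc m) ^ 2)) = (\<lambda>m. g (int m + 1))"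
    unfolding q_def using csc2_qpar[OF z, of "Suc _"] by (simp add: g_def add.commute del: power_Suc)
  finally have nat: "((\<lambda>m. g (int m + 1)) has_sum (- 4 * of_real pi ^ 2 * S)) UNIV" .
  have even: "g (- m) = g m" for m by (simp add: g_def)
  from has_sum_even_int[OF nat even]
  have "csc2_sum z = - 4 * of_real pi ^ 2 * S + - 4 * of_real pi ^ 2 * S"
    using csc2_sum_has_sum(1)[OF z] unfolding g_def[symmetric] by (metis has_sum_unique)
  hence "csc2_sum z = 8 * of_real pi ^ 2 * (- S)" by simp
  thus ?thesis by (simp add: S_def q_def)
qed

text \<open>The identity is exact for partial products, provided those in q and -q have 2 N factors,
  that in q^4 has N, and of the three in q^2 one has 2 N and two have N. It expresses eta(z + 1/2)
  through eta at z, 2 z and 4 z, as the cusp 1/2 requires.\<close>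

lemma euler_prod_minus:
  assumes q: "norm q < 1"
  shows "euler_prod (- q) * euler_prod q * euler_prod (q ^ 4) = euler_prod (q ^ 2) ^ 3"
proof -
  define E where "E = (\<lambda>N q. \<Prod>n<N. 1 - q ^ Suc n :: complex)"
  have fin: "E (2 * N) (- q) * E (2 * N) q * E N (q ^ 4) = E (2 * N) (q ^ 2) * E N (q ^ 2) ^ 2" for N
  proof (induction N)
    case (Suc N)
    have *: "E (2 * Suc N) x = E (2 * N) x * (1 - x ^ (2 * N + 1)) * (1 - x ^ (2 * N + 2))" for x
      by (simp add: E_def)
    have **: "E (Suc N) x = E N x * (1 - x ^ (N + 1))" for x
      by (simp add: E_def)
    have 1: "(- q) ^ (2 * N + 1) = - (q ^ (2 * N + 1))" "(- q) ^ (2 * N + 2) = q ^ (2 * N + 2)"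
      by (simp_all add: power_minus_odd power_minus_even)
    have 2: "(q ^ 4) ^ (N + 1) = (q ^ (2 * N + 2)) ^ 2" "(q ^ 2) ^ (2 * N + 1) = (q ^ (2 * N + 1)) ^ 2"
        "(q ^ 2) ^ (2 * N + 2) = (q ^ (2 * N + 2)) ^ 2" "(q ^ 2) ^ (N + 1) = q ^ (2 * N + 2)"
      unfolding power_mult[symmetric] by (rule arg_cong[where f = "power q"], simp)+
    define a b where "a = q ^ (2 * N + 1)" and "b = q ^ (2 * N + 2)"
    have "E (2 * Suc N) (- q) * E (2 * Suc N) q * E (Suc N) (q ^ 4) =
      (E (2 * N) (- q) * E (2 * N) q * E N (q ^ 4)) * ((1 + a) * (1 - b) * (1 - a) * (1 - b) * (1 - b ^ 2))"
      unfolding * ** 1 2 a_def[symmetric] b_def[symmetric] by (simp add: algebra_simps)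
    also have "\<dots> = E (2 * Suc N) (q ^ 2) * E (Suc N) (q ^ 2) ^ 2"
      unfolding Suc.IH * ** 2 a_def[symmetric] b_def[symmetric]
      by (simp add: algebra_simps power2_eq_square)
    finally show ?case .
  qed (simp add: E_def)
  have sub: "filterlim (\<lambda>N::nat. 2 * N) sequentially sequentially"
    by (rule filterlim_subseq) (auto simp: strict_mono_def)
  have lim: "(\<lambda>N. E N x) \<longlonglongrightarrow> euler_prod x" if "norm x < 1" for x
    unfolding E_def by (rule euler_prod_LIMSEQ) fact
  have qn: "norm (- q) < 1" "norm (q ^ 2) < 1" "norm (q ^ 4) < 1"
    using norm_power_less_1[OF q] q by simp_all
  have "(\<lambda>N. E (2 * N) (- q) * E (2 * N) q * E N (q ^ 4)) \<longlonglongrightarrow> euler_prod (- q) * euler_prod q * euler_prod (q ^ 4)"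
    by (intro tendsto_intros filterlim_compose[OF lim sub] lim qn q)
  moreover have "(\<lambda>N. E (2 * N) (q ^ 2) * E N (q ^ 2) ^ 2) \<longlonglongrightarrow> euler_prod (q ^ 2) * euler_prod (q ^ 2) ^ 2"
    by (intro tendsto_intros filterlim_compose[OF lim sub] lim qn q)
  ultimately show ?thesis
    unfolding fin using LIMSEQ_unique by (force simp: power2_eq_square power3_eq_cube)
qed

section \<open>The fourth power of the eta function\<close>

text \<open>This is eta(z)^4: the fourth power of the factor q^(1/24) is q^(1/6) = exp(pi i z /
  3).\<close>

definition eta4 :: "complex \<Rightarrow> complex" where
  "eta4 z = exp (of_real pi * \<i> * z / 3) * euler_prod (qpar z) ^ 4"

lemma upper_half_plane_iff [simp]: "z \<in> upper_half_plane \<longleftrightarrow> Im z > 0"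
  by (simp add: upper_half_plane_def)

lemma open_upper_half_plane: "open upper_half_plane"
  unfolding upper_half_plane_def by (rule open_halfspace_Im_gt)

lemma convex_upper_half_plane: "convex upper_half_plane"
  unfolding upper_half_plane_def by (rule convex_halfspace_Im_gt)

lemma holomorphic_qpar [holomorphic_intros]:
  assumes "f holomorphic_on A"
  shows "(\<lambda>z. qpar (f z)) holomorphic_on A"
  unfolding qpar_def by (intro holomorphic_intros assms)

lemma eta4_nonzero: "Im z > 0 \<Longrightarrow> eta4 z \<noteq> 0"
  by (simp add: eta4_def euler_prod_nonzero norm_qpar_less_1)

lemma holomorphic_eta4 [holomorphic_intros]:
  assumes "f holomorphic_on A" "\<And>z. z \<in> A \<Longrightarrow> Im (f z) > 0"
  shows "(\<lambda>z. eta4 (f z)) holomorphic_on A"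
  unfolding eta4_def by (intro holomorphic_intros assms norm_qpar_less_1) auto

lemma eta4_deriv:
  assumes z: "Im z > 0"
  shows "(eta4 has_field_derivative eta4 z * (of_real pi * \<i> / 3 + \<i> * csc2_sum z / of_real pi)) (at z)"
proof -
  define q where "q = qpar z"
  have q: "norm q < 1" using norm_qpar_less_1[OF z] by (simp add: q_def)
  have nz: "euler_prod q \<noteq> 0" by (rule euler_prod_nonzero[OF q])
  have d: "(euler_prod has_field_derivative deriv euler_prod q) (at q)"
    using q by (intro holomorphic_derivI[OF holomorphic_euler_prod]) auto
  have dq: "(qpar has_field_derivative 2 * of_real pi * \<i> * q) (at z)"
    unfolding qpar_def q_def by (auto intro!: derivative_eq_intros)
  have "((\<lambda>z. euler_prod (qpar z)) has_field_derivative deriv euler_prod q * (2 * of_real pi * \<i> * q)) (at z)"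
    using DERIV_chain2[OF d[unfolded q_def] dq] by (simp add: q_def)
  hence "(eta4 has_field_derivative
     exp (of_real pi * \<i> * z / 3) * (of_real pi * \<i> / 3) * euler_prod q ^ 4 +
     exp (of_real pi * \<i> * z / 3) * (4 * euler_prod q ^ 3 * (deriv euler_prod q * (2 * of_real pi * \<i> * q)))) (at z)"
    unfolding eta4_def q_def by (auto intro!: derivative_eq_intros)
  also have "exp (of_real pi * \<i> * z / 3) * (of_real pi * \<i> / 3) * euler_prod q ^ 4 +
     exp (of_real pi * \<i> * z / 3) * (4 * euler_prod q ^ 3 * (deriv euler_prod q * (2 * of_real pi * \<i> * q))) =
     eta4 z * (of_real pi * \<i> / 3 + 8 * of_real pi * \<i> * (q * deriv euler_prod q / euler_prod q))"
    unfolding eta4_def q_def[symmetric] using nz by (simp add: field_simps power_numeral_reduce)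
  also have "q * deriv euler_prod q / euler_prod q = csc2_sum z / (8 * of_real pi ^ 2)"
    unfolding q_def by (rule csc2_sum_euler_prod[OF z])
  also have "8 * of_real pi * \<i> * (csc2_sum z / (8 * of_real pi ^ 2)) = \<i> * csc2_sum z / of_real pi"
    by (simp add: field_simps power2_eq_square)
  finally show ?thesis .
qed

text \<open>The quotient of eta4(-1/z) by z^2 eta4(z) has derivative 0 by the transformation of
  \<open>csc2_sum\<close>; its constant value is read off at the fixed point i, where it is 1 / i^2
  = -1.\<close>

theorem eta4_inversion:
  assumes z: "Im z > 0"
  shows "eta4 (- 1 / z) = - (z ^ 2) * eta4 z"
proof -
  define R where "R = (\<lambda>z. eta4 (- 1 / z) / (z ^ 2 * eta4 z))"
  have D: "(R has_field_derivative 0) (at z within upper_half_plane)" if "z \<in> upper_half_plane" for z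
  proof -
    have z: "Im z > 0" and z0: "z \<noteq> 0" using that by auto
    have w: "Im (- 1 / z) > 0" by (rule Im_minus_inverse_pos[OF z])
    define A where "A = of_real pi * \<i> / 3 + \<i> * csc2_sum (- 1 / z) / of_real pi"
    define B where "B = of_real pi * \<i> / 3 + \<i> * csc2_sum z / of_real pi"
    have "((\<lambda>z. - 1 / z) has_field_derivative 1 / z ^ 2) (at z)"
      using z0 by (auto intro!: derivative_eq_intros simp: power2_eq_square)
    from DERIV_chain2[OF eta4_deriv[OF w] this]
    have 1: "((\<lambda>z. eta4 (- 1 / z)) has_field_derivative eta4 (- 1 / z) * A * (1 / z ^ 2)) (at z)"
      by (simp add: A_def)
    have 2: "(eta4 has_field_derivative eta4 z * B) (at z)"
      using eta4_deriv[OF z] by (simp add: B_def)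
    \<comment> \<open>This is \<open>csc2_sum_transform\<close>: the terms with pi^2 / 3 cancel
      against the derivatives of the exponential factors, and 2 pi i / z cancels the 2 / z that
      comes from z^2.\<close>
    have AB: "A / z ^ 2 - 2 / z - B = 0"
      unfolding A_def B_def csc2_sum_transform[OF z] using z0
      by (simp add: field_simps power2_eq_square)
    have nz: "eta4 z \<noteq> 0" by (rule eta4_nonzero[OF z])
    have 3: "((\<lambda>z. z ^ 2 * eta4 z) has_field_derivative 2 * z * eta4 z + z ^ 2 * (eta4 z * B)) (at z)"
      by (rule derivative_eq_intros refl 2 | simp)+
    have "(R has_field_derivative
       ((eta4 (- 1 / z) * A * (1 / z ^ 2)) * (z ^ 2 * eta4 z) - eta4 (- 1 / z) * (2 * z * eta4 z + z ^ 2 * (eta4 z * B)))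
         / ((z ^ 2 * eta4 z) * (z ^ 2 * eta4 z))) (at z)"
      unfolding R_def by (rule DERIV_divide[OF 1 3]) (use nz z0 in auto)
    also have "((eta4 (- 1 / z) * A * (1 / z ^ 2)) * (z ^ 2 * eta4 z) - eta4 (- 1 / z) * (2 * z * eta4 z + z ^ 2 * (eta4 z * B)))
      = eta4 (- 1 / z) * eta4 z * z ^ 2 * (A / z ^ 2 - 2 / z - B)"
      using z0 by (simp add: field_simps power2_eq_square)
    finally show ?thesis by (simp add: AB has_field_derivative_at_within)
  qed
  obtain c where c: "\<And>z. z \<in> upper_half_plane \<Longrightarrow> R z = c"
    using has_field_derivative_zero_constant[OF convex_upper_half_plane D] by blast
  have "R \<i> = - 1" using eta4_nonzero[of \<i>] by (simp add: R_def divide_i)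
  hence "R z = - 1" using c z by (metis imaginary_unit.simps(2) upper_half_plane_iff zero_less_one)
  moreover have "z ^ 2 * eta4 z \<noteq> 0" using eta4_nonzero[OF z] z by auto
  ultimately have "eta4 (- 1 / z) = - 1 * (z ^ 2 * eta4 z)"
    unfolding R_def by (metis nonzero_divide_eq_eq)
  thus ?thesis by simp
qed

text \<open>The hypothesis as a product lets the inversion be applied at multiples such as 2 w and 4
  w without first rewriting them as quotients.\<close>

lemma eta4_inversion':
  assumes "Im z > 0" and "w * z = -1"
  shows "eta4 w = - (z ^ 2) * eta4 z"
proof -
  have "z \<noteq> 0" using assms by auto
  hence "w = - 1 / z" using assms(2) by (metis nonzero_eq_divide_eq)
  thus ?thesis using eta4_inversion[OF assms(1)] by simp
qed

lemma eta4_translate: "eta4 (z + of_nat n) = exp (of_real pi * \<i> / 3) ^ n * eta4 z"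
proof -
  have "qpar (z + of_nat n) = qpar z"
    using qpar_of_nat_mult[of n 1] by (simp add: qpar_add)
  thus ?thesis
    by (simp add: eta4_def ring_distribs add_divide_distrib exp_add flip: exp_of_nat_mult)
       (simp add: mult_ac)
qed

text \<open>Fourth power of \<open>euler_prod_minus\<close>. The fractional powers of q collect to
  x^6 on both sides, and exp(pi i / 6) comes from the shift by 1/2 in the exponential.\<close>

lemma eta4_half_translate:
  assumes z: "Im z > 0"
  shows "eta4 (z + 1/2) * (eta4 z * eta4 (4 * z)) = exp (of_real pi * \<i> / 6) * eta4 (2 * z) ^ 3"
proof -
  define q x where "q = qpar z" and "x = exp (of_real pi * \<i> * z / 3)"
  have q: "norm q < 1" using norm_qpar_less_1[OF z] by (simp add: q_def)
  have qs: "qpar (z + 1/2) = - q" "qpar (2 * z) = q ^ 2" "qpar (4 * z) = q ^ 4"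
    using qpar_of_nat_mult[of 2 z] qpar_of_nat_mult[of 4 z] by (simp_all add: qpar_add q_def)
  have xs: "exp (of_real pi * \<i> * (2 * z) / 3) = x ^ 2" "exp (of_real pi * \<i> * (4 * z) / 3) = x ^ 4"
    "exp (of_real pi * \<i> * (z + 1 / 2) / 3) = exp (of_real pi * \<i> / 6) * x"
    unfolding x_def by (simp_all flip: exp_of_nat_mult exp_add add: field_simps)
  have "eta4 (z + 1/2) * (eta4 z * eta4 (4 * z)) =
      exp (of_real pi * \<i> / 6) * x ^ 6 * (euler_prod (- q) * euler_prod q * euler_prod (q ^ 4)) ^ 4"
    unfolding eta4_def qs xs unfolding x_def[symmetric] q_def[symmetric]
    by (simp add: power_mult_distrib power_numeral_reduce)
  also have "\<dots> = exp (of_real pi * \<i> / 6) * eta4 (2 * z) ^ 3"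
    unfolding euler_prod_minus[OF q] eta4_def qs xs
    by (simp add: power_mult_distrib flip: power_mult)
  finally show ?thesis .
qed

section \<open>The eta quotients phi and P: translation, Fricke involution, expansions at the
  cusps\<close>

definition hauptmodul4 :: "complex \<Rightarrow> complex" where
  "hauptmodul4 z = (if Im z > 0 then eta4 z ^ 2 / eta4 (4 * z) ^ 2 else 0)"

definition weight2_form :: "complex \<Rightarrow> complex" where
  "weight2_form z = (if Im z > 0 then eta4 (4 * z) ^ 2 / eta4 (2 * z) else 0)"

lemma exp_pi_third_power: "exp (of_real pi * \<i> / 3) ^ 6 = (1 :: complex)"
proof -
  have "exp (of_real pi * \<i> / 3) ^ 6 = exp (of_nat 6 * (of_real pi * \<i> / 3) :: complex)"
    by (simp only: exp_of_nat_mult)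
  also have "of_nat 6 * (of_real pi * \<i> / 3) = 2 * of_real pi * \<i>" by simp
  finally show ?thesis by (simp only: exp_two_pi_i)
qed

lemma eta4_multiple:
  "eta4 (of_nat n * z) = exp (of_real pi * \<i> * z / 3) ^ n * euler_prod (qpar z ^ n) ^ 4"
  unfolding eta4_def qpar_of_nat_mult by (simp flip: exp_of_nat_mult) (simp add: mult_ac)

lemmas eta4_multiples = eta4_multiple[of 2, simplified] eta4_multiple[of 4, simplified]

lemma exp_qpar_root: "exp (of_real pi * \<i> * z / 3) ^ 6 = qpar z"
  by (simp add: qpar_def mult_ac flip: exp_of_nat_mult)

lemma hauptmodul4_qexp:
  assumes z: "Im z > 0"
  shows "hauptmodul4 z = (euler_prod (qpar z) / euler_prod (qpar z ^ 4)) ^ 8 / qpar z"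
proof -
  define x where "x = exp (of_real pi * \<i> * z / 3)"
  have "x \<noteq> 0" by (simp add: x_def)
  have "hauptmodul4 z = (x * euler_prod (qpar z) ^ 4) ^ 2 / (x ^ 4 * euler_prod (qpar z ^ 4) ^ 4) ^ 2"
    using z by (simp add: hauptmodul4_def eta4_multiples eta4_def[of z] x_def)
  also have "\<dots> = (euler_prod (qpar z) / euler_prod (qpar z ^ 4)) ^ 8 / x ^ 6"
    using \<open>x \<noteq> 0\<close> by (simp add: power_mult_distrib power_divide power_numeral_reduce)
  finally show ?thesis by (simp add: x_def exp_qpar_root)
qed

lemma weight2_form_qexp:
  assumes z: "Im z > 0"
  shows "weight2_form z = qpar z * (euler_prod (qpar z ^ 4) ^ 8 / euler_prod (qpar z ^ 2) ^ 4)"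
proof -
  define x where "x = exp (of_real pi * \<i> * z / 3)"
  have "x \<noteq> 0" by (simp add: x_def)
  have "weight2_form z = (x ^ 4 * euler_prod (qpar z ^ 4) ^ 4) ^ 2 / (x ^ 2 * euler_prod (qpar z ^ 2) ^ 4)"
    using z by (simp add: weight2_form_def eta4_multiples x_def)
  also have "\<dots> = x ^ 6 * (euler_prod (qpar z ^ 4) ^ 8 / euler_prod (qpar z ^ 2) ^ 4)"
    using \<open>x \<noteq> 0\<close> by (simp add: power_mult_distrib power_divide power_numeral_reduce)
  finally show ?thesis by (simp add: x_def exp_qpar_root)
qed

lemma
  shows hauptmodul4_translate: "hauptmodul4 (z + 1) = hauptmodul4 z"
    and weight2_form_translate: "weight2_form (z + 1) = weight2_form z"
proof -
  define \<zeta> where "\<zeta> = exp (of_real pi * \<i> / 3)"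
  have "\<zeta> \<noteq> 0" by (simp add: \<zeta>_def)
  have "eta4 (z + 1) = \<zeta> * eta4 z" "eta4 (2 * (z + 1)) = \<zeta> ^ 2 * eta4 (2 * z)"
    "eta4 (4 * (z + 1)) = \<zeta> ^ 4 * eta4 (4 * z)"
    using eta4_translate[of z 1] eta4_translate[of "2 * z" 2] eta4_translate[of "4 * z" 4]
    by (simp_all add: \<zeta>_def distrib_left)
  moreover have "(\<zeta> ^ 4) ^ 2 = \<zeta> ^ 2 * \<zeta> ^ 6" by (simp flip: power_add power_mult)
  moreover have "\<zeta> ^ 6 = 1" by (simp add: \<zeta>_def exp_pi_third_power)
  ultimately show "hauptmodul4 (z + 1) = hauptmodul4 z" "weight2_form (z + 1) = weight2_form z"
    using \<open>\<zeta> \<noteq> 0\<close> by (simp_all add: hauptmodul4_def weight2_form_def power_mult_distrib)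
qed

lemma Im_fricke_pos:
  assumes "Im z > 0"
  shows "Im (- 1 / (4 * z)) > 0"
  using Im_minus_inverse_pos[of "4 * z"] assms by simp

text \<open>The Fricke involution z -> -1 / (4 z) exchanges \<open>eta4\<close> at z and at 4 z up
  to the factors -16 z^2 and -z^2; the square of their quotient is 256.\<close>

lemma hauptmodul4_fricke:
  assumes z: "Im z > 0"
  shows "hauptmodul4 (- 1 / (4 * z)) = 256 / hauptmodul4 z"
proof -
  have z0: "z \<noteq> 0" using z by auto
  have "eta4 (- 1 / (4 * z)) = - ((4 * z) ^ 2) * eta4 (4 * z)"
    by (rule eta4_inversion') (use z z0 in auto)
  moreover have "eta4 (4 * (- 1 / (4 * z))) = - (z ^ 2) * eta4 z"
    by (rule eta4_inversion') (use z z0 in auto)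
  ultimately show ?thesis
    using z z0 Im_fricke_pos[OF z] eta4_nonzero[of z] eta4_nonzero[of "4 * z"]
    by (simp add: hauptmodul4_def power_mult_distrib del: times_divide_eq_right mult_minus_right minus_divide_left)
qed

text \<open>The lower unipotent generator is conjugate to a unit translation under the Fricke
  involution, so the claim follows from periodicity and two applications of
  \<open>hauptmodul4_fricke\<close>.\<close>

lemma hauptmodul4_V:
  assumes z: "Im z > 0"
  shows "hauptmodul4 (z / (4 * z + 1)) = hauptmodul4 z"
proof -
  define y where "y = - 1 / (4 * z) - 1"
  have z0: "z \<noteq> 0" using z by auto
  have y: "Im y > 0" using Im_fricke_pos[OF z] by (simp add: y_def)
  have z1: "4 * z + 1 \<noteq> 0" using z by (auto simp: complex_eq_iff)
  have "4 * y = - ((4 * z + 1) / z)" using z0 by (simp add: y_def field_simps)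
  hence "z / (4 * z + 1) = - 1 / (4 * y)" by simp
  hence "hauptmodul4 (z / (4 * z + 1)) = 256 / hauptmodul4 y"
    using hauptmodul4_fricke[OF y] by simp
  also have "hauptmodul4 y = hauptmodul4 (- 1 / (4 * z))"
    using hauptmodul4_translate[of y] by (simp add: y_def)
  also have "\<dots> = 256 / hauptmodul4 z" by (rule hauptmodul4_fricke[OF z])
  finally show ?thesis by simp
qed

text \<open>The same conjugation as in weight 0; the Fricke involution now leads from P to Q =
  eta(z)^8 / eta(2 z)^4, which is itself periodic, and back.\<close>

lemma weight2_form_V:
  assumes z: "Im z > 0"
  shows "weight2_form (z / (4 * z + 1)) = (4 * z + 1) ^ 2 * weight2_form z"
proof -
  define Q where "Q = (\<lambda>y. eta4 y ^ 2 / eta4 (2 * y))"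
  have Q1: "Q (y + 1) = Q y" for y
    using eta4_translate[of y 1] eta4_translate[of "2 * y" 2]
    by (simp add: Q_def distrib_left power_mult_distrib)
  have P: "weight2_form w = - (y ^ 2 / 4) * Q y" if y: "Im y > 0" and w: "w = - 1 / (4 * y)" for y w
  proof -
    have y0: "y \<noteq> 0" using y by auto
    have "eta4 (4 * w) = - (y ^ 2) * eta4 y"
      by (rule eta4_inversion') (use y y0 w in auto)
    moreover have "eta4 (2 * w) = - ((2 * y) ^ 2) * eta4 (2 * y)"
      by (rule eta4_inversion') (use y y0 w in auto)
    moreover have "Im w > 0" using Im_fricke_pos[OF y] w by simp
    ultimately show ?thesis using y0 eta4_nonzero[of "2 * y"] y
      by (simp add: weight2_form_def Q_def field_simps power2_eq_square)
  qed
  have Qf: "Q w = - 64 * z ^ 2 * weight2_form z" if z: "Im z > 0" and w: "w = - 1 / (4 * z)" for z w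
  proof -
    have z0: "z \<noteq> 0" using z by auto
    have "eta4 w = - ((4 * z) ^ 2) * eta4 (4 * z)"
      by (rule eta4_inversion') (use z z0 w in auto)
    moreover have "eta4 (2 * w) = - ((2 * z) ^ 2) * eta4 (2 * z)"
      by (rule eta4_inversion') (use z z0 w in auto)
    ultimately show ?thesis using z0 eta4_nonzero[of "2 * z"] z
      by (simp add: weight2_form_def Q_def field_simps power2_eq_square)
  qed
  define y where "y = - 1 / (4 * z) - 1"
  have z0: "z \<noteq> 0" using z by auto
  have y: "Im y > 0" using Im_fricke_pos[OF z] by (simp add: y_def)
  have z1: "4 * z + 1 \<noteq> 0" using z by (auto simp: complex_eq_iff)
  have "4 * y = - ((4 * z + 1) / z)" using z0 by (simp add: y_def field_simps)
  hence "weight2_form (z / (4 * z + 1)) = - (y ^ 2 / 4) * Q y"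
    by (intro P[OF y]) simp
  also have "Q y = - 64 * z ^ 2 * weight2_form z"
    using Q1[of y] Qf[OF z] by (simp add: y_def)
  also have "- (y ^ 2 / 4) * (- 64 * z ^ 2 * weight2_form z) = (4 * y * z) ^ 2 * weight2_form z"
    by (simp add: power_mult_distrib)
  also have "4 * y * z = - (4 * z + 1)"
    using z0 by (simp add: y_def field_simps)
  finally show ?thesis by (simp only: power2_minus)
qed

text \<open>The parameter is q^(1/4) because the cusp 0 has width 4; the explicit factor w exhibits
  a simple zero there.\<close>

lemma hauptmodul4_S:
  assumes z: "Im z > 0"
  defines "w \<equiv> qpar (z / 4)"
  shows "hauptmodul4 (- 1 / z) = w * (256 * (euler_prod (w ^ 4) / euler_prod w) ^ 8)"
proof -
  define y where "y = z / 4"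
  define x where "x = exp (of_real pi * \<i> * y / 3)"
  have x0: "x \<noteq> 0" by (simp add: x_def)
  have y: "Im y > 0" "z = 4 * y" and y0: "y \<noteq> 0" using z by (auto simp: y_def)
  have 1: "eta4 (- 1 / z) = - ((4 * y) ^ 2) * eta4 (4 * y)"
    using eta4_inversion[OF z] y(2) by simp
  have 2: "eta4 (4 * (- 1 / z)) = - (y ^ 2) * eta4 y"
    by (rule eta4_inversion') (use y y0 in auto)
  have "hauptmodul4 (- 1 / z) = (- ((4 * y) ^ 2) * eta4 (4 * y)) ^ 2 / (- (y ^ 2) * eta4 y) ^ 2"
    using Im_minus_inverse_pos[OF z] by (simp only: hauptmodul4_def 1 2 if_True)
  also have "\<dots> = 256 * (eta4 (4 * y) ^ 2 / eta4 y ^ 2)"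
    using y0 by (simp add: power_mult_distrib)
  also have "\<dots> = 256 * ((x ^ 4 * euler_prod (w ^ 4) ^ 4) ^ 2 / (x * euler_prod w ^ 4) ^ 2)"
    unfolding eta4_multiples eta4_def[of y] by (simp add: x_def w_def y_def)
  also have "\<dots> = x ^ 6 * (256 * (euler_prod (w ^ 4) / euler_prod w) ^ 8)"
    using x0 by (simp add: power_mult_distrib power_divide power_numeral_reduce)
  also have "x ^ 6 = w" unfolding x_def exp_qpar_root by (simp add: w_def y_def)
  finally show ?thesis .
qed

text \<open>No power of w appears as a factor: the value at the cusp 0 is -1/64, so negative powers
  of P stay holomorphic there.\<close>

lemma weight2_form_S:
  assumes z: "Im z > 0"
  defines "w \<equiv> qpar (z / 4)"
  shows "weight2_form (- 1 / z) / z ^ 2 = - (1 / 64) * (euler_prod w ^ 8 / euler_prod (w ^ 2) ^ 4)"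
proof -
  define y where "y = z / 4"
  define x where "x = exp (of_real pi * \<i> * y / 3)"
  have x0: "x \<noteq> 0" by (simp add: x_def)
  have y: "Im y > 0" "z = 4 * y" and y0: "y \<noteq> 0" using z by (auto simp: y_def)
  have 1: "eta4 (2 * (- 1 / z)) = - ((2 * y) ^ 2) * eta4 (2 * y)"
    by (rule eta4_inversion') (use y y0 in auto)
  have 2: "eta4 (4 * (- 1 / z)) = - (y ^ 2) * eta4 y"
    by (rule eta4_inversion') (use y y0 in auto)
  have "weight2_form (- 1 / z) / z ^ 2 = (- (y ^ 2) * eta4 y) ^ 2 / (- ((2 * y) ^ 2) * eta4 (2 * y)) / (4 * y) ^ 2"
    using Im_minus_inverse_pos[OF z] unfolding y(2)[symmetric] by (simp only: weight2_form_def 1 2 if_True)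
  also have "\<dots> = - (1 / 64) * (eta4 y ^ 2 / eta4 (2 * y))"
    using y0 by (simp add: power_mult_distrib power_numeral_reduce)
  also have "\<dots> = - (1 / 64) * ((x * euler_prod w ^ 4) ^ 2 / (x ^ 2 * euler_prod (w ^ 2) ^ 4))"
    unfolding eta4_multiples eta4_def[of y] by (simp add: x_def w_def y_def)
  also have "\<dots> = - (1 / 64) * (euler_prod w ^ 8 / euler_prod (w ^ 2) ^ 4)"
    using x0 by (simp add: power_mult_distrib power_divide power_numeral_reduce)
  finally show ?thesis .
qed

text \<open>The cusp 1/2 is reached from the cusp 0 by the half translation, since
  z / (2 z + 1) = 1/2 - 1 / (4 z + 2).\<close>

lemma half_translate_cusp:
  assumes z: "Im z > 0"
  obtains w where "Im w > 0" "z / (2 * z + 1) = w + 1/2" "w * (4 * z + 2) = -1"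
    "2 * w * (2 * z + 1) = -1" "4 * w * (z + 1/2) = -1"
proof
  define w where "w = - 1 / (4 * z + 2)"
  show "Im w > 0" unfolding w_def by (rule Im_minus_inverse_pos) (use z in simp)
  have nz: "2 * z + 1 \<noteq> 0" "4 * z + 2 \<noteq> 0" using z by (auto simp: complex_eq_iff)
  show 1: "w * (4 * z + 2) = -1" using nz by (simp add: w_def)
  show "2 * w * (2 * z + 1) = -1" "4 * w * (z + 1/2) = -1"
    using 1 by (simp_all add: algebra_simps)
  have "(w + 1/2) * (2 * z + 1) = (w * (4 * z + 2)) / 2 + z + 1/2" by (simp add: algebra_simps)
  hence "(w + 1/2) * (2 * z + 1) = z" using 1 by simp
  thus "z / (2 * z + 1) = w + 1/2" using nz(1) by (metis nonzero_divide_eq_eq)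
qed

text \<open>The constants -16 and 1/16 are the values at the cusp 1/2, so both functions are finite
  and nonzero there. The eta factors at multiples of w + 1/2 are reduced to w, 2 w and 4 w, inverted
  to 4 z + 2, 2 z + 1 and z + 1/2, and translated back; the half translation is used once at w and
  once at z.\<close>

lemma
  assumes z: "Im z > 0"
  defines "q \<equiv> qpar z"
  shows hauptmodul4_U: "hauptmodul4 (z / (2 * z + 1)) =
      - 16 * (euler_prod q ^ 16 * euler_prod (q ^ 4) ^ 8 / euler_prod (q ^ 2) ^ 24)"
    and weight2_form_U: "weight2_form (z / (2 * z + 1)) / (2 * z + 1) ^ 2 =
      (1 / 16) * (euler_prod (q ^ 2) ^ 20 / (euler_prod q ^ 8 * euler_prod (q ^ 4) ^ 8))"
proof -
  obtain w where w: "Im w > 0" "z / (2 * z + 1) = w + 1/2" "w * (4 * z + 2) = -1"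
    "2 * w * (2 * z + 1) = -1" "4 * w * (z + 1/2) = -1"
    using half_translate_cusp[OF z] by metis
  \<comment> \<open>Writing every root of unity as a power of one twelfth root, and the inversion
    factors through v, v / 2 and v / 4 with v = 4 z + 2, leaves identities between
    monomials.\<close>
  define \<zeta> where "\<zeta> = exp (of_real pi * \<i> / 6)"
  define v where "v = 4 * z + 2"
  have \<zeta>: "\<zeta> \<noteq> 0" "\<zeta> ^ 6 = -1" "exp (of_real pi * \<i> / 3) = \<zeta> ^ 2"
    by (simp_all add: \<zeta>_def mult.commute flip: exp_of_nat_mult)
  have v0: "v \<noteq> 0" using w(3) by (auto simp: v_def)
  define a b c where "a = eta4 z" and "b = eta4 (2 * z)" and "c = eta4 (4 * z)"
  have abc0: "a \<noteq> 0" "b \<noteq> 0" "c \<noteq> 0" using z by (simp_all add: a_def b_def c_def eta4_nonzero)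
  have t1: "eta4 (4 * z + 2) = \<zeta> ^ 4 * c"
    using eta4_translate[of "4 * z" 2] by (simp add: c_def \<zeta>(3) flip: power_mult)
  have t2: "eta4 (2 * z + 1) = \<zeta> ^ 2 * b"
    using eta4_translate[of "2 * z" 1] by (simp add: b_def \<zeta>(3))
  have t3: "eta4 (z + 1/2) = \<zeta> * b ^ 3 / (a * c)"
    using eta4_half_translate[OF z] abc0 unfolding a_def[symmetric] b_def[symmetric] c_def[symmetric] \<zeta>_def[symmetric]
    by (simp add: nonzero_eq_divide_eq)
  have e1: "eta4 w = - (v ^ 2) * (\<zeta> ^ 4 * c)"
    unfolding t1[symmetric] v_def by (rule eta4_inversion') (use z w in auto)
  have e2: "eta4 (2 * w) = - ((v / 2) ^ 2) * (\<zeta> ^ 2 * b)"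
  proof -
    have vh: "v / 2 = 2 * z + 1" by (simp add: v_def)
    show ?thesis unfolding vh t2[symmetric] using eta4_inversion'[of "2 * z + 1" "2 * w"] z w by simp
  qed
  have e4: "eta4 (4 * w) = - ((v / 4) ^ 2) * (\<zeta> * b ^ 3 / (a * c))"
  proof -
    have vh: "v / 4 = z + 1/2" by (simp add: v_def)
    show ?thesis unfolding vh t3[symmetric] using eta4_inversion'[of "z + 1/2" "4 * w"] z w by simp
  qed
  have w0: "eta4 w \<noteq> 0" "eta4 (4 * w) \<noteq> 0" using w(1) by (simp_all add: eta4_nonzero)
  have "eta4 (w + 1/2) = \<zeta> * eta4 (2 * w) ^ 3 / (eta4 w * eta4 (4 * w))"
    using eta4_half_translate[OF w(1)] w0 by (simp add: nonzero_eq_divide_eq \<zeta>_def)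
  moreover have "eta4 (4 * (w + 1/2)) = \<zeta> ^ 4 * eta4 (4 * w)"
    using eta4_translate[of "4 * w" 2] by (simp add: distrib_left \<zeta>(3) flip: power_mult)
  moreover have "Im (w + 1/2) > 0" using w by simp
  moreover have "eta4 (2 * (w + 1/2)) = \<zeta> ^ 2 * eta4 (2 * w)"
    using eta4_translate[of "2 * w" 1] by (simp add: distrib_left \<zeta>(3))
  ultimately have P: "weight2_form (z / (2 * z + 1)) = (\<zeta> ^ 4 * eta4 (4 * w)) ^ 2 / (\<zeta> ^ 2 * eta4 (2 * w))"
    and H: "hauptmodul4 (z / (2 * z + 1)) =
      (\<zeta> * eta4 (2 * w) ^ 3 / (eta4 w * eta4 (4 * w))) ^ 2 / (\<zeta> ^ 4 * eta4 (4 * w)) ^ 2"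
    unfolding w(2) by (simp_all only: hauptmodul4_def weight2_form_def if_True)
  note H
  also have "\<dots> = eta4 (2 * w) ^ 6 / (\<zeta> ^ 6 * eta4 w ^ 2 * eta4 (4 * w) ^ 4)"
    using \<zeta>(1) by (simp add: power_mult_distrib power_divide power_numeral_reduce)
  also have "\<dots> = - ((((v / 2) ^ 2) * (\<zeta> ^ 2 * b)) ^ 6 / ((v ^ 2 * (\<zeta> ^ 4 * c)) ^ 2 * ((v / 4) ^ 2 * (\<zeta> * b ^ 3 / (a * c))) ^ 4))"
    unfolding e1 e2 e4 \<zeta>(2) by simp
  also have "\<dots> = - 16 * (a ^ 4 * c ^ 2 / b ^ 6)"
    using v0 \<zeta>(1) abc0 by (simp add: power_mult_distrib power_divide divide_simps flip: power_mult power_add)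
      (simp add: power_numeral_reduce)
  also have "a ^ 4 * c ^ 2 / b ^ 6 = euler_prod q ^ 16 * euler_prod (q ^ 4) ^ 8 / euler_prod (q ^ 2) ^ 24"
  proof -
    define x where "x = exp (of_real pi * \<i> * z / 3)"
    have x: "x \<noteq> 0" by (simp add: x_def)
    show ?thesis
      unfolding a_def b_def c_def eta4_multiples eta4_def[of z] q_def x_def[symmetric]
      using x by (simp add: power_mult_distrib flip: power_mult) (simp add: power_numeral_reduce)
  qed
  finally show "hauptmodul4 (z / (2 * z + 1)) =
      - 16 * (euler_prod q ^ 16 * euler_prod (q ^ 4) ^ 8 / euler_prod (q ^ 2) ^ 24)" .
  have "weight2_form (z / (2 * z + 1)) = \<zeta> ^ 6 * (eta4 (4 * w) ^ 2 / eta4 (2 * w))"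
    unfolding P using \<zeta>(1) by (simp add: power_mult_distrib power_numeral_reduce)
  also have "\<dots> = ((v / 4) ^ 2 * (\<zeta> * b ^ 3 / (a * c))) ^ 2 / ((v / 2) ^ 2 * (\<zeta> ^ 2 * b))"
    unfolding e2 e4 \<zeta>(2) by simp
  also have "\<dots> = (v / 2) ^ 2 * ((1 / 16) * (b ^ 5 / (a ^ 2 * c ^ 2)))"
    using v0 \<zeta>(1) abc0 by (simp add: power_mult_distrib power_divide divide_simps flip: power_mult power_add)
      (simp add: power_numeral_reduce)
  also have "b ^ 5 / (a ^ 2 * c ^ 2) = euler_prod (q ^ 2) ^ 20 / (euler_prod q ^ 8 * euler_prod (q ^ 4) ^ 8)"
  proof -
    define x where "x = exp (of_real pi * \<i> * z / 3)"
    have x: "x \<noteq> 0" by (simp add: x_def)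
    show ?thesis
      unfolding a_def b_def c_def eta4_multiples eta4_def[of z] q_def x_def[symmetric]
      using x by (simp add: power_mult_distrib flip: power_mult) (simp add: power_numeral_reduce)
  qed
  also have "v / 2 = 2 * z + 1" by (simp add: v_def)
  finally show "weight2_form (z / (2 * z + 1)) / (2 * z + 1) ^ 2 =
      (1 / 16) * (euler_prod (q ^ 2) ^ 20 / (euler_prod q ^ 8 * euler_prod (q ^ 4) ^ 8))"
    using w(4) by auto
qed

section \<open>The slash action and generators of the congruence subgroup\<close>

no_notation fps_nth (infixl "$" 75)

definition mat2 :: "int \<Rightarrow> int \<Rightarrow> int \<Rightarrow> int \<Rightarrow> int ^ 2 ^ 2" where
  "mat2 a b c d = vector [vector [a, b], vector [c, d]]"

lemma mat2_nth [simp]: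
  "mat2 a b c d $ 1 $ 1 = a" "mat2 a b c d $ 1 $ 2 = b"
  "mat2 a b c d $ 2 $ 1 = c" "mat2 a b c d $ 2 $ 2 = d"
  by (simp_all add: mat2_def)

lemma mat2_eqI:
  fixes A B :: "int ^ 2 ^ 2"
  assumes "A $ 1 $ 1 = B $ 1 $ 1" "A $ 1 $ 2 = B $ 1 $ 2" "A $ 2 $ 1 = B $ 2 $ 1" "A $ 2 $ 2 = B $ 2 $ 2"
  shows "A = B"
  using assms by (simp add: vec_eq_iff forall_2)

lemma mat2_mult_nth [simp]:
  fixes A B :: "int ^ 2 ^ 2"
  shows "(A ** B) $ i $ j = A $ i $ 1 * B $ 1 $ j + A $ i $ 2 * B $ 2 $ j"
  by (simp add: matrix_matrix_mult_def sum_2)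

lemma SL2Z_iff: "A \<in> SL2Z \<longleftrightarrow> A $ 1 $ 1 * A $ 2 $ 2 - A $ 1 $ 2 * A $ 2 $ 1 = 1"
  by (simp add: SL2Z_def det_2)

lemma Gamma0_4_iff: "A \<in> Gamma0_4 \<longleftrightarrow> A \<in> SL2Z \<and> 4 dvd A $ 2 $ 1"
  by (simp add: Gamma0_4_def)

lemma SL2Z_mult [intro]: "A \<in> SL2Z \<Longrightarrow> B \<in> SL2Z \<Longrightarrow> A ** B \<in> SL2Z"
  by (simp add: SL2Z_def det_mul)

definition inv2 :: "int ^ 2 ^ 2 \<Rightarrow> int ^ 2 ^ 2" where
  "inv2 A = mat2 (A $ 2 $ 2) (- A $ 1 $ 2) (- A $ 2 $ 1) (A $ 1 $ 1)"

lemma inv2_SL2Z [intro]: "A \<in> SL2Z \<Longrightarrow> inv2 A \<in> SL2Z"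
  by (simp add: SL2Z_iff inv2_def mult.commute)

lemma inv2_mult:
  assumes "A \<in> SL2Z"
  shows "A ** inv2 A = mat2 1 0 0 1" "inv2 A ** A = mat2 1 0 0 1"
  using assms by (auto intro!: mat2_eqI simp: inv2_def SL2Z_iff algebra_simps)

lemma mat2_id_mult:
  fixes A :: "int ^ 2 ^ 2"
  shows "A ** mat2 1 0 0 1 = A" "mat2 1 0 0 1 ** A = A"
  by (auto intro!: mat2_eqI)

lemma factor_right:
  fixes A B :: "int ^ 2 ^ 2"
  assumes "B \<in> SL2Z"
  shows "A = (A ** inv2 B) ** B"
  by (simp only: matrix_mul_assoc[symmetric] inv2_mult[OF assms] mat2_id_mult)

text \<open>The factor of automorphy c z + d; its cocycle property makes the slash operator an
  action.\<close>

definition cocycle2 :: "int ^ 2 ^ 2 \<Rightarrow> complex \<Rightarrow> complex" where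
  "cocycle2 A z = of_int (A $ 2 $ 1) * z + of_int (A $ 2 $ 2)"

lemma cocycle2_nonzero:
  assumes "A \<in> SL2Z" "Im z > 0"
  shows "cocycle2 A z \<noteq> 0"
proof
  assume *: "cocycle2 A z = 0"
  hence "Im (cocycle2 A z) = 0" by simp
  hence "A $ 2 $ 1 = 0" using assms(2) by (simp add: cocycle2_def)
  moreover from this have "A $ 2 $ 2 = 0" using * by (simp add: cocycle2_def)
  ultimately show False using assms(1) by (simp add: SL2Z_iff)
qed

lemma moebius_act_cocycle2:
  "moebius_act A z = (of_int (A $ 1 $ 1) * z + of_int (A $ 1 $ 2)) / cocycle2 A z"
  by (simp add: moebius_act_def cocycle2_def)

lemma slash_cocycle2: "slash k A F z = cocycle2 A z powi (- k) * F (moebius_act A z)"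
  by (simp add: slash_def cocycle2_def)

lemma Im_moebius_act:
  assumes "A \<in> SL2Z" "Im z > 0"
  shows "Im (moebius_act A z) = Im z / norm (cocycle2 A z) ^ 2"
proof -
  define a b c d where "a = real_of_int (A $ 1 $ 1)" "b = real_of_int (A $ 1 $ 2)"
    "c = real_of_int (A $ 2 $ 1)" "d = real_of_int (A $ 2 $ 2)"
  have "of_int (A $ 1 $ 1 * A $ 2 $ 2 - A $ 1 $ 2 * A $ 2 $ 1) = (1 :: real)"
    using assms(1) by (simp only: SL2Z_iff of_int_1)
  hence det: "a * d - b * c = 1" by (simp add: a_b_c_d_def)
  have "(of_int (A $ 1 $ 1) * z + of_int (A $ 1 $ 2)) = Complex (a * Re z + b) (a * Im z)"
    "cocycle2 A z = Complex (c * Re z + d) (c * Im z)"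
    by (simp_all add: complex_eq_iff a_b_c_d_def cocycle2_def)
  hence "Im (moebius_act A z) = (a * Im z * (c * Re z + d) - (a * Re z + b) * (c * Im z)) / norm (cocycle2 A z) ^ 2"
    by (simp add: moebius_act_cocycle2 Im_divide cmod_power2)
  also have "a * Im z * (c * Re z + d) - (a * Re z + b) * (c * Im z) = (a * d - b * c) * Im z"
    by (simp add: algebra_simps)
  finally show ?thesis by (simp add: det)
qed

lemma Im_moebius_act_pos:
  assumes "A \<in> SL2Z" "Im z > 0"
  shows "Im (moebius_act A z) > 0"
  using assms cocycle2_nonzero[OF assms] by (simp add: Im_moebius_act)

lemma cocycle2_mult:
  assumes "B \<in> SL2Z" "Im z > 0"
  shows "cocycle2 (A ** B) z = cocycle2 A (moebius_act B z) * cocycle2 B z"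
  using cocycle2_nonzero[OF assms]
  by (simp add: moebius_act_cocycle2 cocycle2_def[of A] distrib_right) (simp add: cocycle2_def algebra_simps)

lemma moebius_act_mult:
  assumes "A \<in> SL2Z" "B \<in> SL2Z" "Im z > 0"
  shows "moebius_act (A ** B) z = moebius_act A (moebius_act B z)"
proof -
  define w where "w = moebius_act B z"
  define x where "x = of_int (B $ 1 $ 1) * z + of_int (B $ 1 $ 2)"
  have nz: "cocycle2 B z \<noteq> 0" "cocycle2 A w \<noteq> 0"
    using cocycle2_nonzero Im_moebius_act_pos assms by (auto simp: w_def)
  have w: "w * cocycle2 B z = x" using nz by (simp add: w_def moebius_act_cocycle2 x_def)
  have "moebius_act (A ** B) z = (of_int (A $ 1 $ 1) * x + of_int (A $ 1 $ 2) * cocycle2 B z) / (cocycle2 A w * cocycle2 B z)"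
    unfolding moebius_act_cocycle2[of "A ** B"] cocycle2_mult[OF assms(2,3)] w_def
    by (simp add: x_def cocycle2_def algebra_simps)
  also have "\<dots> = ((of_int (A $ 1 $ 1) * w + of_int (A $ 1 $ 2)) * cocycle2 B z) / (cocycle2 A w * cocycle2 B z)"
    unfolding w[symmetric] by (simp add: algebra_simps)
  also have "\<dots> = moebius_act A w" using nz by (simp add: moebius_act_cocycle2[of A])
  finally show ?thesis by (simp add: w_def)
qed

lemma slash_mult:
  assumes "A \<in> SL2Z" "B \<in> SL2Z" "Im z > 0"
  shows "slash k (A ** B) F z = slash k B (slash k A F) z"
  unfolding slash_cocycle2 cocycle2_mult[OF assms(2,3)] moebius_act_mult[OF assms] power_int_mult_distrib
  by simp

lemma slash_cong:
  assumes "A \<in> SL2Z" "Im z > 0" "\<And>z. Im z > 0 \<Longrightarrow> F z = G z"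
  shows "slash k A F z = slash k A G z"
  using assms Im_moebius_act_pos[OF assms(1,2)] by (simp add: slash_def)

lemma slash_id [simp]: "slash k (mat2 1 0 0 1) F z = F z"
  by (simp add: slash_def moebius_act_def)

text \<open>Closed under products and inverses, this set contains the whole congruence subgroup once
  it contains generators.\<close>

definition slash_stabilizer :: "int \<Rightarrow> (complex \<Rightarrow> complex) \<Rightarrow> (int ^ 2 ^ 2) set" where
  "slash_stabilizer k F = {A \<in> SL2Z. \<forall>z. Im z > 0 \<longrightarrow> slash k A F z = F z}"

lemma slash_stabilizer_mult:
  assumes "A \<in> slash_stabilizer k F" "B \<in> slash_stabilizer k F"
  shows "A ** B \<in> slash_stabilizer k F"
  using assms slash_cong[of B _ "slash k A F" F k]
  by (auto simp: slash_stabilizer_def slash_mult)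

lemma slash_stabilizer_inverse:
  assumes "A \<in> slash_stabilizer k F"
  shows "inv2 A \<in> slash_stabilizer k F"
proof -
  have A: "A \<in> SL2Z" "\<And>z. Im z > 0 \<Longrightarrow> slash k A F z = F z"
    using assms by (auto simp: slash_stabilizer_def)
  have "slash k (inv2 A) F z = F z" if z: "Im z > 0" for z
  proof -
    have "slash k (inv2 A) F z = slash k (inv2 A) (slash k A F) z"
      using slash_cong[of "inv2 A" z F "slash k A F"] A z inv2_SL2Z[OF A(1)] by simp
    also have "\<dots> = slash k (A ** inv2 A) F z"
      using A z by (subst slash_mult) auto
    finally show ?thesis using inv2_mult[OF A(1)] by simp
  qed
  thus ?thesis using inv2_SL2Z[OF A(1)] by (auto simp: slash_stabilizer_def)
qed

text \<open>Peels off a left factor: the descent multiplies a matrix by known stabilizers and then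
  has to return to the original matrix.\<close>

lemma slash_stabilizer_factor:
  assumes "A \<in> slash_stabilizer k F" "B \<in> SL2Z" "A ** B \<in> slash_stabilizer k F"
  shows "B \<in> slash_stabilizer k F"
proof -
  have "inv2 A ** (A ** B) \<in> slash_stabilizer k F"
    by (intro slash_stabilizer_mult slash_stabilizer_inverse assms)
  moreover have "A \<in> SL2Z" using assms by (simp add: slash_stabilizer_def)
  ultimately show ?thesis
    by (simp only: matrix_mul_assoc inv2_mult mat2_id_mult)
qed

text \<open>Induction in both directions from n = 0 along the integer powers of one matrix, given as
  an explicit family; it serves the upper and the lower unipotent subgroup.\<close>

lemma slash_stabilizer_power:
  assumes "mat2 1 0 0 1 \<in> slash_stabilizer k F" "M 0 = mat2 1 0 0 1" "M 1 \<in> slash_stabilizer k F"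
    and "\<And>n :: int. M n = M 1 ** M (n - 1)" "\<And>n. M n \<in> SL2Z"
  shows "M n \<in> slash_stabilizer k F"
proof (induction n rule: int_induct[where k = 0])
  case (step1 n)
  show ?case using assms(4)[of "n + 1"] slash_stabilizer_mult[OF assms(3) step1(2)] by simp
next
  case (step2 n)
  have "M 1 ** M (n - 1) \<in> slash_stabilizer k F" using assms(4)[of n] step2(2) by simp
  thus ?case using slash_stabilizer_factor[OF assms(3,5)] by blast
qed (use assms(1,2) in simp)

lemma symmetric_remainder:
  fixes a c :: int
  assumes "c \<noteq> 0"
  obtains n where "2 * \<bar>a + n * c\<bar> \<le> \<bar>c\<bar>"
proof -
  have "\<exists>n. 2 * \<bar>a + n * c\<bar> \<le> \<bar>c\<bar>"
  proof (cases "2 * (a mod \<bar>c\<bar>) \<le> \<bar>c\<bar>")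
    case True
    have "a + (- (sgn c * (a div \<bar>c\<bar>))) * c = a mod \<bar>c\<bar>"
      by (simp add: minus_div_mult_eq_mod[symmetric] abs_sgn algebra_simps)
    thus ?thesis using True assms by (intro exI[of _ "- (sgn c * (a div \<bar>c\<bar>))"]) simp
  next
    case False
    have "a + (- (sgn c * (a div \<bar>c\<bar> + 1))) * c = a mod \<bar>c\<bar> - \<bar>c\<bar>"
      by (simp add: minus_div_mult_eq_mod[symmetric] abs_sgn algebra_simps)
    moreover have "a mod \<bar>c\<bar> < \<bar>c\<bar>" using assms by simp
    ultimately show ?thesis using False by (intro exI[of _ "- (sgn c * (a div \<bar>c\<bar> + 1))"]) simp
  qed
  thus ?thesis using that by blast
qed

text \<open>Descent on the absolute value of the lower left entry: translations make the upper left
  entry smaller than half of it (strictly, since that entry is odd and the lower left entry is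
  divisible by 4), and then the lower unipotent generator makes the lower left entry smaller.\<close>

lemma slash_stabilizer_Gamma0_4:
  assumes k: "even k"
    and T: "\<And>z. Im z > 0 \<Longrightarrow> F (z + 1) = F z"
    and V: "\<And>z. Im z > 0 \<Longrightarrow> F (z / (4 * z + 1)) = (4 * z + 1) powi k * F z"
    and A: "A \<in> Gamma0_4"
  shows "A \<in> slash_stabilizer k F"
proof -
  have id: "mat2 1 0 0 1 \<in> slash_stabilizer k F"
    by (simp add: slash_stabilizer_def SL2Z_iff)
  \<comment> \<open>The matrix -1 acts by (-1)^(-k), which is where the parity of the weight
    enters.\<close>
  have "slash k (mat2 (-1) 0 0 (-1)) F z = F z" for z
    using k by (simp add: slash_def moebius_act_def)
  hence neg: "mat2 (-1) 0 0 (-1) \<in> slash_stabilizer k F"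
    by (simp add: slash_stabilizer_def SL2Z_iff)
  have T1: "mat2 1 1 0 1 \<in> slash_stabilizer k F"
    using T by (simp add: slash_stabilizer_def SL2Z_iff slash_def moebius_act_def)
  have Tn: "mat2 1 n 0 1 \<in> slash_stabilizer k F" for n
    by (rule slash_stabilizer_power[where M = "\<lambda>n. mat2 1 n 0 1"])
       (use id T1 in \<open>auto intro!: mat2_eqI simp: SL2Z_iff\<close>)
  have V1: "mat2 1 0 4 1 \<in> slash_stabilizer k F"
  proof -
    have "(4 * z + 1) powi (- k) * F (z / (4 * z + 1)) = F z" if "Im z > 0" for z
    proof -
      have "4 * z + 1 \<noteq> 0" using that by (auto simp: complex_eq_iff)
      thus ?thesis using V[OF that] by (simp add: power_int_minus field_simps)
    qed
    thus ?thesis by (simp add: slash_stabilizer_def SL2Z_iff slash_def moebius_act_def)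
  qed
  have Vn: "mat2 1 0 (4 * n) 1 \<in> slash_stabilizer k F" for n
    by (rule slash_stabilizer_power[where M = "\<lambda>n. mat2 1 0 (4 * n) 1"])
       (use id V1 in \<open>auto intro!: mat2_eqI simp: SL2Z_iff\<close>)
  show ?thesis using A
  proof (induction "nat \<bar>A $ 2 $ 1\<bar>" arbitrary: A rule: less_induct)
    case less
    define a b c d where "a = A $ 1 $ 1" "b = A $ 1 $ 2" "c = A $ 2 $ 1" "d = A $ 2 $ 2"
    note abcd = a_b_c_d_def
    have SL: "A \<in> SL2Z" and c4: "4 dvd c" using less.prems by (auto simp: Gamma0_4_iff abcd)
    have det: "a * d - b * c = 1" using SL by (simp add: SL2Z_iff abcd)
    show ?case
    proof (cases "c = 0")
      case True
      hence "a * d = 1" using det by simp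
      hence "(a = 1 \<and> d = 1) \<or> (a = -1 \<and> d = -1)" by (simp add: zmult_eq_1_iff)
      thus ?thesis
      proof
        assume "a = 1 \<and> d = 1"
        hence "A = mat2 1 b 0 1" using True by (intro mat2_eqI) (auto simp: abcd)
        thus ?thesis using Tn by simp
      next
        assume "a = -1 \<and> d = -1"
        hence "A = mat2 (-1) 0 0 (-1) ** mat2 1 (- b) 0 1" using True by (intro mat2_eqI) (auto simp: abcd)
        thus ?thesis using slash_stabilizer_mult[OF neg Tn] by simp
      qed
    next
      case False
      obtain n where n: "2 * \<bar>a + n * c\<bar> \<le> \<bar>c\<bar>" using symmetric_remainder[OF False] by blast
      define a' where "a' = a + n * c"
      obtain c' where c': "c = 4 * c'" using c4 by auto
      have "a * d = 1 + 2 * (2 * (b * c'))" using det c' by simp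
      hence "odd (a * d)" by simp
      hence "odd a" by simp
      hence odd: "odd a'" by (simp add: a'_def c')
      have "2 * \<bar>a'\<bar> \<noteq> \<bar>c\<bar>"
      proof
        assume "2 * \<bar>a'\<bar> = \<bar>c\<bar>"
        hence "\<bar>a'\<bar> = 2 * \<bar>c'\<bar>" by (simp add: c' abs_mult)
        hence "even \<bar>a'\<bar>" by simp
        thus False using odd by simp
      qed
      hence a': "2 * \<bar>a'\<bar> < \<bar>c\<bar>" using n by (simp add: a'_def)
      have "4 * a' \<noteq> 0" using odd by auto
      then obtain m where m: "2 * \<bar>c + m * (4 * a')\<bar> \<le> \<bar>4 * a'\<bar>" using symmetric_remainder by blast
      define B where "B = mat2 1 0 (4 * m) 1 ** (mat2 1 n 0 1 ** A)"
      have B21: "B $ 2 $ 1 = c + m * (4 * a')" by (simp add: B_def a'_def abcd algebra_simps)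
      \<comment> \<open>The new entry has modulus at most 2 |a'|, which is strictly below
        |c|.\<close>
      have "nat \<bar>B $ 2 $ 1\<bar> < nat \<bar>A $ 2 $ 1\<bar>"
      proof -
        have "2 * \<bar>c + m * (4 * a')\<bar> \<le> 4 * \<bar>a'\<bar>" using m by (simp add: abs_mult)
        hence "\<bar>c + m * (4 * a')\<bar> < \<bar>c\<bar>" using a' by presburger
        thus ?thesis unfolding B21 abcd(3)[symmetric] using False by (simp add: nat_mono_iff)
      qed
      moreover have "B \<in> Gamma0_4"
      proof -
        have "mat2 1 0 (4 * m) 1 \<in> SL2Z" "mat2 1 n 0 1 \<in> SL2Z" by (simp_all add: SL2Z_iff)
        hence "B \<in> SL2Z" unfolding B_def using SL by (intro SL2Z_mult)
        thus ?thesis unfolding Gamma0_4_iff B21 c' by simp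
      qed
      ultimately have "B \<in> slash_stabilizer k F" by (rule less.hyps)
      hence "mat2 1 n 0 1 ** A \<in> slash_stabilizer k F"
        unfolding B_def by (rule slash_stabilizer_factor[OF Vn, rotated]) (use SL in \<open>auto simp: SL2Z_iff[of "mat2 _ _ _ _"]\<close>)
      thus ?thesis by (rule slash_stabilizer_factor[OF Tn SL])
    qed
  qed
qed

text \<open>The lower left entry modulo 4 decides between the cusps infinity, 0 and 1/2 of the
  congruence subgroup, which are the three cases.\<close>

lemma SL2Z_coset_cases:
  assumes A: "A \<in> SL2Z"
  obtains (infinity) "A \<in> Gamma0_4"
  | (zero) \<gamma> j where "\<gamma> \<in> Gamma0_4" "A = \<gamma> ** (mat2 0 (-1) 1 0 ** mat2 1 j 0 1)" "odd (A $ 2 $ 1)"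
  | (half) \<gamma> where "\<gamma> \<in> Gamma0_4" "A = \<gamma> ** mat2 1 0 2 1" "even (A $ 2 $ 1)" "\<not> 4 dvd A $ 2 $ 1"
proof -
  define a b c d where "a = A $ 1 $ 1" "b = A $ 1 $ 2" "c = A $ 2 $ 1" "d = A $ 2 $ 2"
  note abcd = a_b_c_d_def
  have det: "a * d - b * c = 1" using A by (simp add: SL2Z_iff abcd)
  consider "4 dvd c" | "odd c" | "even c" "\<not> 4 dvd c" by blast
  thus ?thesis
  proof cases
    case 1
    thus ?thesis using A infinity by (auto simp: Gamma0_4_iff abcd)
  next
    case 2
    \<comment> \<open>For B built with j, the lower left entry of A B^(-1) is c j - d; as c is odd,
      c^2 is 1 modulo 4, and j = c d makes the entry divisible by 4.\<close>
    define B where "B = mat2 0 (-1) 1 0 ** mat2 1 (c * d) 0 1"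
    have B: "B \<in> SL2Z" by (simp add: B_def SL2Z_iff)
    obtain e where e: "c = 2 * e + 1" using 2 by (elim oddE)
    have "(A ** inv2 B) $ 2 $ 1 = 4 * (d * (e * e + e))"
      by (simp add: B_def inv2_def abcd(3,4)[symmetric] e algebra_simps)
    hence "A ** inv2 B \<in> Gamma0_4" using A B by (auto simp: Gamma0_4_iff)
    thus ?thesis using factor_right[OF B, of A] 2
      by (intro zero[of "A ** inv2 B" "c * d", folded B_def]) (simp_all only: abcd not_False_eq_True simp_thms)
  next
    case 3
    define B where "B = mat2 1 0 2 1"
    have B: "B \<in> SL2Z" by (simp add: B_def SL2Z_iff)
    have "odd (a * d - b * c)" using det by simp
    hence "odd d" using 3 by simp
    \<comment> \<open>Both c and 2 d are 2 modulo 4.\<close>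
    moreover have "(A ** inv2 B) $ 2 $ 1 = c - 2 * d"
      by (simp add: B_def inv2_def abcd(3,4)[symmetric])
    ultimately have "4 dvd (A ** inv2 B) $ 2 $ 1" using 3 by presburger
    hence "A ** inv2 B \<in> Gamma0_4" using A B by (auto simp: Gamma0_4_iff)
    thus ?thesis using factor_right[OF B, of A] 3
      by (intro half[of "A ** inv2 B", folded B_def]) (simp_all only: abcd not_False_eq_True simp_thms)
  qed
qed

lemma rep_SL2Z: "mat2 0 (-1) 1 0 \<in> SL2Z" "mat2 1 0 2 1 \<in> SL2Z"
  by (simp_all add: SL2Z_iff)

lemma slash_coset:
  assumes "Gamma0_4 \<subseteq> slash_stabilizer k F" "\<gamma> \<in> Gamma0_4" "A \<in> SL2Z" "Im z > 0"
  shows "slash k (\<gamma> ** A) F z = slash k A F z"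
proof -
  have "\<gamma> \<in> SL2Z" "\<And>z. Im z > 0 \<Longrightarrow> slash k \<gamma> F z = F z"
    using assms by (auto simp: slash_stabilizer_def)
  thus ?thesis
    using slash_mult[of \<gamma> A z k F] slash_cong[OF assms(3,4), of "slash k \<gamma> F" F k] assms(3,4) by simp
qed

lemma slash_coset_translate:
  assumes "Gamma0_4 \<subseteq> slash_stabilizer k F" "\<gamma> \<in> Gamma0_4" "A \<in> SL2Z" "Im z > 0"
  shows "slash k (\<gamma> ** (A ** mat2 1 j 0 1)) F z = slash k A F (z + of_int j)"
proof -
  have T: "mat2 1 j 0 1 \<in> SL2Z" by (simp add: SL2Z_iff)
  show ?thesis
    unfolding slash_coset[OF assms(1,2) SL2Z_mult[OF assms(3) T] assms(4)] slash_mult[OF assms(3) T assms(4)]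
      slash_def[of k "mat2 1 j 0 1"]
    by (simp add: moebius_act_def[of "mat2 1 j 0 1"])
qed

text \<open>A pair (c, d) with |c z + d| minimal maximizes the height of the image. After a
  translation to real part at most 1/2 in modulus, minimality against the inversion gives modulus at
  least 1, hence height at least 1/2.\<close>

lemma SL2Z_reduction:
  assumes z: "Im z > 0"
  obtains A where "A \<in> SL2Z" "Im (moebius_act A z) \<ge> 1/2"
proof -
  \<comment> \<open>Restricting to |c z + d| \<le> 1 makes the set of pairs finite; the identity
    matrix keeps it nonempty.\<close>
  define P where "P = (\<lambda>A. (A $ 2 $ 1, A $ 2 $ 2)) ` {A \<in> SL2Z. norm (cocycle2 A z) \<le> 1}"
  define K where "K = nat \<lceil>(Im z + norm z + 1) / Im z\<rceil>"
  have "P \<subseteq> {- int K..int K} \<times> {- int K..int K}"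
  proof (clarsimp simp: P_def, goal_cases)
    case (1 A)
    have n: "norm (of_real (real_of_int (A $ 2 $ 1)) * z + of_real (real_of_int (A $ 2 $ 2))) \<le> 1"
      using 1 by (simp add: cocycle2_def)
    have "(Im z + norm z + 1) / Im z \<le> real K" unfolding K_def by linarith
    hence K: "Im z + norm z + 1 \<le> Im z * real K" using z by (simp add: field_simps)
    have "Im z * \<bar>real_of_int (A $ 2 $ 1)\<bar> \<le> Im z * real K"
      using lattice_norm_bounds(1)[OF z, of "real_of_int (A $ 2 $ 1)" "real_of_int (A $ 2 $ 2)"] n K z norm_ge_zero[of z]
      by linarith
    hence 2: "\<bar>real_of_int (A $ 2 $ 1)\<bar> \<le> real K" using z by simp
    have "(Im z + norm z) * norm (of_real (real_of_int (A $ 2 $ 1)) * z + of_real (real_of_int (A $ 2 $ 2))) \<le> (Im z + norm z) * 1"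
      using n z by (intro mult_left_mono) auto
    from order_trans[OF lattice_norm_bounds(2)[OF z] this]
    have "Im z * \<bar>real_of_int (A $ 2 $ 2)\<bar> \<le> Im z + norm z" by simp
    also have "\<dots> \<le> Im z * real K" using K by simp
    finally have "Im z * \<bar>real_of_int (A $ 2 $ 2)\<bar> \<le> Im z * real K" .
    hence 3: "\<bar>real_of_int (A $ 2 $ 2)\<bar> \<le> real K" using z by simp
    show ?case using 2 3 by linarith
  qed
  hence "finite P" by (rule finite_subset) auto
  moreover have "(0, 1) \<in> P"
    unfolding P_def by (rule image_eqI[of _ _ "mat2 1 0 0 1"]) (auto simp: SL2Z_iff cocycle2_def)
  ultimately obtain p where p: "p \<in> P"
    "\<And>p'. p' \<in> P \<Longrightarrow> norm (of_int (fst p) * z + of_int (snd p)) \<le> norm (of_int (fst p') * z + of_int (snd p'))"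
    using arg_min_if_finite[of P "\<lambda>p. norm (of_int (fst p) * z + of_int (snd p))"]
    by (metis (no_types, lifting) empty_iff linorder_not_le)
  then obtain A where A: "A \<in> SL2Z" "norm (cocycle2 A z) \<le> 1" "p = (A $ 2 $ 1, A $ 2 $ 2)"
    unfolding P_def by auto
  have min: "norm (cocycle2 A z) \<le> norm (cocycle2 B z)" if "B \<in> SL2Z" for B
  proof (cases "norm (cocycle2 B z) \<le> 1")
    case True
    hence "(B $ 2 $ 1, B $ 2 $ 2) \<in> P" using that by (auto simp: P_def)
    from p(2)[OF this] show ?thesis by (simp add: A cocycle2_def)
  qed (use A in linarith)
  define w where "w = moebius_act A z"
  define n where "n = - round (Re w)"
  define B where "B = mat2 1 n 0 1 ** A"
  define v where "v = moebius_act B z"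
  have T: "mat2 1 n 0 1 \<in> SL2Z" and S: "mat2 0 (-1) 1 0 \<in> SL2Z" by (simp_all add: SL2Z_iff)
  have B: "B \<in> SL2Z" using T A by (auto simp: B_def)
  have v: "v = w + of_int n"
    unfolding v_def B_def moebius_act_mult[OF T A(1) z] w_def[symmetric] by (simp add: moebius_act_def)
  have Re: "\<bar>Re v\<bar> \<le> 1/2"
    using of_int_round_abs_le[of "Re w"] by (simp add: v n_def abs_minus_commute)
  have vpos: "Im v > 0" unfolding v_def by (rule Im_moebius_act_pos[OF B z])
  have "cocycle2 B z = cocycle2 A z"
    unfolding B_def cocycle2_mult[OF A(1) z] by (simp add: cocycle2_def[of "mat2 _ _ _ _"])
  hence "norm (cocycle2 B z) \<le> norm (cocycle2 (mat2 0 (-1) 1 0 ** B) z)"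
    using min[of "mat2 0 (-1) 1 0 ** B"] S B by auto
  also have "\<dots> = norm v * norm (cocycle2 B z)"
    unfolding cocycle2_mult[OF B z] v_def[symmetric] by (simp add: norm_mult cocycle2_def[of "mat2 _ _ _ _"])
  finally have "norm v \<ge> 1" using cocycle2_nonzero[OF B z] by simp
  hence "1 \<le> norm v ^ 2" by (simp add: one_le_power)
  also have "\<dots> = Re v ^ 2 + Im v ^ 2" by (rule cmod_power2)
  finally have *: "1 \<le> Re v ^ 2 + Im v ^ 2" .
  have "Re v ^ 2 \<le> (1/2) ^ 2" using Re by (metis abs_ge_zero power2_abs power_mono)
  hence "Im v ^ 2 \<ge> (1/2) ^ 2" using * by (simp add: power2_eq_square)
  hence "Im v \<ge> 1/2" by (rule power2_le_imp_le) (use vpos in simp)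
  thus ?thesis using that[OF B] by (simp add: v_def)
qed

section \<open>Expansions at the cusps\<close>

lemma qpar_surj:
  assumes "h > 0" "w \<noteq> 0" "norm w < 1"
  obtains z where "Im z > 0" "qpar (z / of_nat h) = w"
proof
  define z where "z = of_nat h * (Ln w / (2 * of_real pi * \<i>))"
  have "2 * of_real pi * \<i> * (z / of_nat h) = Ln w"
    using assms by (simp add: z_def)
  thus "qpar (z / of_nat h) = w"
    using assms(2) by (simp add: qpar_def)
  have "ln (norm w) < 0" using assms by simp
  moreover have "Im z = - (real h * ln (norm w) / (2 * pi))"
    using assms by (simp add: z_def Im_divide power2_eq_square Re_Ln)
  moreover have "real h > 0" using assms by simp
  ultimately show "Im z > 0" by (simp add: mult_pos_neg divide_neg_pos)
qed

lemma norm_qpar_div_less_1: "Im z > 0 \<Longrightarrow> h > 0 \<Longrightarrow> norm (qpar (z / of_nat h)) < 1"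
  by (rule norm_qpar_less_1) simp

lemma holomorphic_has_sum_power_series:
  assumes "g holomorphic_on ball 0 r" "w \<in> ball 0 r"
  shows "((\<lambda>n. (deriv ^^ n) g 0 / fact n * w ^ n) has_sum g w) (UNIV :: nat set)"
proof (rule norm_summable_imp_has_sum)
  have *: "(\<lambda>n. (deriv ^^ n) g 0 / fact n * v ^ n) sums g v" if "v \<in> ball 0 r" for v
    using holomorphic_power_series[OF assms(1) that] by simp
  show "(\<lambda>n. (deriv ^^ n) g 0 / fact n * w ^ n) sums g w" by (rule *[OF assms(2)])
  obtain s where s: "norm w < s" "s < r" using assms(2) dense[of "norm w" r] by auto
  have "s \<ge> 0" using s norm_ge_zero[of w] by linarith
  hence "of_real s \<in> ball (0::complex) r" using s by simp
  from *[OF this] have "summable (\<lambda>n. (deriv ^^ n) g 0 / fact n * of_real s ^ n)" by (simp add: sums_iff)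
  thus "summable (\<lambda>n. norm ((deriv ^^ n) g 0 / fact n * w ^ n))"
    by (rule powser_insidea) (use s \<open>s \<ge> 0\<close> in simp)
qed

lemma powi_split:
  fixes w :: complex
  assumes "w \<noteq> 0" "N \<le> n"
  shows "w powi n = w powi N * w ^ nat (n - N)"
  using power_int_add[of w N "n - N"] assms by (simp add: power_int_def)

lemma has_sum_powi_shift:
  fixes w :: complex
  assumes "w \<noteq> 0"
  shows "((\<lambda>n::int. a n * w powi n) has_sum (w powi N * S)) {N..} \<longleftrightarrow>
         ((\<lambda>n::nat. a (N + int n) * w ^ n) has_sum S) UNIV"
proof -
  have "((\<lambda>n::int. a n * w powi n) has_sum (w powi N * S)) {N..} \<longleftrightarrow>
        ((\<lambda>n::nat. w powi N * (a (N + int n) * w ^ n)) has_sum (w powi N * S)) UNIV"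
    by (rule has_sum_reindex_bij_witness[where i = "\<lambda>n. N + int n" and j = "\<lambda>n. nat (n - N)"])
       (use assms in \<open>auto simp: power_int_add powi_split[OF assms, symmetric]\<close>)
  also have "\<dots> \<longleftrightarrow> ((\<lambda>n::nat. a (N + int n) * w ^ n) has_sum S) UNIV"
    using assms by (subst has_sum_cmult_right_iff) auto
  finally show ?thesis .
qed

text \<open>An expansion is encoded by the holomorphic function that its power series defines in
  q^(1/h), so that products, derivatives and negative powers avoid manipulations of coefficients. N
  counts powers of q^(1/h); h = 4 is the common parameter of \<open>cusp_order_ge\<close>.\<close>

definition qexp :: "nat \<Rightarrow> int \<Rightarrow> (complex \<Rightarrow> complex) \<Rightarrow> bool" where
  "qexp h N f \<longleftrightarrow> (\<exists>g. g holomorphic_on ball 0 1 \<and>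
     (\<forall>z. Im z > 0 \<longrightarrow> f z = qpar (z / of_nat h) powi N * g (qpar (z / of_nat h))))"

lemma qexpI:
  assumes "g holomorphic_on ball 0 1"
    and "\<And>z. Im z > 0 \<Longrightarrow> f z = qpar (z / of_nat h) powi N * g (qpar (z / of_nat h))"
  shows "qexp h N f"
  using assms by (auto simp: qexp_def)

lemma qexpE:
  assumes "qexp h N f"
  obtains g where "g holomorphic_on ball 0 1"
    "\<And>z. Im z > 0 \<Longrightarrow> f z = qpar (z / of_nat h) powi N * g (qpar (z / of_nat h))"
  using assms unfolding qexp_def by blast

text \<open>From right to left: every point of the punctured unit disc is a value of the parameter,
  so the coefficient series converges on the entire disc and defines the holomorphic
  function.\<close>

lemma qexp_iff_has_sum:
  assumes h: "h > 0"
  shows "qexp h N f \<longleftrightarrow> (\<exists>a :: int \<Rightarrow> complex. \<forall>z\<in>upper_half_plane.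
           ((\<lambda>n. a n * qpar (z / of_nat h) powi n) has_sum f z) {N..})"
proof
  assume "qexp h N f"
  then obtain g where g: "g holomorphic_on ball 0 1"
    "\<And>z. Im z > 0 \<Longrightarrow> f z = qpar (z / of_nat h) powi N * g (qpar (z / of_nat h))"
    by (auto simp: qexp_def)
  define a where "a = (\<lambda>n::int. (deriv ^^ nat (n - N)) g 0 / fact (nat (n - N)))"
  have "((\<lambda>n. a n * qpar (z / of_nat h) powi n) has_sum f z) {N..}" if z: "Im z > 0" for z
    unfolding g(2)[OF z] has_sum_powi_shift[OF qpar_nonzero] a_def
    using holomorphic_has_sum_power_series[OF g(1), of "qpar (z / of_nat h)"] norm_qpar_div_less_1[OF z h]
    by simp
  thus "\<exists>a :: int \<Rightarrow> complex. \<forall>z\<in>upper_half_plane.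
           ((\<lambda>n. a n * qpar (z / of_nat h) powi n) has_sum f z) {N..}"
    by (intro exI[of _ a] ballI) simp
next
  assume "\<exists>a :: int \<Rightarrow> complex. \<forall>z\<in>upper_half_plane.
           ((\<lambda>n. a n * qpar (z / of_nat h) powi n) has_sum f z) {N..}"
  then obtain a :: "int \<Rightarrow> complex" where "\<forall>z\<in>upper_half_plane.
      ((\<lambda>n. a n * qpar (z / of_nat h) powi n) has_sum f z) {N..}" ..
  hence a: "((\<lambda>n. a n * qpar (z / of_nat h) powi n) has_sum f z) {N..}" if "Im z > 0" for z
    using that by simp
  define c where "c = (\<lambda>n. a (N + int n))"
  define g where "g = (\<lambda>w. \<Sum>n. c n * w ^ n)"
  have hs: "((\<lambda>n. c n * qpar (z / of_nat h) ^ n) has_sum (f z / qpar (z / of_nat h) powi N)) UNIV"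
    if "Im z > 0" for z
    using a[OF that] has_sum_powi_shift[of "qpar (z / of_nat h)" a N "f z / qpar (z / of_nat h) powi N"]
    by (simp add: c_def)
  have sums: "(\<lambda>n. c n * w ^ n) sums g w" if w: "w \<in> ball 0 1" for w
  proof (cases "w = 0")
    case True
    have "(\<lambda>n. c n * 0 ^ n) sums c 0" by (rule powser_sums_zero)
    thus ?thesis using True by (simp add: g_def sums_iff)
  next
    case False
    obtain z where z: "Im z > 0" "qpar (z / of_nat h) = w"
      using qpar_surj[OF h False] w by auto
    from has_sum_imp_sums[OF hs[OF z(1)]] show ?thesis
      unfolding z(2) g_def by (simp add: sums_iff)
  qed
  have "g holomorphic_on ball 0 1"
    by (rule power_series_holomorphic[where a = c]) (use sums in auto)
  moreover have "f z = qpar (z / of_nat h) powi N * g (qpar (z / of_nat h))" if z: "Im z > 0" for z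
  proof -
    have "g (qpar (z / of_nat h)) = f z / qpar (z / of_nat h) powi N"
      using sums_unique2[OF sums has_sum_imp_sums[OF hs[OF z]]] norm_qpar_div_less_1[OF z h] by simp
    thus ?thesis by simp
  qed
  ultimately show "qexp h N f" by (rule qexpI)
qed

lemma cusp_order_ge_iff: "cusp_order_ge k A F N \<longleftrightarrow> qexp 4 N (slash k A F)"
  by (subst qexp_iff_has_sum) (simp_all add: cusp_order_ge_def)

lemma qexp_cong:
  assumes "\<And>z. Im z > 0 \<Longrightarrow> f z = g z"
  shows "qexp h N f \<longleftrightarrow> qexp h N g"
  using assms by (auto simp: qexp_def)

lemma qexp_mult:
  assumes "qexp h N f" "qexp h M g"
  shows "qexp h (N + M) (\<lambda>z. f z * g z)"
  by (rule qexpE[OF assms(1)], rule qexpE[OF assms(2)], rule qexpI[OF holomorphic_on_mult])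
     (simp_all add: power_int_add)

lemma qexp_add:
  assumes "qexp h N f" "qexp h N g"
  shows "qexp h N (\<lambda>z. f z + g z)"
  by (rule qexpE[OF assms(1)], rule qexpE[OF assms(2)], rule qexpI[OF holomorphic_on_add])
     (simp_all add: distrib_left)

lemma qexp_mono:
  assumes "qexp h N f" "M \<le> N"
  shows "qexp h M f"
proof -
  obtain a where a: "a holomorphic_on ball 0 1"
    "\<And>z. Im z > 0 \<Longrightarrow> f z = qpar (z / of_nat h) powi N * a (qpar (z / of_nat h))"
    using assms by (auto simp: qexp_def)
  have "qpar (z / of_nat h) powi N = qpar (z / of_nat h) powi M * qpar (z / of_nat h) ^ nat (N - M)" for z
    by (rule powi_split[OF qpar_nonzero assms(2)])
  thus ?thesis
    by (intro qexpI[where g = "\<lambda>w. w ^ nat (N - M) * a w"])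
       (use a in \<open>auto intro!: holomorphic_intros\<close>)
qed

lemma qexp_const: "qexp h 0 (\<lambda>z. c)"
  by (rule qexpI[where g = "\<lambda>w. c"]) auto

lemma qexp_cmult:
  assumes "qexp h N f"
  shows "qexp h N (\<lambda>z. c * f z)"
  using qexp_mult[OF qexp_const assms] by simp

lemma qexp_diff:
  assumes "qexp h N f" "qexp h N g"
  shows "qexp h N (\<lambda>z. f z - g z)"
  using qexp_add[OF assms(1) qexp_cmult[OF assms(2), of "-1"]] by simp

text \<open>A real translation multiplies the parameter by a number of modulus 1, which preserves
  the disc. The coset representatives at the cusp 0 differ by such translations.\<close>

lemma qexp_shift:
  assumes "qexp h N f"
  shows "qexp h N (\<lambda>z. f (z + of_real x))"
proof -
  obtain a where a: "a holomorphic_on ball 0 1"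
    "\<And>z. Im z > 0 \<Longrightarrow> f z = qpar (z / of_nat h) powi N * a (qpar (z / of_nat h))"
    using assms by (auto simp: qexp_def)
  define \<zeta> where "\<zeta> = qpar (of_real x / of_nat h)"
  have n: "norm \<zeta> = 1" by (simp add: \<zeta>_def qpar_def norm_exp_eq_Re)
  have q: "qpar ((z + of_real x) / of_nat h) = qpar (z / of_nat h) * \<zeta>" for z
    by (simp add: \<zeta>_def qpar_add add_divide_distrib)
  have "(\<lambda>w. a (w * \<zeta>)) holomorphic_on ball 0 1"
    by (rule holomorphic_on_compose_gen[OF _ a(1), unfolded o_def])
       (auto intro!: holomorphic_intros simp: norm_mult n)
  thus ?thesis
    by (intro qexpI[where g = "\<lambda>w. \<zeta> powi N * a (w * \<zeta>)"])
       (use a(2) in \<open>auto intro!: holomorphic_intros simp: q power_int_mult_distrib\<close>)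
qed

lemma qexp_1_imp_4:
  assumes "qexp 1 N f"
  shows "qexp 4 (4 * N) f"
proof -
  obtain a where a: "a holomorphic_on ball 0 1"
    "\<And>z. Im z > 0 \<Longrightarrow> f z = qpar z powi N * a (qpar z)"
    using assms by (auto simp: qexp_def)
  have "(\<lambda>w. a (w ^ 4)) holomorphic_on ball 0 1"
    by (rule holomorphic_on_compose_gen[OF _ a(1), unfolded o_def])
       (auto intro!: holomorphic_intros norm_power_less_1)
  moreover have "f z = qpar (z / of_nat 4) powi (4 * N) * a (qpar (z / of_nat 4) ^ 4)" if "Im z > 0" for z
  proof -
    have "qpar z = qpar (z / of_nat 4) ^ 4"
      using qpar_of_nat_mult[of 4 "z / 4"] by simp
    thus ?thesis using a(2)[OF that] by (simp only: power_int_mult power_int_numeral)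
  qed
  ultimately show ?thesis by (rule qexpI)
qed

text \<open>As g has no zeros on the disc, l may be negative.\<close>

lemma qexp_powi:
  assumes "g holomorphic_on ball 0 1" "\<And>w. w \<in> ball 0 1 \<Longrightarrow> g w \<noteq> 0"
    and "\<And>z. Im z > 0 \<Longrightarrow> f z = qpar (z / of_nat h) powi N * g (qpar (z / of_nat h))"
  shows "qexp h (N * l) (\<lambda>z. f z powi l)"
proof (rule qexpI)
  show "(\<lambda>w. g w powi l) holomorphic_on ball 0 1"
    using assms(1,2) by (cases "l \<ge> 0") (auto simp: power_int_def intro!: holomorphic_intros)
qed (use assms(3) in \<open>simp add: power_int_mult_distrib power_int_mult\<close>)

text \<open>Up to a constant, differentiation acts as w d/dw on the parameter w and kills the
  constant term; derivatives of functions holomorphic at a cusp therefore vanish there.\<close>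

lemma qexp_deriv:
  assumes h: "h > 0" and f: "qexp h 0 f"
  shows "qexp h 1 (deriv f)"
proof -
  obtain g where g: "g holomorphic_on ball 0 1" "\<And>z. Im z > 0 \<Longrightarrow> f z = g (qpar (z / of_nat h))"
    using f by (auto simp: qexp_def)
  have "deriv f z = qpar (z / of_nat h) powi 1 * (2 * of_real pi * \<i> / of_nat h * deriv g (qpar (z / of_nat h)))"
    if z: "Im z > 0" for z
  proof -
    define w where "w = qpar (z / of_nat h)"
    have dq: "((\<lambda>z. qpar (z / of_nat h)) has_field_derivative 2 * of_real pi * \<i> / of_nat h * w) (at z)"
      unfolding qpar_def w_def using h by (auto intro!: derivative_eq_intros)
    have dg: "(g has_field_derivative deriv g w) (at w)"
      using norm_qpar_div_less_1[OF z h] by (intro holomorphic_derivI[OF g(1)]) (auto simp: w_def)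
    have "((\<lambda>z. g (qpar (z / of_nat h))) has_field_derivative deriv g w * (2 * of_real pi * \<i> / of_nat h * w)) (at z)"
      using DERIV_chain2[OF dg[unfolded w_def] dq] by (simp add: w_def)
    hence "(f has_field_derivative deriv g w * (2 * of_real pi * \<i> / of_nat h * w)) (at z)"
    proof (rule has_field_derivative_transform_within_open)
      show "open upper_half_plane" by (rule open_upper_half_plane)
    qed (use g(2) z in auto)
    thus ?thesis by (simp add: DERIV_imp_deriv w_def)
  qed
  moreover have "deriv g holomorphic_on ball 0 1" by (intro holomorphic_deriv g(1)) auto
  ultimately show ?thesis
    by (intro qexpI[where g = "\<lambda>w. 2 * of_real pi * \<i> / of_nat h * deriv g w"])
       (auto intro!: holomorphic_intros)
qed

text \<open>Compares constant terms: the parameter takes every value in the disc except 0, and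
  continuity supplies the equality there.\<close>

lemma qexp_imp_tendsto:
  assumes "h > 0" "\<And>z. Im z > 0 \<Longrightarrow> f (qpar (z / of_nat h)) = g (qpar (z / of_nat h))"
    and "continuous_on (ball 0 1) f" "continuous_on (ball 0 1) g"
  shows "f 0 = (g 0 :: complex)"
proof -
  have eq: "f w = g w" if "w \<in> ball 0 1 - {0}" for w
    using qpar_surj[OF assms(1), of w] that assms(2) by (metis DiffE dist_0_norm insertCI mem_ball)
  have "((\<lambda>w. f w) \<longlongrightarrow> f 0) (at 0)" "((\<lambda>w. g w) \<longlongrightarrow> g 0) (at 0)"
    using assms(3,4) by (simp_all add: continuous_on_eq_continuous_at isCont_def)
  moreover have "eventually (\<lambda>w. f w = g w) (at 0)"
    unfolding eventually_at by (rule exI[of _ 1]) (auto simp: eq)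
  hence "((\<lambda>w. f w) \<longlongrightarrow> f 0) (at 0) \<longleftrightarrow> ((\<lambda>w. g w) \<longlongrightarrow> f 0) (at 0)"
    by (rule tendsto_cong)
  ultimately show ?thesis using LIM_unique by blast
qed

lemma qexp_const_zero:
  assumes "h > 0" "qexp h 1 (\<lambda>z. c)"
  shows "c = 0"
proof -
  obtain g where g: "g holomorphic_on ball 0 1" "\<And>z. Im z > 0 \<Longrightarrow> c = qpar (z / of_nat h) * g (qpar (z / of_nat h))"
    using assms(2) by (auto simp: qexp_def)
  have "(\<lambda>w. c) 0 = (\<lambda>w. w * g w) 0"
    by (rule qexp_imp_tendsto[OF assms(1)])
       (use g in \<open>auto intro!: continuous_intros holomorphic_intros holomorphic_on_imp_continuous_on\<close>)
  thus ?thesis by simp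
qed

text \<open>One representative for each of the cusps 0 and 1/2 is tested, at a common order N, while
  the order at infinity is left open. N = 0 describes \<open>M_sharp_4\<close>, and N = 1 its
  subspace of forms that vanish at both cusps.\<close>

definition form4 :: "int \<Rightarrow> int \<Rightarrow> (complex \<Rightarrow> complex) \<Rightarrow> bool" where
  "form4 k N F \<longleftrightarrow> F holomorphic_on upper_half_plane \<and> (\<forall>z. \<not> Im z > 0 \<longrightarrow> F z = 0) \<and>
     Gamma0_4 \<subseteq> slash_stabilizer k F \<and> (\<exists>M. qexp 4 M F) \<and>
     qexp 4 N (slash k (mat2 0 (-1) 1 0) F) \<and> qexp 4 N (slash k (mat2 1 0 2 1) F)"

text \<open>Every such A lies in the coset of one of the two representatives up to a translation,
  and neither the stabilizer nor the translation lowers the order.\<close>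

lemma form4_slash_qexp:
  assumes F: "form4 k N F" and A: "A \<in> SL2Z" "\<not> 4 dvd A $ 2 $ 1"
  shows "qexp 4 N (slash k A F)"
  using A(1)
proof (cases rule: SL2Z_coset_cases)
  case infinity
  thus ?thesis using A by (simp add: Gamma0_4_iff)
next
  case (zero \<gamma> j)
  have "slash k A F z = slash k (mat2 0 (-1) 1 0) F (z + of_real (of_int j))" if "Im z > 0" for z
    unfolding zero(2) of_real_of_int_eq
    by (rule slash_coset_translate[OF _ zero(1) rep_SL2Z(1) that]) (use F in \<open>simp add: form4_def\<close>)
  moreover have "qexp 4 N (\<lambda>z. slash k (mat2 0 (-1) 1 0) F (z + of_real (of_int j)))"
    using F by (intro qexp_shift) (auto simp: form4_def)
  ultimately show ?thesis by (simp cong: qexp_cong)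
next
  case (half \<gamma>)
  have "slash k A F z = slash k (mat2 1 0 2 1) F z" if "Im z > 0" for z
    unfolding half(2) by (rule slash_coset[OF _ half(1) rep_SL2Z(2) that]) (use F in \<open>simp add: form4_def\<close>)
  moreover have "qexp 4 N (slash k (mat2 1 0 2 1) F)"
    using F by (auto simp: form4_def)
  ultimately show ?thesis by (simp cong: qexp_cong)
qed

lemma to_cusp_0: "A \<in> to_cusp 0 \<Longrightarrow> A \<in> SL2Z \<and> \<not> 4 dvd A $ 2 $ 1"
proof -
  assume A: "A \<in> to_cusp 0"
  hence SL: "A \<in> SL2Z" and "A $ 1 $ 1 = 0" by (auto simp: to_cusp_def)
  hence "A $ 1 $ 2 * A $ 2 $ 1 = - 1" by (simp add: SL2Z_iff)
  moreover have "\<not> 4 dvd (- 1 :: int)" by simp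
  ultimately have "\<not> 4 dvd A $ 2 $ 1" by (metis dvd_mult)
  thus ?thesis using SL by simp
qed

lemma to_cusp_half: "A \<in> to_cusp (1/2) \<Longrightarrow> A \<in> SL2Z \<and> \<not> 4 dvd A $ 2 $ 1"
proof -
  assume A: "A \<in> to_cusp (1/2)"
  hence SL: "A \<in> SL2Z" and "rat_of_int (A $ 1 $ 1) = 1 / 2 * rat_of_int (A $ 2 $ 1)"
    by (auto simp: to_cusp_def)
  hence "rat_of_int (A $ 2 $ 1) = rat_of_int (2 * A $ 1 $ 1)" by simp
  hence c: "A $ 2 $ 1 = 2 * A $ 1 $ 1" by (simp only: of_int_eq_iff)
  hence "A $ 1 $ 1 * (A $ 2 $ 2 - 2 * A $ 1 $ 2) = 1"
    using SL by (simp add: SL2Z_iff algebra_simps)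
  hence "A $ 1 $ 1 = 1 \<or> A $ 1 $ 1 = - 1" by (simp add: zmult_eq_1_iff) blast
  hence "\<not> 4 dvd A $ 2 $ 1" unfolding c by auto
  thus ?thesis using SL by simp
qed

lemma rep_cusps:
  "mat2 0 (-1) 1 0 \<in> to_cusp 0" "mat2 1 0 2 1 \<in> to_cusp (1/2)"
  by (simp_all add: to_cusp_def SL2Z_iff)

lemma Gamma0_4_subset_stabilizer_iff:
  "Gamma0_4 \<subseteq> slash_stabilizer k F \<longleftrightarrow> (\<forall>A\<in>Gamma0_4. \<forall>z\<in>upper_half_plane. slash k A F z = F z)"
  by (auto simp: slash_stabilizer_def Gamma0_4_def)

lemma form4_imp_M_sharp_4:
  assumes "form4 k N F" "N \<ge> 0"
  shows "F \<in> M_sharp_4 k"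
proof -
  have 0: "form4 k 0 F" using assms qexp_mono[of 4 N _ 0] by (auto simp: form4_def)
  have "\<exists>N. cusp_order_ge k A F N" if A: "A \<in> SL2Z" for A
  proof (cases "4 dvd A $ 2 $ 1")
    case True
    hence "A \<in> Gamma0_4" using A by (simp add: Gamma0_4_iff)
    hence "\<And>z. Im z > 0 \<Longrightarrow> slash k A F z = F z"
      using 0 by (auto simp: form4_def slash_stabilizer_def)
    thus ?thesis using 0 unfolding cusp_order_ge_iff by (auto simp: form4_def cong: qexp_cong)
  next
    case False
    thus ?thesis unfolding cusp_order_ge_iff using form4_slash_qexp[OF 0 A] by blast
  qed
  moreover have "holomorphic_at_cusp k 0 F" "holomorphic_at_cusp k (1/2) F"
    unfolding holomorphic_at_cusp_def cusp_order_ge_iff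
    using form4_slash_qexp[OF 0] to_cusp_0 to_cusp_half by blast+
  ultimately show ?thesis
    using 0 by (auto simp: M_sharp_4_def weakly_holomorphic_forms_4_def form4_def Gamma0_4_subset_stabilizer_iff)
qed

lemma M_sharp_4_imp_form4:
  assumes "F \<in> M_sharp_4 k"
  shows "form4 k 0 F"
proof -
  have "mat2 1 0 0 1 \<in> SL2Z" by (simp add: SL2Z_iff)
  then obtain N where "qexp 4 N (slash k (mat2 1 0 0 1) F)"
    using assms by (auto simp: M_sharp_4_def weakly_holomorphic_forms_4_def cusp_order_ge_iff)
  hence "qexp 4 N F" by (simp cong: qexp_cong)
  thus ?thesis using assms rep_cusps
    by (auto simp: M_sharp_4_def weakly_holomorphic_forms_4_def form4_def Gamma0_4_subset_stabilizer_iff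
        holomorphic_at_cusp_def cusp_order_ge_iff)
qed

lemma form4_1_iff:
  "form4 k 1 F \<longleftrightarrow> F \<in> M_sharp_4 k \<and> vanishes_at_cusp k 0 F \<and> vanishes_at_cusp k (1/2) F"
proof
  assume F: "form4 k 1 F"
  show "F \<in> M_sharp_4 k \<and> vanishes_at_cusp k 0 F \<and> vanishes_at_cusp k (1/2) F"
    unfolding vanishes_at_cusp_def cusp_order_ge_iff
    using form4_imp_M_sharp_4[OF F] form4_slash_qexp[OF F] to_cusp_0 to_cusp_half by auto
next
  assume F: "F \<in> M_sharp_4 k \<and> vanishes_at_cusp k 0 F \<and> vanishes_at_cusp k (1/2) F"
  thus "form4 k 1 F"
    using M_sharp_4_imp_form4[of F k] rep_cusps
    by (auto simp: form4_def vanishes_at_cusp_def cusp_order_ge_iff)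
qed

section \<open>Forms of weight 0 and the generators\<close>

lemma qpar_quarter_norm_le:
  assumes "Im z \<ge> 1/2"
  shows "norm (qpar (z / of_nat 4)) \<le> exp (- pi / 4)"
  using mult_left_mono[OF assms, of pi] by (simp add: qpar_def)

text \<open>Every orbit meets the region of height at least 1/2, where |q^(1/4)| \<le> exp(-pi/4);
  so all values of F are values of three holomorphic functions on one closed disc inside the unit
  disc. The largest of their moduli is attained at an interior point, possibly the cusp itself, and
  the maximum modulus principle applies to the function that attains it.\<close>

theorem form4_weight0_holomorphic_const:
  assumes F: "form4 0 0 F" and inf: "qexp 4 0 F"
  shows "\<exists>c. \<forall>z. Im z > 0 \<longrightarrow> F z = c"
proof -
  define R where "R = (\<lambda>i::nat. if i = 0 then mat2 1 0 0 1 else if i = 1 then mat2 0 (-1) 1 0 else mat2 1 0 2 1)"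
  have R: "R i \<in> SL2Z" for i by (simp add: R_def SL2Z_iff)
  have "qexp 4 0 (slash 0 (R i) F)" for i
    using F inf by (auto simp: R_def form4_def cong: qexp_cong)
  hence "\<forall>i. \<exists>g. g holomorphic_on ball 0 1 \<and> (\<forall>z. Im z > 0 \<longrightarrow> slash 0 (R i) F z = g (qpar (z / of_nat 4)))"
    by (auto simp: qexp_def)
  then obtain g where g: "\<And>i. g i holomorphic_on ball 0 1"
    "\<And>i z. Im z > 0 \<Longrightarrow> slash 0 (R i) F z = g i (qpar (z / of_nat 4))" by metis
  have slash0: "slash 0 A F z = F (moebius_act A z)" for A z by (simp add: slash_def)
  define D where "D = cball (0::complex) (exp (- pi / 4))"
  have "exp (- pi / 4) < 1" by simp
  hence D: "D \<subseteq> ball 0 1" "compact D" "0 \<in> D"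
    unfolding D_def by (auto simp del: exp_less_one_iff intro: le_less_trans)
  have "\<exists>w\<in>D. \<forall>v\<in>D. norm (g i v) \<le> norm (g i w)" for i
    using D by (intro continuous_attains_sup continuous_intros
        holomorphic_on_imp_continuous_on[OF holomorphic_on_subset[OF g(1)]]) auto
  then obtain w where w: "\<And>i. w i \<in> D" "\<And>i v. v \<in> D \<Longrightarrow> norm (g i v) \<le> norm (g i (w i))" by metis
  obtain i0 where i0: "\<And>i. i \<in> {0, 1, 2} \<Longrightarrow> norm (g i (w i)) \<le> norm (g i0 (w i0))"
  proof -
    define S where "S = (\<lambda>i::nat. norm (g i (w i))) ` {0, 1, 2}"
    have S: "finite S" "S \<noteq> {}" by (auto simp: S_def)
    obtain j where j: "Max S = norm (g j (w j))" using Max_in[OF S] by (auto simp: S_def)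
    have "norm (g i (w i)) \<le> norm (g j (w j))" if "i \<in> {0, 1, 2}" for i
      unfolding j[symmetric] by (rule Max_ge[OF S(1)]) (use that in \<open>auto simp: S_def\<close>)
    thus ?thesis using that by blast
  qed
  define M where "M = norm (g i0 (w i0))"
  have g_le: "norm (g i v) \<le> M" if "v \<in> D" "i \<in> {0, 1, 2}" for i v
    using w(2)[OF that(1), of i] i0[OF that(2)] by (simp add: M_def)
  have F_le: "norm (F z) \<le> M" if z: "Im z > 0" for z
  proof -
    obtain A where A: "A \<in> SL2Z" "Im (moebius_act A z) \<ge> 1/2" using SL2Z_reduction[OF z] by blast
    define y where "y = moebius_act A z"
    have y: "Im y > 0" using A by (simp add: y_def)
    define B where "B = inv2 A"
    have B: "B \<in> SL2Z" using A(1) by (auto simp: B_def)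
    have "moebius_act B y = moebius_act (B ** A) z"
      unfolding y_def by (rule moebius_act_mult[symmetric, OF B A(1) z])
    also have "\<dots> = z" by (simp only: B_def inv2_mult[OF A(1)]) (simp add: moebius_act_def)
    finally have Fz: "F z = slash 0 B F y" by (simp add: slash0)
    have stab: "Gamma0_4 \<subseteq> slash_stabilizer 0 F" using F by (simp add: form4_def)
    have *: "norm (slash 0 (R i) F x) \<le> M" if "i \<in> {0, 1, 2}" "Im x = Im y" for i x
    proof -
      have x: "Im x \<ge> 1/2" using A that by (simp add: y_def)
      have "qpar (x / of_nat 4) \<in> D" using qpar_quarter_norm_le[OF x] by (simp add: D_def)
      thus ?thesis using g(2)[of x i] x g_le that(1) by simp
    qed
    show ?thesis using B
    proof (cases rule: SL2Z_coset_cases)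
      case infinity
      hence "slash 0 B F y = slash 0 (R 0) F y" using stab y by (auto simp: R_def slash_stabilizer_def)
      thus ?thesis using *[of 0 y] Fz by simp
    next
      case (zero \<gamma> j)
      have "slash 0 B F y = slash 0 (R 1) F (y + of_int j)"
        unfolding zero(2) using slash_coset_translate[OF stab zero(1) rep_SL2Z(1) y] by (simp add: R_def)
      thus ?thesis using *[of 1 "y + of_int j"] Fz by simp
    next
      case (half \<gamma>)
      have "slash 0 B F y = slash 0 (R 2) F y"
        unfolding half(2) using slash_coset[OF stab half(1) rep_SL2Z(2) y] by (simp add: R_def)
      thus ?thesis using *[of 2 y] Fz by simp
    qed
  qed
  \<comment> \<open>The point 0 is not a value of the parameter, but it lies in \<open>D\<close>,
    where \<open>w i0\<close> is maximal by choice.\<close>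
  have bound: "norm (g i0 v) \<le> norm (g i0 (w i0))" if v: "v \<in> ball 0 1" for v
  proof (cases "v = 0")
    case True
    thus ?thesis using w(2)[OF D(3)] by simp
  next
    case False
    obtain z where z: "Im z > 0" "qpar (z / of_nat 4) = v"
      using qpar_surj[of 4 v] False v by auto
    have "norm (F (moebius_act (R i0) z)) \<le> M" by (intro F_le Im_moebius_act_pos R z)
    thus ?thesis using g(2)[OF z(1), of i0] z(2) by (simp add: slash0 M_def)
  qed
  have "g i0 constant_on ball 0 1"
  proof (rule maximum_modulus_principle[where U = "ball 0 1" and \<xi> = "w i0"])
    show "w i0 \<in> ball 0 1" using w(1) D by blast
  qed (use g bound in auto)
  then obtain c where c: "\<And>v. v \<in> ball 0 1 \<Longrightarrow> g i0 v = c" by (auto simp: constant_on_def)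
  have "F z = c" if z: "Im z > 0" for z
  proof -
    define y where "y = moebius_act (inv2 (R i0)) z"
    have y: "Im y > 0" unfolding y_def by (intro Im_moebius_act_pos inv2_SL2Z R z)
    have "moebius_act (R i0) y = moebius_act (R i0 ** inv2 (R i0)) z"
      unfolding y_def by (rule moebius_act_mult[symmetric]) (use R z in auto)
    also have "\<dots> = z" by (simp only: inv2_mult[OF R]) (simp add: moebius_act_def)
    finally have "F z = slash 0 (R i0) F y" by (simp add: slash0)
    also have "\<dots> = c" unfolding g(2)[OF y] by (rule c) (use norm_qpar_div_less_1[OF y, of 4] in simp)
    finally show ?thesis .
  qed
  thus ?thesis by blast
qed

section \<open>Closure properties of forms and the generators phi and P\<close>

lemma slash_times:
  assumes "A \<in> SL2Z" "Im z > 0"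
  shows "slash (k + k') A (\<lambda>z. F z * G z) z = slash k A F z * slash k' A G z"
  using cocycle2_nonzero[OF assms] by (simp add: slash_cocycle2 power_int_add power_int_diff power_int_minus field_simps)

lemma slash_add: "slash k A (\<lambda>z. F z + G z) z = slash k A F z + slash k A G z"
  by (simp add: slash_def distrib_left)

lemma slash_cmult: "slash k A (\<lambda>z. c * F z) z = c * slash k A F z"
  by (simp add: slash_def)

lemma form4_mult:
  assumes F: "form4 k N F" and G: "form4 k' N' G"
  shows "form4 (k + k') (N + N') (\<lambda>z. F z * G z)"
proof -
  have q: "qexp 4 (N + N') (slash (k + k') A (\<lambda>z. F z * G z))"
    if "A \<in> SL2Z" "qexp 4 N (slash k A F)" "qexp 4 N' (slash k' A G)" for A
    using qexp_mult[OF that(2,3)] slash_times[OF that(1)] by (simp cong: qexp_cong)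
  obtain M M' where "qexp 4 M F" "qexp 4 M' G" using F G by (auto simp: form4_def)
  from qexp_mult[OF this] have "\<exists>M. qexp 4 M (\<lambda>z. F z * G z)" by blast
  moreover have "Gamma0_4 \<subseteq> slash_stabilizer (k + k') (\<lambda>z. F z * G z)"
    using F G by (auto simp: form4_def Gamma0_4_subset_stabilizer_iff slash_times Gamma0_4_iff)
  ultimately show ?thesis
    using F G q rep_SL2Z by (auto simp: form4_def intro!: holomorphic_intros)
qed

lemma form4_add:
  assumes F: "form4 k N F" and G: "form4 k N G"
  shows "form4 k N (\<lambda>z. F z + G z)"
proof -
  obtain M M' where "qexp 4 M F" "qexp 4 M' G" using F G by (auto simp: form4_def)
  hence "qexp 4 (min M M') F" "qexp 4 (min M M') G" by (auto intro: qexp_mono)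
  from qexp_add[OF this] have "\<exists>M. qexp 4 M (\<lambda>z. F z + G z)" by blast
  moreover have "Gamma0_4 \<subseteq> slash_stabilizer k (\<lambda>z. F z + G z)"
    using F G by (auto simp: form4_def Gamma0_4_subset_stabilizer_iff slash_add)
  ultimately show ?thesis
    using F G by (auto simp: form4_def slash_add intro!: holomorphic_intros qexp_add cong: qexp_cong)
qed

lemma form4_cmult:
  assumes F: "form4 k N F"
  shows "form4 k N (\<lambda>z. c * F z)"
proof -
  have "Gamma0_4 \<subseteq> slash_stabilizer k (\<lambda>z. c * F z)"
    using F by (auto simp: form4_def Gamma0_4_subset_stabilizer_iff slash_cmult)
  thus ?thesis
    using F qexp_cmult[of 4 _ F c] by (auto simp: form4_def slash_cmult intro!: holomorphic_intros qexp_cmult cong: qexp_cong)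
qed

lemma form4_diff:
  assumes F: "form4 k N F" and G: "form4 k N G"
  shows "form4 k N (\<lambda>z. F z - G z)"
  using form4_add[OF F form4_cmult[OF G, of "-1"]] by simp

lemma form4_mono:
  assumes "form4 k N F" "M \<le> N"
  shows "form4 k M F"
  using assms by (auto simp: form4_def intro: qexp_mono)

lemma holomorphic_hauptmodul4: "hauptmodul4 holomorphic_on upper_half_plane"
  by (rule holomorphic_transform[where f = "\<lambda>z. eta4 z ^ 2 / eta4 (4 * z) ^ 2"])
     (auto intro!: holomorphic_intros simp: eta4_nonzero hauptmodul4_def)

lemma holomorphic_weight2_form: "weight2_form holomorphic_on upper_half_plane"
  by (rule holomorphic_transform[where f = "\<lambda>z. eta4 (4 * z) ^ 2 / eta4 (2 * z)"])
     (auto intro!: holomorphic_intros simp: eta4_nonzero weight2_form_def)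

lemma weight2_form_nonzero: "Im z > 0 \<Longrightarrow> weight2_form z \<noteq> 0"
  by (simp add: weight2_form_def eta4_nonzero)

definition hauptmodul4_num :: "complex \<Rightarrow> complex" where
  "hauptmodul4_num q = (euler_prod q / euler_prod (q ^ 4)) ^ 8"

definition weight2_num :: "complex \<Rightarrow> complex" where
  "weight2_num q = euler_prod (q ^ 4) ^ 8 / euler_prod (q ^ 2) ^ 4"

lemma euler_prod_power_nonzero: "norm q < 1 \<Longrightarrow> n > 0 \<Longrightarrow> euler_prod (q ^ n) \<noteq> 0"
  by (rule euler_prod_nonzero, rule norm_power_less_1)

lemma holomorphic_hauptmodul4_num: "hauptmodul4_num holomorphic_on ball 0 1"
  unfolding hauptmodul4_num_def
  by (intro holomorphic_intros) (auto intro!: norm_power_less_1 simp: euler_prod_power_nonzero)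

lemma holomorphic_weight2_num: "weight2_num holomorphic_on ball 0 1"
  unfolding weight2_num_def
  by (intro holomorphic_intros) (auto intro!: norm_power_less_1 simp: euler_prod_power_nonzero)

lemma weight2_num_nonzero: "norm q < 1 \<Longrightarrow> weight2_num q \<noteq> 0"
  by (simp add: weight2_num_def euler_prod_power_nonzero)

lemma hauptmodul4_num_0 [simp]: "hauptmodul4_num 0 = 1"
  and weight2_num_0 [simp]: "weight2_num 0 = 1"
  by (simp_all add: hauptmodul4_num_def weight2_num_def)

lemma hauptmodul4_eq_num: "Im z > 0 \<Longrightarrow> hauptmodul4 z = hauptmodul4_num (qpar z) / qpar z"
  by (simp add: hauptmodul4_qexp hauptmodul4_num_def)

lemma weight2_form_eq_num: "Im z > 0 \<Longrightarrow> weight2_form z = qpar z * weight2_num (qpar z)"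
  by (simp add: weight2_form_qexp weight2_num_def)

lemma hauptmodul4_qexp1: "qexp 1 (-1) hauptmodul4"
  by (rule qexpI[OF holomorphic_hauptmodul4_num]) (simp add: hauptmodul4_eq_num divide_inverse mult.commute)

text \<open>The parameter is w = q^(1/4), so q becomes w^4. The value -16 at the cusp, being
  nonzero, separates phi from forms that vanish there.\<close>

lemma hauptmodul4_at_half:
  obtains v where "v holomorphic_on ball 0 1" "v 0 = -16"
    "\<And>z. Im z > 0 \<Longrightarrow> slash 0 (mat2 1 0 2 1) hauptmodul4 z = v (qpar (z / of_nat 4))"
proof
  let ?v = "\<lambda>w. - 16 * (euler_prod (w ^ 4) ^ 16 * euler_prod (w ^ 16) ^ 8 / euler_prod (w ^ 8) ^ 24)"
  show "?v holomorphic_on ball 0 1"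
    by (intro holomorphic_intros) (auto intro!: norm_power_less_1 simp: euler_prod_power_nonzero)
  show "?v 0 = - 16" by simp
  fix z :: complex assume z: "Im z > 0"
  have "qpar z = qpar (z / of_nat 4) ^ 4" using qpar_of_nat_mult[of 4 "z / 4"] by simp
  thus "slash 0 (mat2 1 0 2 1) hauptmodul4 z = ?v (qpar (z / of_nat 4))"
    using hauptmodul4_U[OF z] by (simp add: slash_def moebius_act_def flip: power_mult)
qed

lemma form4_hauptmodul4: "form4 0 0 hauptmodul4"
  and hauptmodul4_slash_S: "qexp 4 1 (slash 0 (mat2 0 (-1) 1 0) hauptmodul4)"
proof -
  have "Gamma0_4 \<subseteq> slash_stabilizer 0 hauptmodul4"
    by (auto intro!: slash_stabilizer_Gamma0_4 simp: hauptmodul4_translate hauptmodul4_V)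
  moreover have S: "qexp 4 1 (slash 0 (mat2 0 (-1) 1 0) hauptmodul4)"
  proof (rule qexpI)
    show "(\<lambda>w. 256 * (euler_prod (w ^ 4) / euler_prod w) ^ 8) holomorphic_on ball 0 1"
      by (intro holomorphic_intros) (auto intro!: norm_power_less_1 simp: euler_prod_nonzero)
  qed (use hauptmodul4_S in \<open>simp add: slash_def moebius_act_def\<close>)
  moreover have "qexp 4 0 (slash 0 (mat2 1 0 2 1) hauptmodul4)"
    by (rule hauptmodul4_at_half, rule qexpI) auto
  moreover have "qexp 4 (-4) hauptmodul4" using qexp_1_imp_4[OF hauptmodul4_qexp1] by simp
  ultimately show "form4 0 0 hauptmodul4"
    using holomorphic_hauptmodul4 qexp_mono[OF S, of 0] by (auto simp: form4_def hauptmodul4_def)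
  show "qexp 4 1 (slash 0 (mat2 0 (-1) 1 0) hauptmodul4)" by (rule S)
qed

text \<open>Extension by 0 is explicit because a power with exponent 0 would equal 1 outside the
  half plane.\<close>

definition weight2_power :: "int \<Rightarrow> complex \<Rightarrow> complex" where
  "weight2_power l z = (if Im z > 0 then weight2_form z powi l else 0)"

lemma slash_weight2_power:
  assumes "A \<in> SL2Z" "Im z > 0"
  shows "slash (2 * l) A (weight2_power l) z = slash 2 A weight2_form z powi l"
proof -
  have "cocycle2 A z powi (- (2 * l)) = (cocycle2 A z powi (- 2)) powi l"
    by (simp flip: power_int_mult)
  thus ?thesis
    using Im_moebius_act_pos[OF assms] unfolding slash_cocycle2
    by (simp add: weight2_power_def power_int_mult_distrib)
qed

lemma qexp_weight2_power: "qexp 1 l (weight2_power l)"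
proof -
  have "qexp 1 (1 * l) (\<lambda>z. weight2_form z powi l)"
    by (rule qexp_powi[OF holomorphic_weight2_num])
       (auto simp: weight2_num_nonzero weight2_form_eq_num)
  thus ?thesis unfolding mult_1_left by (simp add: weight2_power_def cong: qexp_cong)
qed

text \<open>In the local parameter at each of the cusps 0 and 1/2 the form P is holomorphic without
  zeros, so all its integer powers, negative ones included, have order 0 there.\<close>

lemma form4_weight2_power: "form4 (2 * l) 0 (weight2_power l)"
proof -
  have stab2: "Gamma0_4 \<subseteq> slash_stabilizer 2 weight2_form"
    by (auto intro!: slash_stabilizer_Gamma0_4 simp: weight2_form_translate weight2_form_V)
  have "Gamma0_4 \<subseteq> slash_stabilizer (2 * l) (weight2_power l)"
  proof
    fix A assume A: "A \<in> Gamma0_4"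
    have SL: "A \<in> SL2Z" using A by (simp add: Gamma0_4_iff)
    have "slash (2 * l) A (weight2_power l) z = weight2_power l z" if "Im z > 0" for z
      using slash_weight2_power[OF SL that] stab2 A that
      by (auto simp: slash_stabilizer_def weight2_power_def)
    thus "A \<in> slash_stabilizer (2 * l) (weight2_power l)"
      using SL by (simp add: slash_stabilizer_def)
  qed
  moreover have "weight2_power l holomorphic_on upper_half_plane"
  proof (rule holomorphic_transform)
    show "(\<lambda>z. weight2_form z powi l) holomorphic_on upper_half_plane"
      using holomorphic_weight2_form weight2_form_nonzero
      by (cases "l \<ge> 0") (auto simp: power_int_def intro!: holomorphic_intros)
  qed (simp add: weight2_power_def)
  moreover have "qexp 4 0 (slash (2 * l) (mat2 0 (-1) 1 0) (weight2_power l))"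
  proof -
    have "qexp 4 (0 * l) (\<lambda>z. slash 2 (mat2 0 (-1) 1 0) weight2_form z powi l)"
    proof (rule qexp_powi)
      show "(\<lambda>w. - (1 / 64) * (euler_prod w ^ 8 / euler_prod (w ^ 2) ^ 4)) holomorphic_on ball 0 1"
        by (intro holomorphic_intros) (auto intro!: norm_power_less_1 simp: euler_prod_power_nonzero)
    next
      fix z :: complex assume z: "Im z > 0"
      have "slash 2 (mat2 0 (-1) 1 0) weight2_form z = weight2_form (- 1 / z) / z ^ 2"
        by (simp add: slash_def moebius_act_def power_int_minus divide_inverse)
      also note weight2_form_S[OF z]
      finally show "slash 2 (mat2 0 (-1) 1 0) weight2_form z = qpar (z / of_nat 4) powi 0 *
          (- (1 / 64) * (euler_prod (qpar (z / of_nat 4)) ^ 8 / euler_prod (qpar (z / of_nat 4) ^ 2) ^ 4))"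
        by simp
    qed (simp add: euler_prod_power_nonzero euler_prod_nonzero)
    thus ?thesis unfolding mult_zero_left using slash_weight2_power[OF rep_SL2Z(1)] by (simp cong: qexp_cong)
  qed
  moreover have "qexp 4 0 (slash (2 * l) (mat2 1 0 2 1) (weight2_power l))"
  proof -
    have "qexp 1 (0 * l) (\<lambda>z. slash 2 (mat2 1 0 2 1) weight2_form z powi l)"
    proof (rule qexp_powi)
      show "(\<lambda>q. (1 / 16) * (euler_prod (q ^ 2) ^ 20 / (euler_prod q ^ 8 * euler_prod (q ^ 4) ^ 8))) holomorphic_on ball 0 1"
        by (intro holomorphic_intros) (auto intro!: norm_power_less_1 simp: euler_prod_power_nonzero euler_prod_nonzero)
    next
      fix z :: complex assume z: "Im z > 0"
      have "slash 2 (mat2 1 0 2 1) weight2_form z = weight2_form (z / (2 * z + 1)) / (2 * z + 1) ^ 2"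
        by (simp add: slash_def moebius_act_def power_int_minus divide_inverse)
      also note weight2_form_U[OF z]
      finally show "slash 2 (mat2 1 0 2 1) weight2_form z = qpar (z / of_nat 1) powi 0 *
          ((1 / 16) * (euler_prod (qpar (z / of_nat 1) ^ 2) ^ 20 /
            (euler_prod (qpar (z / of_nat 1)) ^ 8 * euler_prod (qpar (z / of_nat 1) ^ 4) ^ 8)))"
        by simp
    qed (simp add: euler_prod_power_nonzero euler_prod_nonzero)
    from qexp_1_imp_4[OF this] show ?thesis
      unfolding mult_zero_left mult_zero_right using slash_weight2_power[OF rep_SL2Z(2)] by (simp cong: qexp_cong)
  qed
  moreover have "qexp 4 (4 * l) (weight2_power l)" by (rule qexp_1_imp_4[OF qexp_weight2_power])
  ultimately show ?thesis by (auto simp: form4_def weight2_power_def)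
qed

section \<open>Uniqueness\<close>

text \<open>Induction along the Horner scheme: multiplication by phi, which has weight 0 and is
  holomorphic at both cusps, keeps k and N.\<close>

lemma form4_poly_hauptmodul4:
  assumes "form4 k N F"
  shows "form4 k N (\<lambda>z. F z * poly p (hauptmodul4 z))"
proof (induction p)
  case 0
  thus ?case using form4_cmult[OF assms, of 0] by simp
next
  case (pCons a p)
  have "form4 k N (\<lambda>z. a * F z + (F z * poly p (hauptmodul4 z)) * hauptmodul4 z)"
    using form4_mult[OF pCons.IH form4_hauptmodul4] by (intro form4_add form4_cmult assms) simp
  thus ?case by (simp add: algebra_simps)
qed

lemma form4_zeroI:
  assumes "form4 k N F" "\<And>z. Im z > 0 \<Longrightarrow> F z = 0"
  shows "F = (\<lambda>z. 0)"
  using assms by (force simp: form4_def)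

lemma weight2_power_cancel:
  assumes "Im z > 0" "F z * weight2_power (- l) z = G z"
  shows "F z = G z * weight2_power l z"
  using assms weight2_form_nonzero[OF assms(1)]
  by (auto simp: weight2_power_def power_int_minus field_simps)

text \<open>Dividing by the power of the weight 2 form, which has neither zeros in the half plane nor
  at the cusps 0 and 1/2, reduces both uniqueness statements to weight 0.\<close>

theorem form4_unique:
  assumes F: "form4 (2 * l) 0 F" and q: "qexp 1 (l + 1) F"
  shows "F = (\<lambda>z. 0)"
proof (rule form4_zeroI[OF F])
  fix z :: complex assume z: "Im z > 0"
  define H where "H = (\<lambda>z. F z * weight2_power (- l) z)"
  have H: "form4 0 0 H" unfolding H_def using form4_mult[OF F form4_weight2_power[of "- l"]] by simp
  have "qexp 1 1 H" unfolding H_def using qexp_mult[OF q qexp_weight2_power[of "- l"]] by simp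
  from qexp_mono[OF qexp_1_imp_4[OF this], of 1] have H1: "qexp 4 1 H" by simp
  obtain c where c: "\<And>z. Im z > 0 \<Longrightarrow> H z = c"
    using form4_weight0_holomorphic_const[OF H qexp_mono[OF H1]] by auto
  have "qexp 4 1 (\<lambda>z. c)" using H1 c by (simp cong: qexp_cong)
  hence "c = 0" by (intro qexp_const_zero[of 4]) auto
  thus "F z = 0" using c[OF z] weight2_power_cancel[OF z, of F l "\<lambda>z. 0"] by (simp add: H_def)
qed

lemma holomorphic_factor_zero:
  assumes "f holomorphic_on ball 0 1" "f 0 = 0"
  obtains g where "g holomorphic_on ball 0 1" "\<And>w. f w = w * g w"
proof
  show "(\<lambda>z. if z = 0 then deriv f 0 else (f z - f 0) / (z - 0)) holomorphic_on ball 0 1"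
    by (rule pole_lemma[OF assms(1)]) auto
qed (use assms(2) in auto)

text \<open>After division by P^l at most a simple pole remains at infinity, so the quotient is a
  phi + b. Vanishing at the cusp 0, where phi vanishes, forces b = 0; vanishing at 1/2, where phi is
  -16, forces a = 0. The two cusp conditions thus pay for the two further coefficients that the
  bound l - 1 admits compared with \<open>form4_unique\<close>.\<close>

theorem form4_vanishing_unique:
  assumes F: "form4 (2 * l) 1 F" and q: "qexp 1 (l - 1) F"
  shows "F = (\<lambda>z. 0)"
proof (rule form4_zeroI[OF F])
  fix z :: complex assume z: "Im z > 0"
  define H where "H = (\<lambda>z. F z * weight2_power (- l) z)"
  have H: "form4 0 1 H" unfolding H_def using form4_mult[OF F form4_weight2_power[of "- l"]] by simp
  have "qexp 1 (- 1) H" unfolding H_def using qexp_mult[OF q qexp_weight2_power[of "- l"]] by simp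
  then obtain g where g: "g holomorphic_on ball 0 1" "\<And>z. Im z > 0 \<Longrightarrow> H z = g (qpar z) / qpar z"
    by (auto simp: qexp_def divide_inverse mult.commute)
  \<comment> \<open>Subtracting the multiple of phi with the same leading coefficient removes the
    pole.\<close>
  define a where "a = g 0"
  define G where "G = (\<lambda>z. H z - a * hauptmodul4 z)"
  have G: "form4 0 0 G"
    unfolding G_def by (intro form4_diff form4_cmult form4_hauptmodul4 form4_mono[OF H]) auto
  obtain g' where g': "g' holomorphic_on ball 0 1" "\<And>w. g w - a * hauptmodul4_num w = w * g' w"
    by (rule holomorphic_factor_zero[of "\<lambda>w. g w - a * hauptmodul4_num w"])
       (auto intro!: holomorphic_intros g holomorphic_hauptmodul4_num simp: a_def)
  have "qexp 1 0 G"
  proof (rule qexpI[OF g'(1)])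
    fix z :: complex assume z: "Im z > 0"
    have "G z = (g (qpar z) - a * hauptmodul4_num (qpar z)) / qpar z"
      using z by (simp add: G_def g(2) hauptmodul4_eq_num diff_divide_distrib)
    thus "G z = qpar (z / of_nat 1) powi 0 * g' (qpar (z / of_nat 1))" by (simp add: g'(2))
  qed
  from qexp_1_imp_4[OF this] obtain b where b: "\<And>z. Im z > 0 \<Longrightarrow> G z = b"
    using form4_weight0_holomorphic_const[OF G] by auto
  hence Hz: "\<And>z. Im z > 0 \<Longrightarrow> H z = a * hauptmodul4 z + b" by (simp add: G_def algebra_simps)
  have slashH: "slash 0 A H z = a * slash 0 A hauptmodul4 z + b" if "A \<in> SL2Z" "Im z > 0" for A z
    using Hz[OF Im_moebius_act_pos[OF that]] by (simp add: slash_def)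
  have "qexp 4 1 (\<lambda>z. slash 0 (mat2 0 (-1) 1 0) H z - a * slash 0 (mat2 0 (-1) 1 0) hauptmodul4 z)"
    using H by (intro qexp_diff qexp_cmult hauptmodul4_slash_S) (auto simp: form4_def)
  hence "qexp 4 1 (\<lambda>z. b)" using slashH[OF rep_SL2Z(1)] by (simp cong: qexp_cong)
  hence b0: "b = 0" by (intro qexp_const_zero[of 4]) auto
  obtain v where v: "v holomorphic_on ball 0 1" "v 0 = -16"
    "\<And>z. Im z > 0 \<Longrightarrow> slash 0 (mat2 1 0 2 1) hauptmodul4 z = v (qpar (z / of_nat 4))"
    using hauptmodul4_at_half by metis
  have "qexp 4 1 (slash 0 (mat2 1 0 2 1) H)" using H by (auto simp: form4_def)
  then obtain h where h: "h holomorphic_on ball 0 1"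
    "\<And>z. Im z > 0 \<Longrightarrow> slash 0 (mat2 1 0 2 1) H z = qpar (z / of_nat 4) * h (qpar (z / of_nat 4))"
    by (auto simp: qexp_def)
  have "(\<lambda>w. a * v w) 0 = (\<lambda>w. w * h w) 0"
  proof (rule qexp_imp_tendsto[of 4])
    fix z :: complex assume z: "Im z > 0"
    show "a * v (qpar (z / of_nat 4)) = qpar (z / of_nat 4) * h (qpar (z / of_nat 4))"
      using slashH[OF rep_SL2Z(2) z] b0 h(2)[OF z] v(3)[OF z] by simp
  qed (use v h in \<open>auto intro!: holomorphic_on_imp_continuous_on holomorphic_intros\<close>)
  hence "a = 0" using v(2) by simp
  thus "F z = 0"
    using Hz[OF z] b0 weight2_power_cancel[OF z, of F l "\<lambda>z. 0"] by (simp add: H_def)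
qed

section \<open>Characterization of the two families by principal parts\<close>

lemma qexp_1_iff_has_sum:
  "qexp 1 N f \<longleftrightarrow> (\<exists>a :: int \<Rightarrow> complex. \<forall>z\<in>upper_half_plane.
           ((\<lambda>n. a n * qpar z powi n) has_sum f z) {N..})"
  using qexp_iff_has_sum[of 1 N f] by simp

text \<open>The prescribed power q^(-m) cancels in the difference of two candidates, which therefore
  has order at least l + 1 at infinity and is 0. Exhibiting one form with the principal part thus
  evaluates the definite description.\<close>

lemma f4_eqI:
  assumes F: "form4 (2 * l) 0 F" and q: "qexp 1 (l + 1) (\<lambda>z. F z - qpar z powi (- m))"
  shows "f4 (2 * l) m = F"
  unfolding f4_def
proof (rule the_equality, goal_cases)
  case 1
  show ?case
    using form4_imp_M_sharp_4[OF F] q unfolding qexp_1_iff_has_sum by simp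
next
  case (2 G)
  hence G: "form4 (2 * l) 0 G" and qG: "qexp 1 (l + 1) (\<lambda>z. G z - qpar z powi (- m))"
    unfolding qexp_1_iff_has_sum by (auto intro: M_sharp_4_imp_form4)
  have "qexp 1 (l + 1) (\<lambda>z. G z - F z)"
    using qexp_diff[OF qG q] by simp
  hence "(\<lambda>z. G z - F z) = (\<lambda>z. 0)"
    by (rule form4_unique[OF form4_diff[OF G F]])
  thus "G = F" by (metis eq_iff_diff_eq_0 ext)
qed

lemma g4_eqI:
  assumes F: "form4 (2 * l) 1 F" and q: "qexp 1 (l - 1) (\<lambda>z. F z - qpar z powi (- m))"
  shows "g4 (2 * l) m = F"
  unfolding g4_def
proof (rule the_equality, goal_cases)
  case 1
  show ?case
    using F q unfolding qexp_1_iff_has_sum form4_1_iff by simp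
next
  case (2 G)
  hence G: "form4 (2 * l) 1 G" and qG: "qexp 1 (l - 1) (\<lambda>z. G z - qpar z powi (- m))"
    unfolding qexp_1_iff_has_sum form4_1_iff by auto
  have "qexp 1 (l - 1) (\<lambda>z. G z - F z)"
    using qexp_diff[OF qG q] by simp
  hence "(\<lambda>z. G z - F z) = (\<lambda>z. 0)"
    by (rule form4_vanishing_unique[OF form4_diff[OF G F]])
  thus "G = F" by (metis eq_iff_diff_eq_0 ext)
qed

text \<open>Chain rule with the derivative (c z + d)^(-2) of the Moebius map, which accounts for the
  weight 2.\<close>

lemma deriv_slash_weight0:
  assumes F: "F holomorphic_on upper_half_plane" and A: "A \<in> SL2Z" and z: "Im z > 0"
  shows "deriv (slash 0 A F) z = slash 2 A (deriv F) z"
proof -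
  have nz: "cocycle2 A z \<noteq> 0" by (rule cocycle2_nonzero[OF A z])
  have det: "of_int (A $ 1 $ 1) * of_int (A $ 2 $ 2) - of_int (A $ 1 $ 2) * of_int (A $ 2 $ 1) = (1 :: complex)"
    using A unfolding SL2Z_iff of_int_mult[symmetric] of_int_diff[symmetric] by simp
  have "(moebius_act A has_field_derivative
      (of_int (A $ 1 $ 1) * cocycle2 A z - (of_int (A $ 1 $ 1) * z + of_int (A $ 1 $ 2)) * of_int (A $ 2 $ 1))
        / (cocycle2 A z * cocycle2 A z)) (at z)"
    unfolding moebius_act_def cocycle2_def using nz
    by (auto intro!: derivative_eq_intros simp: cocycle2_def)
  also have "of_int (A $ 1 $ 1) * cocycle2 A z - (of_int (A $ 1 $ 1) * z + of_int (A $ 1 $ 2)) * of_int (A $ 2 $ 1) =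
      (of_int (A $ 1 $ 1) * of_int (A $ 2 $ 2) - of_int (A $ 1 $ 2) * of_int (A $ 2 $ 1) :: complex)"
    by (simp add: cocycle2_def algebra_simps)
  finally have d: "(moebius_act A has_field_derivative 1 / (cocycle2 A z * cocycle2 A z)) (at z)"
    by (simp only: det)
  have "(F has_field_derivative deriv F (moebius_act A z)) (at (moebius_act A z))"
    using Im_moebius_act_pos[OF A z] by (intro holomorphic_derivI[OF F open_upper_half_plane]) simp
  from DERIV_chain2[OF this d]
  have "deriv (\<lambda>z. F (moebius_act A z)) z = deriv F (moebius_act A z) * (1 / (cocycle2 A z * cocycle2 A z))"
    by (rule DERIV_imp_deriv)
  moreover have "slash 0 A F = (\<lambda>z. F (moebius_act A z))" by (simp add: slash_def fun_eq_iff)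
  ultimately show ?thesis
    by (simp add: slash_cocycle2 power_int_minus power2_eq_square divide_inverse mult.commute)
qed

text \<open>This is -q dphi/dq; the sign normalizes the coefficient of q^(-1) to 1.\<close>

definition hauptmodul4_theta :: "complex \<Rightarrow> complex" where
  "hauptmodul4_theta z = (if Im z > 0 then - 1 / (2 * of_real pi * \<i>) * deriv hauptmodul4 z else 0)"

lemma hauptmodul4_theta_eq_num:
  assumes z: "Im z > 0"
  shows "hauptmodul4_theta z = (hauptmodul4_num (qpar z) - qpar z * deriv hauptmodul4_num (qpar z)) / qpar z"
proof -
  define q where "q = qpar z"
  define X where "X = (hauptmodul4_num q - q * deriv hauptmodul4_num q) / q"
  have dq: "(qpar has_field_derivative 2 * of_real pi * \<i> * q) (at z)"
    unfolding qpar_def q_def by (auto intro!: derivative_eq_intros)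
  have "(hauptmodul4_num has_field_derivative deriv hauptmodul4_num q) (at q)"
    using norm_qpar_less_1[OF z] by (intro holomorphic_derivI[OF holomorphic_hauptmodul4_num]) (auto simp: q_def)
  from DERIV_chain2[OF this[unfolded q_def] dq[unfolded q_def]]
  have du: "((\<lambda>z. hauptmodul4_num (qpar z)) has_field_derivative deriv hauptmodul4_num q * (2 * of_real pi * \<i> * q)) (at z)"
    by (simp add: q_def)
  have "((\<lambda>z. hauptmodul4_num (qpar z) / qpar z) has_field_derivative
      (deriv hauptmodul4_num q * (2 * of_real pi * \<i> * q) * qpar z - hauptmodul4_num (qpar z) * (2 * of_real pi * \<i> * q))
        / (qpar z * qpar z)) (at z)"
    by (rule DERIV_divide[OF du dq]) simp
  hence "(hauptmodul4 has_field_derivative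
      (deriv hauptmodul4_num q * (2 * of_real pi * \<i> * q) * qpar z - hauptmodul4_num (qpar z) * (2 * of_real pi * \<i> * q))
        / (qpar z * qpar z)) (at z)"
    by (rule has_field_derivative_transform_within_open[OF _ open_upper_half_plane])
       (use z hauptmodul4_eq_num in auto)
  hence "deriv hauptmodul4 z = (deriv hauptmodul4_num q * (2 * of_real pi * \<i> * q) * q - hauptmodul4_num q * (2 * of_real pi * \<i> * q))
        / (q * q)"
    unfolding q_def[symmetric] by (rule DERIV_imp_deriv)
  also have "\<dots> = - (2 * of_real pi * \<i>) * X"
    by (simp add: X_def q_def field_simps)
  finally show ?thesis
    using z unfolding q_def[symmetric] X_def[symmetric] by (simp add: hauptmodul4_theta_def)
qed

text \<open>Differentiation kills the constant terms of phi at the cusps 0 and 1/2, which raises N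
  from 0 to 1.\<close>

lemma form4_hauptmodul4_theta: "form4 2 1 hauptmodul4_theta"
proof -
  define c where "c = - 1 / (2 * of_real pi * \<i>)"
  have th: "hauptmodul4_theta z = c * deriv hauptmodul4 z" if "Im z > 0" for z
    using that by (simp add: hauptmodul4_theta_def c_def)
  have sl: "slash 2 A hauptmodul4_theta z = c * deriv (slash 0 A hauptmodul4) z"
    if "A \<in> SL2Z" "Im z > 0" for A z
    using slash_cong[where F = hauptmodul4_theta and G = "\<lambda>z. c * deriv hauptmodul4 z" and k = 2, OF that th]
      deriv_slash_weight0[OF holomorphic_hauptmodul4 that]
    by (simp add: slash_def)
  have "hauptmodul4_theta holomorphic_on upper_half_plane"
  proof (rule holomorphic_transform)
    show "(\<lambda>z. c * deriv hauptmodul4 z) holomorphic_on upper_half_plane"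
      by (intro holomorphic_intros holomorphic_deriv holomorphic_hauptmodul4 open_upper_half_plane)
  qed (simp add: th)
  moreover have "Gamma0_4 \<subseteq> slash_stabilizer 2 hauptmodul4_theta"
  proof
    fix A assume A: "A \<in> Gamma0_4"
    hence SL: "A \<in> SL2Z" by (simp add: Gamma0_4_iff)
    have "slash 2 A hauptmodul4_theta z = hauptmodul4_theta z" if z: "Im z > 0" for z
    proof -
      have "eventually (\<lambda>z. z \<in> upper_half_plane) (nhds z)"
        using z by (intro eventually_nhds_in_open open_upper_half_plane) simp
      hence "eventually (\<lambda>z. slash 0 A hauptmodul4 z = hauptmodul4 z) (nhds z)"
        by eventually_elim (use form4_hauptmodul4 A in \<open>auto simp: form4_def slash_stabilizer_def\<close>)
      hence "deriv (slash 0 A hauptmodul4) z = deriv hauptmodul4 z" by (rule deriv_cong_ev) simp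
      thus ?thesis using sl[OF SL z] th[OF z] by simp
    qed
    thus "A \<in> slash_stabilizer 2 hauptmodul4_theta" using SL by (simp add: slash_stabilizer_def)
  qed
  moreover have "qexp 4 1 (slash 2 A hauptmodul4_theta)" if "A \<in> SL2Z" "qexp 4 0 (slash 0 A hauptmodul4)" for A
    using qexp_cmult[OF qexp_deriv[OF _ that(2)], of c] sl[OF that(1)] by (simp cong: qexp_cong)
  moreover have "\<exists>M. qexp 4 M hauptmodul4_theta"
  proof -
    have "qexp 1 (-1) hauptmodul4_theta"
    proof (rule qexpI)
      show "(\<lambda>q. hauptmodul4_num q - q * deriv hauptmodul4_num q) holomorphic_on ball 0 1"
        by (intro holomorphic_intros holomorphic_deriv holomorphic_hauptmodul4_num) auto
    qed (simp add: hauptmodul4_theta_eq_num divide_inverse mult.commute)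
    from qexp_1_imp_4[OF this] show ?thesis by blast
  qed
  ultimately show ?thesis
    using form4_hauptmodul4 rep_SL2Z unfolding form4_def
    by (auto simp: hauptmodul4_theta_def)
qed

section \<open>Coefficients of the kernel\<close>

definition taylor_coeff :: "(complex \<Rightarrow> complex) \<Rightarrow> nat \<Rightarrow> complex" where
  "taylor_coeff f n = (deriv ^^ n) f 0 / fact n"

lemma taylor_coeff_0 [simp]: "taylor_coeff f 0 = f 0"
  by (simp add: taylor_coeff_def)

lemma taylor_coeff_mult:
  assumes "f holomorphic_on S" "g holomorphic_on S" "open S" "0 \<in> S"
  shows "taylor_coeff (\<lambda>w. f w * g w) n = (\<Sum>i\<le>n. taylor_coeff f i * taylor_coeff g (n - i))"
proof -
  have "taylor_coeff (\<lambda>w. f w * g w) n =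
      (\<Sum>i\<le>n. of_nat (n choose i) * (deriv ^^ i) f 0 * (deriv ^^ (n - i)) g 0) / fact n"
    unfolding taylor_coeff_def higher_deriv_mult[OF assms] by (simp add: atLeast0AtMost)
  also have "\<dots> = (\<Sum>i\<le>n. taylor_coeff f i * taylor_coeff g (n - i))"
    unfolding sum_divide_distrib
    by (intro sum.cong refl) (auto simp: taylor_coeff_def binomial_fact field_simps)
  finally show ?thesis .
qed

text \<open>With the remainder as a holomorphic multiple of x^(n+1), the quotient u(x) / x^n becomes
  an explicit principal part with constant term plus a multiple of x.\<close>

lemma holomorphic_taylor_remainder:
  assumes f: "f holomorphic_on ball 0 1"
  obtains T where "T holomorphic_on ball 0 1"
    "\<And>x. x \<in> ball 0 1 \<Longrightarrow> f x = (\<Sum>i\<le>n. taylor_coeff f i * x ^ i) + x ^ Suc n * T x"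
proof -
  have sums: "(\<lambda>i. taylor_coeff f i * x ^ i) sums f x" if "x \<in> ball 0 1" for x
    using holomorphic_power_series[OF f that] by (simp add: taylor_coeff_def)
  define T where "T = (\<lambda>x. \<Sum>i. taylor_coeff f (i + Suc n) * x ^ i)"
  have shift: "(\<lambda>i. x ^ Suc n * (taylor_coeff f (i + Suc n) * x ^ i)) sums (f x - (\<Sum>i\<le>n. taylor_coeff f i * x ^ i))"
    if "x \<in> ball 0 1" for x
    using sums_split_initial_segment[OF sums[OF that], of "Suc n"]
    by (simp add: power_add mult_ac lessThan_Suc_atMost)
  have T: "(\<lambda>i. taylor_coeff f (i + Suc n) * x ^ i) sums T x" if x: "x \<in> ball 0 1" for x
  proof (cases "x = 0")
    case True
    show ?thesis unfolding T_def True by (intro summable_sums sums_summable[OF powser_sums_zero])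
  next
    case False
    hence "summable (\<lambda>i. taylor_coeff f (i + Suc n) * x ^ i)"
      using sums_summable[OF shift[OF x]] by (subst (asm) summable_cmult_iff) auto
    thus ?thesis unfolding T_def by (rule summable_sums)
  qed
  have "T holomorphic_on ball 0 1"
    by (rule power_series_holomorphic[where a = "\<lambda>i. taylor_coeff f (i + Suc n)"]) (use T in simp)
  moreover have "f x = (\<Sum>i\<le>n. taylor_coeff f i * x ^ i) + x ^ Suc n * T x" if "x \<in> ball 0 1" for x
    using sums_unique2[OF shift[OF that] sums_mult[OF T[OF that], of "x ^ Suc n"]] by (simp add: algebra_simps)
  ultimately show ?thesis by (rule that)
qed

text \<open>The coefficients, as polynomials in \<open>t\<close>, of the power series of \<open>b(x) / (u(x) - t x)\<close>.\<close>
fun kernel_poly :: "(nat \<Rightarrow> complex) \<Rightarrow> (nat \<Rightarrow> complex) \<Rightarrow> nat \<Rightarrow> complex poly" where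
  "kernel_poly u b n = [:b n:] - (\<Sum>j<n. smult (u (n - j)) (kernel_poly u b j)) +
     (if n = 0 then 0 else pCons 0 (kernel_poly u b (n - 1)))"

declare kernel_poly.simps [simp del]

lemma poly_kernel_poly:
  "poly (kernel_poly u b n) t = b n - (\<Sum>j<n. u (n - j) * poly (kernel_poly u b j) t) +
     (if n = 0 then 0 else t * poly (kernel_poly u b (n - 1)) t)"
  by (subst kernel_poly.simps) (simp add: poly_sum)

lemma taylor_coeff_linear: "taylor_coeff (\<lambda>w. w) n = (if n = 1 then 1 else 0)"
proof -
  have "(deriv ^^ n) (\<lambda>w. w) (0::complex) = (if n = 1 then 1 else 0)"
    using higher_deriv_ident[of n "0::complex"] by auto
  thus ?thesis by (simp add: taylor_coeff_def)
qed

text \<open>Taylor coefficients are compared in G u = B + t x G for G = B / (u - t x): since u(0) =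
  1, coefficient n of G is determined by the earlier ones through the recursion of
  \<open>kernel_poly\<close>. The radius r, within which u - t x has no zeros, depends on t.\<close>

lemma kernel_poly_generating:
  assumes u: "u holomorphic_on ball 0 1" "u 0 = 1" and B: "B holomorphic_on ball 0 1"
    and r: "0 < r" "r \<le> 1" and nz: "\<And>w. w \<in> ball 0 r \<Longrightarrow> u w \<noteq> t * w"
    and x: "x \<in> ball 0 r"
  shows "((\<lambda>n. poly (kernel_poly (taylor_coeff u) (taylor_coeff B) n) t * x ^ n) has_sum
           (B x / (u x - t * x))) UNIV"
proof -
  define G where "G = (\<lambda>w. B w / (u w - t * w))"
  have sub: "ball 0 r \<subseteq> ball (0::complex) 1" using r by auto
  have hol: "u holomorphic_on ball 0 r" "B holomorphic_on ball 0 r"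
    using u B sub holomorphic_on_subset by blast+
  have G: "G holomorphic_on ball 0 r"
    unfolding G_def by (intro holomorphic_intros hol) (use nz in auto)
  have eq: "G w * u w = B w + t * (G w * w)" if "w \<in> ball 0 r" for w
    using nz[OF that] by (simp add: G_def field_simps)
  have coeff: "(\<Sum>i\<le>n. taylor_coeff G i * taylor_coeff u (n - i)) =
      taylor_coeff B n + (if n = 0 then 0 else t * taylor_coeff G (n - 1))" for n
  proof -
    have "(\<Sum>i\<le>n. taylor_coeff G i * taylor_coeff u (n - i)) = taylor_coeff (\<lambda>w. G w * u w) n"
      by (rule taylor_coeff_mult[symmetric, OF G hol(1)]) (use r in auto)
    also have "\<dots> = taylor_coeff (\<lambda>w. B w + t * (G w * w)) n"
      unfolding taylor_coeff_def
      by (intro arg_cong2[where f = "(/)"] refl higher_deriv_transform_within_open[where S = "ball 0 r"])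
         (use eq r in \<open>auto intro!: holomorphic_intros hol G\<close>)
    also have "\<dots> = taylor_coeff B n + t * taylor_coeff (\<lambda>w. G w * w) n"
    proof -
      have GW: "(\<lambda>w. G w * w) holomorphic_on ball 0 r" by (intro holomorphic_intros G)
      have "(deriv ^^ n) (\<lambda>w. B w + t * (G w * w)) 0 = (deriv ^^ n) B 0 + (deriv ^^ n) (\<lambda>w. t * (G w * w)) 0"
        by (rule higher_deriv_add[where S = "ball 0 r"]) (use r in \<open>auto intro!: holomorphic_intros hol G\<close>)
      also have "(deriv ^^ n) (\<lambda>w. t * (G w * w)) 0 = t * (deriv ^^ n) (\<lambda>w. G w * w) 0"
        by (rule higher_deriv_cmult[OF GW]) (use r in auto)
      finally show ?thesis by (simp add: taylor_coeff_def add_divide_distrib)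
    qed
    also have "taylor_coeff (\<lambda>w. G w * w) n = (\<Sum>i\<le>n. taylor_coeff G i * taylor_coeff (\<lambda>w. w) (n - i))"
      by (rule taylor_coeff_mult[OF G]) (use r in \<open>auto intro!: holomorphic_intros\<close>)
    also have "\<dots> = (\<Sum>i\<le>n. if n - i = 1 then taylor_coeff G i else 0)"
      by (intro sum.cong) (auto simp: taylor_coeff_linear)
    also have "\<dots> = (if n = 0 then 0 else taylor_coeff G (n - 1))"
    proof (cases n)
      case (Suc m)
      have "(\<Sum>i\<le>n. if n - i = 1 then taylor_coeff G i else 0) = (\<Sum>i\<le>n. if i = m then taylor_coeff G i else 0)"
        by (intro sum.cong) (auto simp: Suc)
      thus ?thesis by (simp add: Suc)
    qed simp
    finally show ?thesis by simp
  qed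
  have "taylor_coeff G n = poly (kernel_poly (taylor_coeff u) (taylor_coeff B) n) t" for n
  proof (induction n rule: less_induct)
    case (less n)
    have "taylor_coeff G n + (\<Sum>i<n. taylor_coeff G i * taylor_coeff u (n - i)) =
      taylor_coeff B n + (if n = 0 then 0 else t * taylor_coeff G (n - 1))"
      using coeff[of n] u(2) by (simp add: lessThan_Suc_atMost[symmetric] add.commute)
    hence "taylor_coeff G n = taylor_coeff B n - (\<Sum>i<n. taylor_coeff u (n - i) * taylor_coeff G i)
        + (if n = 0 then 0 else t * taylor_coeff G (n - 1))"
      by (simp add: algebra_simps)
    also have "\<dots> = poly (kernel_poly (taylor_coeff u) (taylor_coeff B) n) t"
      unfolding poly_kernel_poly[of _ _ n] using less.IH by simp
    finally show ?case .
  qed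
  thus ?thesis
    using holomorphic_has_sum_power_series[OF G x] by (simp add: taylor_coeff_def G_def)
qed

text \<open>The coefficient of \<open>x\<close> is a residue: up to the sign, the integrand is the derivative of
  a primitive of \<open>p\<close> composed with \<open>u(x) / x\<close>.\<close>
lemma residue_duality:
  assumes u: "u holomorphic_on ball 0 1" and A: "A holomorphic_on ball 0 1" and B: "B holomorphic_on ball 0 1"
    and AB: "\<And>x. x \<in> ball 0 1 \<Longrightarrow> A x * B x = u x - x * deriv u x" and B0: "B 0 = 1"
    and E: "E holomorphic_on ball 0 1"
    and eq: "\<And>x. x \<in> ball 0 1 - {0} \<Longrightarrow> A x * poly p (u x / x) = 1 / x ^ n + x * E x"
  shows "E 0 = - taylor_coeff B (Suc n)"
proof -
  \<comment> \<open>The primitive is entire, so its composition with u(x) / x is single valued on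
    the punctured disc.\<close>
  obtain Q where Q: "\<And>t. (Q has_field_derivative poly p t) (at t)"
  proof -
    have "poly p holomorphic_on UNIV"
      unfolding holomorphic_on_def field_differentiable_def by (auto intro: poly_DERIV)
    thus ?thesis using that holomorphic_convex_primitive'[of UNIV "poly p"] by auto
  qed
  have "path_image (circlepath 0 (1/2)) \<subseteq> ball 0 1 - {0 :: complex}"
    by (auto simp: path_image_circlepath)
  moreover have "((\<lambda>x. Q (u x / x)) has_field_derivative - (B x / x ^ Suc (Suc n) + (E x * B x) / x ^ Suc 0))
      (at x within ball 0 1 - {0})" if x: "x \<in> ball 0 1 - {0}" for x
  proof -
    have "(u has_field_derivative deriv u x) (at x)"
      using x by (intro holomorphic_derivI[OF u]) auto
    hence "((\<lambda>x. u x / x) has_field_derivative (deriv u x * x - u x) / (x * x)) (at x)"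
      using x by (auto intro!: derivative_eq_intros)
    from DERIV_chain2[OF Q this]
    have "((\<lambda>x. Q (u x / x)) has_field_derivative poly p (u x / x) * ((deriv u x * x - u x) / (x * x))) (at x)" .
    also have "deriv u x * x - u x = - (A x * B x)" using AB[of x] x by simp
    also have "poly p (u x / x) * (- (A x * B x) / (x * x)) = - ((A x * poly p (u x / x)) * B x / (x * x))"
      by simp
    also have "\<dots> = - (B x / x ^ Suc (Suc n) + (E x * B x) / x ^ Suc 0)"
      unfolding eq[OF x] using x by (simp add: field_simps)
    finally show ?thesis by (rule has_field_derivative_at_within)
  qed
  \<comment> \<open>The integral of a derivative over the circle is 0, while Cauchy's formula
    evaluates it to -2 pi i times the sum of E(0) and the Taylor coefficient of B at n + 1.\<close>
  ultimately have 0: "((\<lambda>x. - (B x / x ^ Suc (Suc n) + (E x * B x) / x ^ Suc 0)) has_contour_integral 0) (circlepath 0 (1/2))"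
    using contour_integral_primitive[where S = "ball 0 1 - {0}" and g = "circlepath 0 (1/2)"]
    by fastforce
  have EB: "(\<lambda>x. E x * B x) holomorphic_on ball 0 1" by (intro holomorphic_intros E B)
  have sub: "cball 0 (1/2) \<subseteq> ball (0::complex) 1" "ball 0 (1/2) \<subseteq> ball (0::complex) 1" by auto
  have cauchy: "((\<lambda>x. f x / x ^ Suc k) has_contour_integral (2 * pi * \<i> * taylor_coeff f k)) (circlepath 0 (1/2))"
    if "f holomorphic_on ball 0 1" for f k
    using Cauchy_has_contour_integral_higher_derivative_circlepath[of 0 "1/2" f 0 k]
      holomorphic_on_imp_continuous_on[OF holomorphic_on_subset[OF that sub(1)]] holomorphic_on_subset[OF that sub(2)]
    by (simp add: taylor_coeff_def)
  have "((\<lambda>x. - (B x / x ^ Suc (Suc n) + (E x * B x) / x ^ Suc 0)) has_contour_integral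
     - (2 * pi * \<i> * taylor_coeff B (Suc n) + 2 * pi * \<i> * taylor_coeff (\<lambda>x. E x * B x) 0)) (circlepath 0 (1/2))"
    by (intro has_contour_integral_neg has_contour_integral_add cauchy B EB)
  with 0 have "- (2 * pi * \<i> * taylor_coeff B (Suc n) + 2 * pi * \<i> * taylor_coeff (\<lambda>x. E x * B x) 0) = 0"
    using has_contour_integral_unique by blast
  hence "2 * pi * \<i> * taylor_coeff B (Suc n) + 2 * pi * \<i> * E 0 = 0"
    by (simp only: neg_equal_0_iff_equal taylor_coeff_0 B0 mult_1_right)
  hence "2 * pi * \<i> * (taylor_coeff B (Suc n) + E 0) = 0"
    by (simp only: distrib_left)
  thus ?thesis by (simp add: eq_neg_iff_add_eq_0 add.commute)
qed

text \<open>The recursion is multiplied by A and evaluated at t = u(x) / x. For n = m + 1 the factor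
  t turns 1 / x^m into u(x) / x^n, and the subtracted sum removes the terms of this quotient from
  x^(1-n) up to the constant one. What is left at x = 0 is coefficient n of B plus E_m(0), which is
  zero by \<open>residue_duality\<close>.\<close>

theorem kernel_poly_principal_part:
  assumes u: "u holomorphic_on ball 0 1" "u 0 = 1"
    and A: "A holomorphic_on ball 0 1" "A 0 = 1" and B: "B holomorphic_on ball 0 1" "B 0 = 1"
    and AB: "\<And>x. x \<in> ball 0 1 \<Longrightarrow> A x * B x = u x - x * deriv u x"
  shows "\<exists>E. E holomorphic_on ball 0 1 \<and> (\<forall>x\<in>ball 0 1 - {0}.
      A x * poly (kernel_poly (taylor_coeff u) (taylor_coeff B) n) (u x / x) = 1 / x ^ n + x * E x)"
proof (induction n rule: less_induct)
  case (less n)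
  define r where "r = kernel_poly (taylor_coeff u) (taylor_coeff B)"
  have "\<exists>E. \<forall>j<n. E j holomorphic_on ball 0 1 \<and>
      (\<forall>x\<in>ball 0 1 - {0}. A x * poly (r j) (u x / x) = 1 / x ^ j + x * E j x)"
    using less.IH unfolding r_def by metis
  then obtain E where E: "\<And>j. j < n \<Longrightarrow> E j holomorphic_on ball 0 1"
    "\<And>j x. j < n \<Longrightarrow> x \<in> ball 0 1 - {0} \<Longrightarrow> A x * poly (r j) (u x / x) = 1 / x ^ j + x * E j x"
    by blast
  show ?case
  proof (cases n)
    case 0
    have "kernel_poly (taylor_coeff u) (taylor_coeff B) 0 = 1"
      by (subst kernel_poly.simps) (simp add: B one_pCons)
    moreover obtain g where "g holomorphic_on ball 0 1" "\<And>x. A x - 1 = x * g x"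
      by (rule holomorphic_factor_zero[of "\<lambda>x. A x - 1"]) (auto intro!: holomorphic_intros A simp: A)
    ultimately show ?thesis using 0 by (intro exI[of _ g]) (auto simp: algebra_simps)
  next
    case (Suc m)
    obtain T where T: "T holomorphic_on ball 0 1"
      "\<And>x. x \<in> ball 0 1 \<Longrightarrow> u x = (\<Sum>i\<le>n. taylor_coeff u i * x ^ i) + x ^ Suc n * T x"
      using holomorphic_taylor_remainder[OF u(1), of n] by metis
    define H where "H = (\<lambda>x. A x * taylor_coeff B n - x * (\<Sum>j<n. taylor_coeff u (n - j) * E j x)
      + u x * E m x + x * T x)"
    have H: "H holomorphic_on ball 0 1"
      unfolding H_def by (intro holomorphic_intros A u T E) (auto simp: Suc)
    have eq: "A x * poly (r n) (u x / x) = 1 / x ^ n + H x" if x: "x \<in> ball 0 1 - {0}" for x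
    proof -
      have x0: "x \<noteq> 0" using x by simp
      define \<phi> where "\<phi> = u x / x"
      have "A x * poly (r n) \<phi> = A x * taylor_coeff B n - (\<Sum>j<n. taylor_coeff u (n - j) * (A x * poly (r j) \<phi>))
          + \<phi> * (A x * poly (r m) \<phi>)"
        unfolding r_def by (subst poly_kernel_poly) (simp add: Suc algebra_simps sum_distrib_left)
      also have "(\<Sum>j<n. taylor_coeff u (n - j) * (A x * poly (r j) \<phi>)) =
          (\<Sum>j<n. taylor_coeff u (n - j) * (1 / x ^ j)) + x * (\<Sum>j<n. taylor_coeff u (n - j) * E j x)"
        unfolding sum_distrib_left sum.distrib[symmetric]
        by (intro sum.cong refl) (use E(2) x in \<open>simp add: \<phi>_def algebra_simps\<close>)
      also have "A x * poly (r m) \<phi> = 1 / x ^ m + x * E m x"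
        using E(2)[of m x] x by (simp add: \<phi>_def Suc)
      also have "\<phi> * (1 / x ^ m + x * E m x) = u x / x ^ n + u x * E m x"
        using x0 by (simp add: \<phi>_def Suc field_simps)
      also have "u x / x ^ n = 1 / x ^ n + (\<Sum>j<n. taylor_coeff u (n - j) * (1 / x ^ j)) + x * T x"
      proof -
        have "(\<Sum>i\<le>n. taylor_coeff u i * x ^ i) / x ^ n = (\<Sum>i\<le>n. taylor_coeff u i * (1 / x ^ (n - i)))"
          unfolding sum_divide_distrib
          by (intro sum.cong refl) (use x0 in \<open>simp add: power_diff field_simps\<close>)
        also have "\<dots> = (\<Sum>j\<le>n. taylor_coeff u (n - j) * (1 / x ^ j))"
          by (rule sum.reindex_bij_witness[of _ "\<lambda>j. n - j" "\<lambda>j. n - j"]) auto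
        also have "\<dots> = (\<Sum>j<n. taylor_coeff u (n - j) * (1 / x ^ j)) + 1 / x ^ n"
          by (simp add: lessThan_Suc_atMost[symmetric] u(2))
        finally have s: "(\<Sum>i\<le>n. taylor_coeff u i * x ^ i) / x ^ n =
            (\<Sum>j<n. taylor_coeff u (n - j) * (1 / x ^ j)) + 1 / x ^ n" .
        have "u x / x ^ n = (\<Sum>i\<le>n. taylor_coeff u i * x ^ i) / x ^ n + x * T x"
          using T(2)[of x] x x0 by (simp add: add_divide_distrib)
        thus ?thesis unfolding s by simp
      qed
      finally show ?thesis by (simp add: H_def \<phi>_def)
    qed
    \<comment> \<open>The duality is applied to the preceding polynomial, with index m: its error
      term cancels coefficient n = m + 1 of B.\<close>
    have "E m 0 = - taylor_coeff B (Suc m)"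
      by (rule residue_duality[OF u(1) A(1) B(1) AB B(2)]) (use E[of m] Suc in auto)
    hence "H 0 = 0" by (simp add: H_def A u(2) Suc)
    then obtain g where "g holomorphic_on ball 0 1" "\<And>x. H x = x * g x"
      using holomorphic_factor_zero[OF H] by metis
    thus ?thesis using eq unfolding r_def by (intro exI[of _ g]) auto
  qed
qed

section \<open>The generating functions\<close>

definition theta_num :: "complex \<Rightarrow> complex" where
  "theta_num q = hauptmodul4_num q - q * deriv hauptmodul4_num q"

text \<open>Together with \<open>theta_quotient_num\<close> this forms the pair (A, B); their
  product u - q u' does not depend on l.\<close>

definition weight2_num_power :: "int \<Rightarrow> complex \<Rightarrow> complex" where
  "weight2_num_power l q = weight2_num q powi l"

definition theta_quotient_num :: "int \<Rightarrow> complex \<Rightarrow> complex" where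
  "theta_quotient_num l q = theta_num q * weight2_num q powi (- l)"

lemma holomorphic_theta_num: "theta_num holomorphic_on ball 0 1"
  unfolding theta_num_def by (intro holomorphic_intros holomorphic_deriv holomorphic_hauptmodul4_num) auto

lemma holomorphic_weight2_num_power: "weight2_num_power l holomorphic_on ball 0 1"
  unfolding weight2_num_power_def using holomorphic_weight2_num weight2_num_nonzero
  by (cases "l \<ge> 0") (auto simp: power_int_def intro!: holomorphic_intros)

lemma holomorphic_theta_quotient_num: "theta_quotient_num l holomorphic_on ball 0 1"
  unfolding theta_quotient_num_def
  by (rule holomorphic_on_mult[OF holomorphic_theta_num
        holomorphic_weight2_num_power[of "- l", unfolded weight2_num_power_def]])

lemma weight2_num_power_0 [simp]: "weight2_num_power l 0 = 1"
  and theta_quotient_num_0 [simp]: "theta_quotient_num l 0 = 1"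
  by (simp_all add: weight2_num_power_def theta_quotient_num_def theta_num_def)

lemma weight2_num_power_mult_theta_quotient_num:
  assumes "q \<in> ball 0 1"
  shows "weight2_num_power l q * theta_quotient_num l q = hauptmodul4_num q - q * deriv hauptmodul4_num q"
  using assms weight2_num_nonzero[of q]
  by (simp add: weight2_num_power_def theta_quotient_num_def theta_num_def power_int_minus)

text \<open>The index n stands for m = n - l here and for m = n + l + 1 in \<open>g4_poly\<close>.
  The two definitions differ in which member of the pair plays the part of B.\<close>

definition f4_poly :: "int \<Rightarrow> nat \<Rightarrow> complex poly" where
  "f4_poly l = kernel_poly (taylor_coeff hauptmodul4_num) (taylor_coeff (theta_quotient_num l))"

definition g4_poly :: "int \<Rightarrow> nat \<Rightarrow> complex poly" where
  "g4_poly l = kernel_poly (taylor_coeff hauptmodul4_num) (taylor_coeff (weight2_num_power l))"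

lemma weight2_power_eq_num:
  "Im z > 0 \<Longrightarrow> weight2_power l z = qpar z powi l * weight2_num_power l (qpar z)"
  by (simp add: weight2_power_def weight2_form_eq_num weight2_num_power_def power_int_mult_distrib)

lemma theta_quotient_eq_num:
  assumes "Im z > 0"
  shows "hauptmodul4_theta z * weight2_power (- l) z = qpar z powi (- l - 1) * theta_quotient_num l (qpar z)"
  using assms
  by (simp add: weight2_power_eq_num hauptmodul4_theta_eq_num theta_quotient_num_def theta_num_def
      weight2_num_power_def power_int_diff)

text \<open>Multiplying 1 / q^n + q E by q^l gives q^(-(n - l)) + q^(l + 1) E: the missing constant
  term of the first expression is what produces the gap in the expansion of f.\<close>

theorem f4_formula:
  "f4 (2 * l) (int n - l) = (\<lambda>z. weight2_power l z * poly (f4_poly l n) (hauptmodul4 z))"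
proof (rule f4_eqI)
  show "form4 (2 * l) 0 (\<lambda>z. weight2_power l z * poly (f4_poly l n) (hauptmodul4 z))"
    by (rule form4_poly_hauptmodul4[OF form4_weight2_power])
  obtain E where E: "E holomorphic_on ball 0 1" "\<And>x. x \<in> ball 0 1 - {0} \<Longrightarrow>
      weight2_num_power l x * poly (f4_poly l n) (hauptmodul4_num x / x) = 1 / x ^ n + x * E x"
    using kernel_poly_principal_part[OF holomorphic_hauptmodul4_num hauptmodul4_num_0
        holomorphic_weight2_num_power[of l] weight2_num_power_0 holomorphic_theta_quotient_num[of l]
        theta_quotient_num_0 weight2_num_power_mult_theta_quotient_num, of n]
    unfolding f4_poly_def by blast
  show "qexp 1 (l + 1) (\<lambda>z. weight2_power l z * poly (f4_poly l n) (hauptmodul4 z) - qpar z powi - (int n - l))"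
  proof (rule qexpI[OF E(1)])
    fix z :: complex assume z: "Im z > 0"
    define q where "q = qpar z"
    have q: "q \<in> ball 0 1 - {0}" using norm_qpar_less_1[OF z] by (simp add: q_def)
    have "weight2_power l z * poly (f4_poly l n) (hauptmodul4 z) = q powi l * (1 / q ^ n + q * E q)"
      using z E(2)[OF q] by (simp add: weight2_power_eq_num hauptmodul4_eq_num q_def mult.assoc)
    also have "\<dots> = q powi (- (int n - l)) + q powi (l + 1) * E q"
      using q by (simp add: power_int_diff power_int_add algebra_simps)
    finally show "weight2_power l z * poly (f4_poly l n) (hauptmodul4 z) - qpar z powi - (int n - l) =
        qpar (z / of_nat 1) powi (l + 1) * E (qpar (z / of_nat 1))"
      by (simp add: q_def)
  qed
qed

text \<open>Weight 2 - 2 l is 2 (1 - l), so the tail of g starts at (1 - l) - 1 = -l. The factor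
  q^(-l - 1) shifts 1 / q^n + q E to q^(-(n + l + 1)) + q^(-l) E, and the theta derivative supplies
  the vanishing at the cusps 0 and 1/2.\<close>

theorem g4_formula:
  "g4 (2 - 2 * l) (int n + l + 1) =
     (\<lambda>z. hauptmodul4_theta z * weight2_power (- l) z * poly (g4_poly l n) (hauptmodul4 z))"
proof -
  have "g4 (2 * (1 - l)) (int n + l + 1) =
     (\<lambda>z. hauptmodul4_theta z * weight2_power (- l) z * poly (g4_poly l n) (hauptmodul4 z))"
  proof (rule g4_eqI)
    have "form4 (2 * (1 - l)) 1 (\<lambda>z. hauptmodul4_theta z * weight2_power (- l) z)"
      using form4_mult[OF form4_hauptmodul4_theta form4_weight2_power[of "- l"]] by (simp add: algebra_simps)
    thus "form4 (2 * (1 - l)) 1 (\<lambda>z. hauptmodul4_theta z * weight2_power (- l) z * poly (g4_poly l n) (hauptmodul4 z))"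
      by (rule form4_poly_hauptmodul4)
    have AB: "theta_quotient_num l q * weight2_num_power l q = hauptmodul4_num q - q * deriv hauptmodul4_num q"
      if "q \<in> ball 0 1" for q
      using weight2_num_power_mult_theta_quotient_num[OF that] by (simp add: mult.commute)
    obtain E where E: "E holomorphic_on ball 0 1" "\<And>x. x \<in> ball 0 1 - {0} \<Longrightarrow>
        theta_quotient_num l x * poly (g4_poly l n) (hauptmodul4_num x / x) = 1 / x ^ n + x * E x"
      using kernel_poly_principal_part[OF holomorphic_hauptmodul4_num hauptmodul4_num_0
          holomorphic_theta_quotient_num[of l] theta_quotient_num_0 holomorphic_weight2_num_power[of l]
          weight2_num_power_0 AB, of n]
      unfolding g4_poly_def by blast
    show "qexp 1 (1 - l - 1) (\<lambda>z. hauptmodul4_theta z * weight2_power (- l) z * poly (g4_poly l n) (hauptmodul4 z)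
        - qpar z powi - (int n + l + 1))"
    proof (rule qexpI[OF E(1)])
      fix z :: complex assume z: "Im z > 0"
      define q where "q = qpar z"
      have q: "q \<in> ball 0 1 - {0}" using norm_qpar_less_1[OF z] by (simp add: q_def)
      have "hauptmodul4_theta z * weight2_power (- l) z * poly (g4_poly l n) (hauptmodul4 z) =
          q powi (- l - 1) * (1 / q ^ n + q * E q)"
        using z E(2)[OF q] unfolding theta_quotient_eq_num[OF z]
        by (simp add: hauptmodul4_eq_num q_def mult.assoc)
      also have "\<dots> = q powi (- (int n + l + 1)) + q powi (- l) * E q"
      proof -
        have "- (int n + l + 1) = - l - 1 - int n" by simp
        hence "q powi (- (int n + l + 1)) = q powi (- l - 1 - int n)" by (simp only:)
        also have "\<dots> = q powi (- l - 1) / q ^ n" using q by (simp add: power_int_diff)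
        finally show ?thesis using q by (simp add: power_int_diff[of q "- l" 1] distrib_left)
      qed
      finally show "hauptmodul4_theta z * weight2_power (- l) z * poly (g4_poly l n) (hauptmodul4 z)
          - qpar z powi - (int n + l + 1) =
          qpar (z / of_nat 1) powi (1 - l - 1) * E (qpar (z / of_nat 1))"
        by (simp add: q_def)
    qed
  qed
  thus ?thesis by (simp add: algebra_simps)
qed

section \<open>First members of both families and the kernel identity\<close>

lemma kernel_poly_0: "b 0 = 1 \<Longrightarrow> kernel_poly u b 0 = 1"
  by (subst kernel_poly.simps) (simp add: one_pCons)

lemma f4_first: "f4 (2 * l) (- l) = weight2_power l"
  using f4_formula[of l 0] by (simp add: f4_poly_def kernel_poly_0)

lemma g4_first: "g4 (2 - 2 * l) (l + 1) = (\<lambda>z. hauptmodul4_theta z * weight2_power (- l) z)"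
  using g4_formula[of l 0] by (simp add: g4_poly_def kernel_poly_0)

text \<open>The kernel contains only the difference of two values of f_{0,1}, in which c
  cancels.\<close>

lemma f4_0_1:
  obtains c where "\<And>z. Im z > 0 \<Longrightarrow> f4 0 1 z = hauptmodul4 z + c"
proof
  have 1: "f4_poly 0 1 = pCons 0 (f4_poly 0 0) + [:taylor_coeff (theta_quotient_num 0) 1:] -
      smult (taylor_coeff hauptmodul4_num 1) (f4_poly 0 0)"
    unfolding f4_poly_def by (subst kernel_poly.simps) simp
  have 0: "f4_poly 0 0 = 1" by (simp add: f4_poly_def kernel_poly_0)
  fix z :: complex assume z: "Im z > 0"
  have "f4 0 1 z = poly (f4_poly 0 1) (hauptmodul4 z)"
    using f4_formula[of 0 1] z by (simp add: weight2_power_def)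
  thus "f4 0 1 z = hauptmodul4 z + (taylor_coeff (theta_quotient_num 0) 1 - taylor_coeff hauptmodul4_num 1)"
    unfolding 1 0 by simp
qed

text \<open>The function u(w) - t w equals 1 at w = 0 and so has no zero on a small disc; as |q| =
  exp(-2 pi Im z), that disc contains q for all z above some height Y.\<close>

lemma pole_free_half_plane:
  obtains r Y where "0 < r" "r \<le> 1" "Y > 0" "\<And>w. w \<in> ball 0 r \<Longrightarrow> hauptmodul4_num w \<noteq> t * w"
    "\<And>z. Im z > Y \<Longrightarrow> qpar z \<in> ball 0 r"
proof -
  have "continuous_on (ball 0 1) (\<lambda>w. hauptmodul4_num w - t * w)"
    by (intro holomorphic_on_imp_continuous_on holomorphic_intros holomorphic_hauptmodul4_num)
  hence "isCont (\<lambda>w. hauptmodul4_num w - t * w) 0"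
    by (simp add: continuous_on_eq_continuous_at)
  from continuous_at_avoid[OF this, of 0] obtain e where e: "e > 0"
    "\<And>w. dist 0 w < e \<Longrightarrow> hauptmodul4_num w - t * w \<noteq> 0" by auto
  define r where "r = min e 1"
  define Y where "Y = max 1 (- ln r / (2 * pi))"
  have r: "0 < r" "r \<le> 1" using e(1) by (auto simp: r_def)
  have "qpar z \<in> ball 0 r" if "Im z > Y" for z
  proof -
    have "Im z > - ln r / (2 * pi)" using that by (simp add: Y_def)
    hence "- (2 * pi * Im z) < ln r" by (simp add: field_simps)
    hence "exp (- (2 * pi * Im z)) < r" using r(1) by (metis exp_less_mono exp_ln)
    thus ?thesis by (simp add: qpar_def)
  qed
  moreover have "Y > 0" by (simp add: Y_def)
  moreover have "hauptmodul4_num w \<noteq> t * w" if "w \<in> ball 0 r" for w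
    using e(2)[of w] that by (auto simp: r_def)
  ultimately show ?thesis using that r by blast
qed

text \<open>Multiplying numerator and denominator by the expansion variable q turns both expansions
  into instances of \<open>kernel_poly_generating\<close>, with t the value of phi at the fixed
  point and one or the other member of the pair as B.\<close>

theorem mainTheorem4:
  fixes k l :: int
  assumes "k = 2 * l"
  shows
    "(\<forall>\<tau> \<in> upper_half_plane. \<exists>Y > 0. \<forall>z. Im z > Y \<longrightarrow>
        f4 0 1 z \<noteq> f4 0 1 \<tau> \<and>
        ((\<lambda>m. f4 k m \<tau> * qpar z powi m) has_sum
           (f4 k (- l) \<tau> * g4 (2 - k) (l + 1) z / (f4 0 1 z - f4 0 1 \<tau>))) {- l..}) \<and>
     (\<forall>z \<in> upper_half_plane. \<exists>Y > 0. \<forall>\<tau>. Im \<tau> > Y \<longrightarrow>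
        f4 0 1 z \<noteq> f4 0 1 \<tau> \<and>
        ((\<lambda>m. g4 (2 - k) m z * qpar \<tau> powi m) has_sum
           - (f4 k (- l) \<tau> * g4 (2 - k) (l + 1) z / (f4 0 1 z - f4 0 1 \<tau>))) {l + 1..})"
proof (intro conjI ballI)
  obtain c where f01: "\<And>z. Im z > 0 \<Longrightarrow> f4 0 1 z = hauptmodul4 z + c" using f4_0_1 by blast
  note hol = holomorphic_hauptmodul4_num hauptmodul4_num_0
  {
    fix \<tau> assume "\<tau> \<in> upper_half_plane"
    hence \<tau>: "Im \<tau> > 0" by simp
    define t where "t = hauptmodul4 \<tau>"
    obtain r Y where r: "0 < r" "r \<le> 1" "\<And>w. w \<in> ball 0 r \<Longrightarrow> hauptmodul4_num w \<noteq> t * w"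
      and Y: "Y > 0" "\<And>z. Im z > Y \<Longrightarrow> qpar z \<in> ball 0 r"
      using pole_free_half_plane[of t] by metis
    show "\<exists>Y > 0. \<forall>z. Im z > Y \<longrightarrow>
        f4 0 1 z \<noteq> f4 0 1 \<tau> \<and>
        ((\<lambda>m. f4 k m \<tau> * qpar z powi m) has_sum
           (f4 k (- l) \<tau> * g4 (2 - k) (l + 1) z / (f4 0 1 z - f4 0 1 \<tau>))) {- l..}"
    proof (intro exI[of _ Y] conjI allI impI Y(1))
      fix z assume "Im z > Y"
      hence z: "Im z > 0" and q: "qpar z \<in> ball 0 r" using Y by auto
      define q where "q = qpar z"
      have q0: "q \<noteq> 0" by (simp add: q_def)
      have ne: "hauptmodul4_num q - t * q \<noteq> 0" using r(3)[OF q] by (simp add: q_def)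
      \<comment> \<open>The factor q clears the pole of phi at infinity, so that the two values
        differ because u(q) - t q has no zero on the disc.\<close>
      have diff: "f4 0 1 z - f4 0 1 \<tau> = (hauptmodul4_num q - t * q) / q"
        using q0 z \<tau> by (simp add: f01 hauptmodul4_eq_num[OF z] t_def q_def field_simps)
      show "f4 0 1 z \<noteq> f4 0 1 \<tau>" using diff ne q0 by auto
      define S where "S = weight2_power l \<tau> * (theta_quotient_num l q / (hauptmodul4_num q - t * q))"
      have "((\<lambda>n. weight2_power l \<tau> * (poly (f4_poly l n) t * q ^ n)) has_sum S) UNIV"
        unfolding S_def f4_poly_def q_def
        by (intro has_sum_cmult_right kernel_poly_generating[OF hol holomorphic_theta_quotient_num r q])
      hence "((\<lambda>n. f4 k (- l + int n) \<tau> * q ^ n) has_sum S) UNIV"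
        using f4_formula[of l] by (simp add: assms t_def mult.assoc)
      hence "((\<lambda>m. f4 k m \<tau> * q powi m) has_sum q powi (- l) * S) {- l..}"
        by (subst has_sum_powi_shift[OF q0])
      also have "q powi (- l) * S = f4 k (- l) \<tau> * g4 (2 - k) (l + 1) z / (f4 0 1 z - f4 0 1 \<tau>)"
        using q0 unfolding diff S_def assms f4_first g4_first theta_quotient_eq_num[OF z] q_def[symmetric]
        by (simp add: power_int_diff)
      finally show "((\<lambda>m. f4 k m \<tau> * qpar z powi m) has_sum
           (f4 k (- l) \<tau> * g4 (2 - k) (l + 1) z / (f4 0 1 z - f4 0 1 \<tau>))) {- l..}"
        by (simp add: q_def)
    qed
  next
    fix z assume "z \<in> upper_half_plane"
    hence z: "Im z > 0" by simp
    define t where "t = hauptmodul4 z"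
    obtain r Y where r: "0 < r" "r \<le> 1" "\<And>w. w \<in> ball 0 r \<Longrightarrow> hauptmodul4_num w \<noteq> t * w"
      and Y: "Y > 0" "\<And>z. Im z > Y \<Longrightarrow> qpar z \<in> ball 0 r"
      using pole_free_half_plane[of t] by metis
    show "\<exists>Y > 0. \<forall>\<tau>. Im \<tau> > Y \<longrightarrow>
        f4 0 1 z \<noteq> f4 0 1 \<tau> \<and>
        ((\<lambda>m. g4 (2 - k) m z * qpar \<tau> powi m) has_sum
           - (f4 k (- l) \<tau> * g4 (2 - k) (l + 1) z / (f4 0 1 z - f4 0 1 \<tau>))) {l + 1..}"
    proof (intro exI[of _ Y] conjI allI impI Y(1))
      fix \<tau> assume "Im \<tau> > Y"
      hence \<tau>: "Im \<tau> > 0" and q: "qpar \<tau> \<in> ball 0 r" using Y by auto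
      define q where "q = qpar \<tau>"
      have q0: "q \<noteq> 0" by (simp add: q_def)
      have ne: "hauptmodul4_num q - t * q \<noteq> 0" using r(3)[OF q] by (simp add: q_def)
      \<comment> \<open>The expanded variable now stands in the subtracted term, which produces the
        minus sign of the second equality.\<close>
      have diff: "f4 0 1 z - f4 0 1 \<tau> = - ((hauptmodul4_num q - t * q) / q)"
        using q0 z \<tau> by (simp add: f01 hauptmodul4_eq_num[OF \<tau>] t_def q_def field_simps)
      show "f4 0 1 z \<noteq> f4 0 1 \<tau>" using diff ne q0 by auto
      define G where "G = hauptmodul4_theta z * weight2_power (- l) z"
      define S where "S = G * (weight2_num_power l q / (hauptmodul4_num q - t * q))"
      have "((\<lambda>n. G * (poly (g4_poly l n) t * q ^ n)) has_sum S) UNIV"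
        unfolding S_def g4_poly_def q_def
        by (intro has_sum_cmult_right kernel_poly_generating[OF hol holomorphic_weight2_num_power r q])
      moreover have "g4 (2 - k) (l + 1 + int n) z = G * poly (g4_poly l n) t" for n
        using g4_formula[of l n] by (simp add: assms t_def G_def algebra_simps)
      ultimately have "((\<lambda>n. g4 (2 - k) (l + 1 + int n) z * q ^ n) has_sum S) UNIV"
        by (simp add: mult.assoc)
      hence "((\<lambda>m. g4 (2 - k) m z * q powi m) has_sum q powi (l + 1) * S) {l + 1..}"
        by (subst has_sum_powi_shift[OF q0])
      also have "q powi (l + 1) * S = - (f4 k (- l) \<tau> * g4 (2 - k) (l + 1) z / (f4 0 1 z - f4 0 1 \<tau>))"
        using q0 unfolding diff S_def assms f4_first g4_first weight2_power_eq_num[OF \<tau>] q_def[symmetric] G_def[symmetric]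
        by (simp add: power_int_add)
      finally show "((\<lambda>m. g4 (2 - k) m z * qpar \<tau> powi m) has_sum
           - (f4 k (- l) \<tau> * g4 (2 - k) (l + 1) z / (f4 0 1 z - f4 0 1 \<tau>))) {l + 1..}"
        by (simp add: q_def)
    qed
  }
qed

end
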